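(* Let $d\ge 3$. Let $\mathbb G=\ 0\to G^0\to G^1\to\cdots\to G^r\to 0$ be a complex of free graded $S$-modules and homogeneous maps such that $H^i(\mathbb G)$ has finite length for all $i$. Then $\mathfrak q_i\subseteq\operatorname{ann}_S H^i(\mathbb G)$ for $0\le i\le d-1$.
   Context: Let $q=p^s$ be a power of a prime $p$, $\mathbb F_q$ the field with $q$ elements, $V$ a $d$-dimensional $\mathbb F_q$-vector space, and $G$ a subgroup of $GL(V)$. Let $R=\mathbb F_q[V]=\operatorname{Sym}_{\mathbb F_q}(V^* )$, graded with $V^*$ in degree $1$, with the natural action of $G$, and let $S=R^G$; $S_+$ is the ideal of $S$ generated by homogeneous elements of positive degree, and $H^j_{S_+}(S)$ is the $j$-th local cohomology module. $S$ contains the Dickson algebra $D^*(d)=R^{GL(V)}$, which is the polynomial ring $\mathbb F_q[\mathbf d_{d,0},\ldots,\mathbf d_{d,d-1}]$, where $\mathbf d_{d,i}$ ($0\le i\le d-1$) is the Dickson polynomial of degree $q^d-q^i$, given by $\prod_{v\in V^*}(X+v)=X^{q^d}+\sum_{i=0}^{d-1}(-1)^{d-i}\mathbf d_{d,i}X^{q^i}$. For $0\le j\le d-1$ let $a_j\ge 0$ be the smallest integer such that $(\mathbf d_{d,0},\mathbf d_{d,1},\mathbf d_{d,2})^{a_j}\subseteq\operatorname{ann}_S H^j_{S_+}(S)$ (ideal powers in $S$; such an integer exists), and for $0\le i\le d-1$ set $\mathfrak q_i=\prod_{j=0}^{i}(\mathbf d_{d,0},\mathbf d_{d,1},\mathbf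 d_{d,2})^{a_j}$, an ideal of $S$. *)

theory Defs
  imports
    "HOL-Analysis.Cartesian_Space"
    "HOL-Computational_Algebra.Polynomial"
    "HOL-Library.Poly_Mapping"
    "HOL-Algebra.Module"
    "HOL-Algebra.Ideal_Product"
begin

section \<open>Polynomial invariants over a finite field\<close>

text \<open>
  The vector space \<open>V\<close> is \<open>'k ^ 'n\<close>, so that \<open>q = CARD('k)\<close> and \<open>d = CARD('n)\<close>.  Its symmetric
  algebra \<open>Sym(V\<^sup>*)\<close> is the polynomial ring in the coordinate functionals \<open>x\<^sub>i\<close>; monomials are
  exponent vectors \<open>'n \<Rightarrow>\<^sub>0 nat\<close>.
\<close>

type_synonym ('n, 'k) mpoly = "('n \<Rightarrow>\<^sub>0 nat) \<Rightarrow>\<^sub>0 'k"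

definition homogeneous :: "nat \<Rightarrow> ('n::finite, 'k::zero) mpoly \<Rightarrow> bool" where
  "homogeneous n f \<longleftrightarrow> (\<forall>m\<in>Poly_Mapping.keys f. (\<Sum>i\<in>UNIV. Poly_Mapping.lookup m i) = n)"

definition mpoly_subst ::
    "('n \<Rightarrow> ('n, 'k) mpoly) \<Rightarrow> ('n::finite, 'k::comm_ring_1) mpoly \<Rightarrow> ('n, 'k) mpoly" where
  "mpoly_subst \<sigma> f =
     (\<Sum>m\<in>Poly_Mapping.keys f.
        Poly_Mapping.single 0 (Poly_Mapping.lookup f m)
          * (\<Prod>i\<in>UNIV. \<sigma> i ^ Poly_Mapping.lookup m i))"

text \<open>The functional \<open>v \<mapsto> \<Sum>\<^sub>i c\<^sub>i v\<^sub>i\<close>, as an element of degree 1; the dual space is the range.\<close>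

definition linear_form :: "'k::comm_ring_1 ^ 'n::finite \<Rightarrow> ('n, 'k) mpoly" where
  "linear_form c = (\<Sum>i\<in>UNIV. Poly_Mapping.single (Poly_Mapping.single i 1) (c $ i))"

definition GL :: "('k::field ^ 'n::finite ^ 'n) monoid" where
  "GL = \<lparr>carrier = {A. invertible A}, mult = (**), one = mat 1\<rparr>"

text \<open>\<open>(g \<cdot> f)(v) = f(g\<^sup>-\<^sup>1 v)\<close>; the \<open>i\<close>-th coordinate of \<open>g\<^sup>-\<^sup>1 v\<close> is given by the \<open>i\<close>-th row of \<open>g\<^sup>-\<^sup>1\<close>.\<close>

definition GL_action ::
    "'k::field ^ 'n::finite ^ 'n \<Rightarrow> ('n, 'k) mpoly \<Rightarrow> ('n, 'k) mpoly" where
  "GL_action g f = mpoly_subst (\<lambda>i. linear_form (matrix_inv g $ i)) f"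

definition invariant_ring :: "('k::field ^ 'n::finite ^ 'n) set \<Rightarrow> ('n, 'k) mpoly ring" where
  "invariant_ring G =
     \<lparr>carrier = {f. \<forall>g\<in>G. GL_action g f = f}, mult = (*), one = 1, zero = 0, add = (+)\<rparr>"

definition invariant_degree ::
    "('k::field ^ 'n::finite ^ 'n) set \<Rightarrow> nat \<Rightarrow> ('n, 'k) mpoly set" where
  "invariant_degree G n = {f \<in> carrier (invariant_ring G). homogeneous n f}"

definition irrelevant_ideal :: "('k::field ^ 'n::finite ^ 'n) set \<Rightarrow> ('n, 'k) mpoly set" where
  "irrelevant_ideal G = genideal (invariant_ring G) (\<Union>n\<in>{0<..}. invariant_degree G n)"

text \<open>
  \<open>dickson i\<close> is \<open>d\<^sub>d\<^sub>,\<^sub>i\<close>, read off from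
  \<open>\<Prod>\<^bsub>v \<in> V\<^sup>*\<^esub> (X + v) = X^(q^d) + (\<Sum>i<d. (-1)^(d - i) d\<^sub>d\<^sub>,\<^sub>i X^(q^i))\<close>; it is meant for \<open>i < d\<close>.
\<close>

definition dickson :: "nat \<Rightarrow> ('n::finite, 'k::{field,finite}) mpoly" where
  "dickson i =
     (-1) ^ (CARD('n) - i)
       * coeff (\<Prod>v\<in>range (linear_form :: 'k ^ 'n \<Rightarrow> ('n, 'k) mpoly). [:v, 1:]) (CARD('k) ^ i)"

definition dickson_ideal ::
    "('k::{field,finite} ^ 'n::finite ^ 'n) set \<Rightarrow> ('n, 'k) mpoly set" where
  "dickson_ideal G = genideal (invariant_ring G) {dickson 0, dickson 1, dickson 2}"


section \<open>Modules\<close>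

definition linear_hom ::
    "('a, 'r) ring_scheme \<Rightarrow> ('a, 'b, 'm) module_scheme \<Rightarrow> ('a, 'c, 'n) module_scheme \<Rightarrow> ('b \<Rightarrow> 'c) set"
  where
  "linear_hom R M N =
     {f \<in> hom (add_monoid M) (add_monoid N).
        \<forall>r\<in>carrier R. \<forall>x\<in>carrier M. f (r \<odot>\<^bsub>M\<^esub> x) = r \<odot>\<^bsub>N\<^esub> f x}"

definition regular_module :: "('a, 'r) ring_scheme \<Rightarrow> ('a, 'a) module" where
  "regular_module R =
     \<lparr>carrier = carrier R, mult = mult R, one = one R, zero = zero R, add = add R, smult = mult R\<rparr>"

text \<open>The fields \<open>mult\<close> and \<open>one\<close> play no role for modules.\<close>

definition quotient_module ::
    "('a, 'b, 'm) module_scheme \<Rightarrow> 'b set \<Rightarrow> ('a, 'b set) module" where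
  "quotient_module M N =
     \<lparr>carrier = a_rcosets\<^bsub>M\<^esub> N, mult = undefined, one = undefined, zero = N, add = set_add M,
      smult = (\<lambda>r X. \<Union>x\<in>X. N +>\<^bsub>M\<^esub> (r \<odot>\<^bsub>M\<^esub> x))\<rparr>"

definition annihilator :: "('a, 'r) ring_scheme \<Rightarrow> ('a, 'b, 'm) module_scheme \<Rightarrow> 'a set" where
  "annihilator R M = {r \<in> carrier R. \<forall>x\<in>carrier M. r \<odot>\<^bsub>M\<^esub> x = \<zero>\<^bsub>M\<^esub>}"

text \<open>Existence of a composition series.\<close>

definition finite_length :: "('a, 'r) ring_scheme \<Rightarrow> ('a, 'b, 'm) module_scheme \<Rightarrow> bool" where
  "finite_length R M \<longleftrightarrow>
     (\<exists>n N. N (0::nat) = {\<zero>\<^bsub>M\<^esub>} \<and> N n = carrier M \<and> (\<forall>i\<le>n. submodule (N i) R M) \<and>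
        (\<forall>i<n. N i \<subset> N (Suc i) \<and>
           \<not> (\<exists>L. submodule L R M \<and> N i \<subset> L \<and> L \<subset> N (Suc i))))"

definition module_basis :: "('a, 'r) ring_scheme \<Rightarrow> ('a, 'b, 'm) module_scheme \<Rightarrow> 'b set \<Rightarrow> bool"
  where
  "module_basis R M B \<longleftrightarrow> B \<subseteq> carrier M \<and>
     (\<forall>x\<in>carrier M. \<exists>!c. range c \<subseteq> carrier R \<and> (\<forall>b. b \<notin> B \<longrightarrow> c b = \<zero>\<^bsub>R\<^esub>) \<and>
        finite {b. c b \<noteq> \<zero>\<^bsub>R\<^esub>} \<and> x = (\<Oplus>\<^bsub>M\<^esub>b\<in>{b. c b \<noteq> \<zero>\<^bsub>R\<^esub>}. c b \<odot>\<^bsub>M\<^esub> b))"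


section \<open>Graded modules\<close>

text \<open>
  \<open>Rg n\<close> and \<open>Mg n\<close> are the homogeneous components of degree \<open>n\<close> of the \<open>\<nat>\<close>-graded ring \<open>R\<close> and of
  the \<open>\<int>\<close>-graded module \<open>M\<close>.
\<close>

definition graded_module ::
    "('a, 'r) ring_scheme \<Rightarrow> (nat \<Rightarrow> 'a set) \<Rightarrow> ('a, 'b, 'm) module_scheme \<Rightarrow> (int \<Rightarrow> 'b set) \<Rightarrow> bool"
  where
  "graded_module R Rg M Mg \<longleftrightarrow> Module.module R M \<and>
     (\<forall>n. subgroup (Mg n) (add_monoid M)) \<and>
     (\<forall>m n. \<forall>r\<in>Rg m. \<forall>x\<in>Mg n. r \<odot>\<^bsub>M\<^esub> x \<in> Mg (int m + n)) \<and>
     (\<forall>x\<in>carrier M. \<exists>!c. (\<forall>n. c n \<in> Mg n) \<and> finite {n. c n \<noteq> \<zero>\<^bsub>M\<^esub>} \<and>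
        x = (\<Oplus>\<^bsub>M\<^esub>n\<in>{n. c n \<noteq> \<zero>\<^bsub>M\<^esub>}. c n))"

text \<open>A direct sum, of arbitrary rank, of degree shifts of \<open>R\<close>: there is a basis of homogeneous elements.\<close>

definition free_graded_module ::
    "('a, 'r) ring_scheme \<Rightarrow> (nat \<Rightarrow> 'a set) \<Rightarrow> ('a, 'b, 'm) module_scheme \<Rightarrow> (int \<Rightarrow> 'b set) \<Rightarrow> bool"
  where
  "free_graded_module R Rg M Mg \<longleftrightarrow> graded_module R Rg M Mg \<and>
     (\<exists>B \<subseteq> (\<Union>n. Mg n). module_basis R M B)"

definition homogeneous_map :: "(int \<Rightarrow> 'b set) \<Rightarrow> (int \<Rightarrow> 'c set) \<Rightarrow> ('b \<Rightarrow> 'c) \<Rightarrow> bool" where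
  "homogeneous_map Mg Ng f \<longleftrightarrow> (\<exists>e. \<forall>n. f ` Mg n \<subseteq> Ng (n + e))"


section \<open>Cochain complexes and local cohomology\<close>

definition cochain_complex ::
    "('a, 'r) ring_scheme \<Rightarrow> (nat \<Rightarrow> ('a, 'b, 'm) module_scheme) \<Rightarrow> (nat \<Rightarrow> 'b \<Rightarrow> 'b) \<Rightarrow> bool" where
  "cochain_complex R C \<delta> \<longleftrightarrow> (\<forall>i. Module.module R (C i)) \<and>
     (\<forall>i. \<delta> i \<in> linear_hom R (C i) (C (Suc i))) \<and>
     (\<forall>i. \<forall>x\<in>carrier (C i). \<delta> (Suc i) (\<delta> i x) = \<zero>\<^bsub>C (Suc (Suc i))\<^esub>)"

definition cocycles ::
    "(nat \<Rightarrow> ('a, 'b, 'm) module_scheme) \<Rightarrow> (nat \<Rightarrow> 'b \<Rightarrow> 'b) \<Rightarrow> nat \<Rightarrow> 'b set" where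
  "cocycles C \<delta> i = a_kernel (C i) (C (Suc i)) (\<delta> i)"

definition coboundaries ::
    "(nat \<Rightarrow> ('a, 'b, 'm) module_scheme) \<Rightarrow> (nat \<Rightarrow> 'b \<Rightarrow> 'b) \<Rightarrow> nat \<Rightarrow> 'b set" where
  "coboundaries C \<delta> i = (case i of 0 \<Rightarrow> {\<zero>\<^bsub>C 0\<^esub>} | Suc k \<Rightarrow> \<delta> k ` carrier (C k))"

definition cohomology ::
    "(nat \<Rightarrow> ('a, 'b, 'm) module_scheme) \<Rightarrow> (nat \<Rightarrow> 'b \<Rightarrow> 'b) \<Rightarrow> nat \<Rightarrow> ('a, 'b set) module" where
  "cohomology C \<delta> i = quotient_module ((C i)\<lparr>carrier := cocycles C \<delta> i\<rparr>) (coboundaries C \<delta> i)"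

text \<open>
  HOL cannot quantify over the element types of the test modules \<open>A \<rightarrowtail> B\<close>.  They range over the
  type \<open>'a + 'b\<close>, which has room for copies of the ideals of \<open>R\<close>; hence, by Baer's criterion, the
  choice of this type does not affect the notion.
\<close>

definition injective_module :: "('a, 'r) ring_scheme \<Rightarrow> ('a, 'b) module \<Rightarrow> bool" where
  "injective_module R E \<longleftrightarrow> Module.module R E \<and>
     (\<forall>(A :: ('a, 'a + 'b) module) (B :: ('a, 'a + 'b) module) f g.
        Module.module R A \<and> Module.module R B \<and>
        f \<in> linear_hom R A B \<and> inj_on f (carrier A) \<and> g \<in> linear_hom R A E \<longrightarrow>
        (\<exists>h\<in>linear_hom R B E. \<forall>x\<in>carrier A. h (f x) = g x))"

definition injective_resolution ::
    "('a, 'r) ring_scheme \<Rightarrow> ('a, 'c) module \<Rightarrow> (nat \<Rightarrow> ('a, 'b) module) \<Rightarrow> ('c \<Rightarrow> 'b) \<Rightarrow>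
     (nat \<Rightarrow> 'b \<Rightarrow> 'b) \<Rightarrow> bool" where
  "injective_resolution R M E \<epsilon> \<delta> \<longleftrightarrow> cochain_complex R E \<delta> \<and> (\<forall>p. injective_module R (E p)) \<and>
     \<epsilon> \<in> linear_hom R M (E 0) \<and> inj_on \<epsilon> (carrier M) \<and> \<epsilon> ` carrier M = cocycles E \<delta> 0 \<and>
     (\<forall>p. cocycles E \<delta> (Suc p) = coboundaries E \<delta> (Suc p))"

definition torsion_submodule ::
    "('a, 'r) ring_scheme \<Rightarrow> 'a set \<Rightarrow> ('a, 'b, 'm) module_scheme \<Rightarrow> 'b set" where
  "torsion_submodule R I M =
     {x \<in> carrier M. \<exists>n::nat. \<forall>a \<in> I [^]\<^bsub>ideals_set R\<^esub> n. a \<odot>\<^bsub>M\<^esub> x = \<zero>\<^bsub>M\<^esub>}"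

text \<open>
  The right derived functors of the \<open>I\<close>-torsion functor: if \<open>(E, \<delta>)\<close> is an injective resolution of
  \<open>M\<close>, this is \<open>H\<^sup>j\<^sub>I(M)\<close>.
\<close>

definition local_cohomology ::
    "('a, 'r) ring_scheme \<Rightarrow> 'a set \<Rightarrow> (nat \<Rightarrow> ('a, 'b) module) \<Rightarrow> (nat \<Rightarrow> 'b \<Rightarrow> 'b) \<Rightarrow> nat \<Rightarrow>
     ('a, 'b set) module" where
  "local_cohomology R I E \<delta> j = cohomology (\<lambda>p. (E p)\<lparr>carrier := torsion_submodule R I (E p)\<rparr>) \<delta> j"

end

theory Submission
  imports Defs "HOL-Algebra.Ring_Divisibility"
begin

text \<open>
  Let \<open>S\<close> be the ring of invariants, \<open>\<mm>\<close> its irrelevant ideal and \<open>E\<close> the injective resolution of \<open>S\<close>.  After a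
  choice of bases the complex \<open>C\<close> is given by matrices over \<open>S\<close>.  These act on the double complex \<open>T\<close> whose
  module \<open>T\<^sup>p\<^sup>q\<close>, the tensor product of \<open>C\<^sup>p\<close> and \<open>E\<^sup>q\<close>, consists of the finitely supported families of
  elements of \<open>E\<^sup>q\<close> indexed by the basis of \<open>C\<^sup>p\<close>.  The proof compares \<open>T\<close> with its \<open>\<mm>\<close>-torsion
  \<open>\<Gamma>T\<close>, which consists of the families with torsion entries.

  The columns of \<open>T\<close> resolve the modules \<open>C\<^sup>p\<close>, and the columns of \<open>\<Gamma>T\<close> have as cohomology direct sums of copies
  of the local cohomology of \<open>S\<close>.  The rows of the quotient of \<open>T\<close> by \<open>\<Gamma>T\<close> are exact.  Hence a cocycle of
  degree \<open>i\<close> of \<open>C\<close>, viewed in \<open>T\<^sup>i\<^sup>0\<close>, is cohomologous in the total complex of \<open>T\<close> to a sum of torsion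
  families in the positions \<open>(i, 0), (i - 1, 1), \<dots>, (0, i)\<close>.  A factor that annihilates the \<open>q\<close>-th local
  cohomology removes the summand with second index \<open>q\<close>, so that the product of the factors for \<open>q \<le> i\<close> makes the
  cocycle a coboundary.  This is the comparison of two spectral sequences; here it is one induction, in
  \<open>ideal_prod_from_lifts\<close>.

  The exactness of the rows modulo torsion (\<open>row_exact_mod_torsion\<close>) has two sources.
  \<^item> Since the cohomology of \<open>C\<close> has finite length and is graded, it lives in finitely many degrees, and so
    every \<open>x\<close> in \<open>\<mm>\<close> acts nilpotently on it (\<open>finite_length_imp_nilpotent\<close>).  As \<open>C\<close> is bounded and free,
    some power of \<open>x\<close> is then null-homotopic on \<open>C\<close> (\<open>null_homotopic_power\<close>).  A homotopy is a family of
    matrices, hence it acts on every row of \<open>T\<close>.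
  \<^item> For a finitely generated submodule \<open>F\<close> of an injective module over a Noetherian ring there is an
    endomorphism \<open>\<rho>\<close> such that \<open>f - \<rho> (x f)\<close> is \<open>x\<close>-torsion for all \<open>f\<close> in \<open>F\<close>
    (\<open>injective_module_torsion_splitting\<close>): multiplication by \<open>x\<close> can be undone up to torsion.
  Together they write each cocycle of a row, up to torsion, as a coboundary; this is done for a finite set
  of generators \<open>x\<close> of \<open>\<mm>\<close>, one after the other.

  The ring \<open>S\<close> is Noetherian (\<open>invariant_ring_noetherian\<close>) because the polynomial ring is a finitely generated
  module over the algebra generated by the coefficients of the product of all \<open>X + v\<close>, where \<open>v\<close> runs through the
  linear forms: these coefficients are invariant, and every variable is integral over them.  The same
  invariance shows that the Dickson polynomials lie in \<open>S\<close>.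
\<close>

section \<open>Finitely generated modules over Noetherian rings\<close>

lemma (in cring) ideal_of_closed:
  assumes "J \<subseteq> carrier R" "\<zero> \<in> J"
    and add: "\<And>a b. \<lbrakk>a \<in> J; b \<in> J\<rbrakk> \<Longrightarrow> a \<oplus> b \<in> J"
    and mult: "\<And>a x. \<lbrakk>a \<in> carrier R; x \<in> J\<rbrakk> \<Longrightarrow> a \<otimes> x \<in> J"
  shows "ideal J R"
proof (rule idealI)
  show "ring R" by (rule ring_axioms)
  show "subgroup J (add_monoid R)"
  proof (rule group.subgroupI)
    show "group (add_monoid R)" by (rule add.is_group)
    fix a assume a: "a \<in> J"
    have "(\<ominus> \<one>) \<otimes> a \<in> J" using a by (intro mult) auto
    moreover have "(\<ominus> \<one>) \<otimes> a = inv\<^bsub>add_monoid R\<^esub> a"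
      using a assms(1) by (metis a_inv_def l_minus l_one one_closed subsetD)
    ultimately show "inv\<^bsub>add_monoid R\<^esub> a \<in> J" by simp
  qed (use assms in auto)
  fix a x assume "a \<in> J" "x \<in> carrier R"
  then show "x \<otimes> a \<in> J" and "a \<otimes> x \<in> J"
    using mult assms(1) m_comm by (metis subsetD)+
qed

lemma (in module) submodule_of_closed:
  assumes "H \<subseteq> carrier M" "\<zero>\<^bsub>M\<^esub> \<in> H"
    and add: "\<And>a b. \<lbrakk>a \<in> H; b \<in> H\<rbrakk> \<Longrightarrow> a \<oplus>\<^bsub>M\<^esub> b \<in> H"
    and smult: "\<And>a x. \<lbrakk>a \<in> carrier R; x \<in> H\<rbrakk> \<Longrightarrow> a \<odot>\<^bsub>M\<^esub> x \<in> H"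
  shows "submodule H R M"
proof (rule submoduleI)
  fix a assume a: "a \<in> H"
  have "(\<ominus> \<one>) \<odot>\<^bsub>M\<^esub> a \<in> H" using a by (intro smult) auto
  moreover have "(\<ominus> \<one>) \<odot>\<^bsub>M\<^esub> a = \<ominus>\<^bsub>M\<^esub> a"
    using a assms(1) smult_l_minus[of \<one> a] by auto
  ultimately show "\<ominus>\<^bsub>M\<^esub> a \<in> H" by simp
qed (use assms in auto)

lemma (in abelian_group) minus_add_add:
  assumes "x \<in> carrier G" "y \<in> carrier G" "u \<in> carrier G"
  shows "(x \<ominus> y) \<oplus> (u \<oplus> y) = u \<oplus> x"
proof -
  have "(x \<ominus> y) \<oplus> (u \<oplus> y) = (u \<oplus> x) \<oplus> (\<ominus> y \<oplus> y)"
    using assms by (simp add: a_minus_def a_ac)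
  then show ?thesis using assms by (simp add: l_neg)
qed

lemma (in abelian_group) minus_add_cancel:
  assumes "x \<in> carrier G" "y \<in> carrier G"
  shows "(x \<ominus> y) \<oplus> y = x"
  using assms by (simp add: a_minus_def a_assoc l_neg)

lemma (in abelian_group) minus_eqI:
  assumes "x = d \<oplus> z" "d \<in> carrier G" "z \<in> carrier G"
  shows "d = x \<ominus> z"
  using assms by (simp add: a_minus_def a_assoc r_neg)

lemma (in module) submodule_zero:
  assumes "submodule H R M" shows "\<zero>\<^bsub>M\<^esub> \<in> H"
  using submoduleE(2)[OF assms] submoduleE(4)[OF assms, of \<zero>] submoduleE(1)[OF assms]
  by (metis R.zero_closed all_not_in_conv smult_l_null subsetD)

lemma (in module) submodule_diff:
  assumes "submodule H R M" "a \<in> H" "b \<in> H" shows "a \<ominus>\<^bsub>M\<^esub> b \<in> H"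
  using submoduleE[OF assms(1)] assms(2,3) by (simp add: a_minus_def)

primrec lin_span :: "('a, 'r) ring_scheme \<Rightarrow> ('a, 'b, 'm) module_scheme \<Rightarrow> 'b list \<Rightarrow> 'b set" where
  "lin_span R M [] = {\<zero>\<^bsub>M\<^esub>}"
| "lin_span R M (e # es) =
     {a \<odot>\<^bsub>M\<^esub> e \<oplus>\<^bsub>M\<^esub> f | a f. a \<in> carrier R \<and> f \<in> lin_span R M es}"

context module
begin

lemma submodule_lin_comb:
  assumes "submodule F R M" "e \<in> carrier M"
  shows "submodule {a \<odot>\<^bsub>M\<^esub> e \<oplus>\<^bsub>M\<^esub> f | a f. a \<in> carrier R \<and> f \<in> F} R M"
proof (rule submodule_of_closed)
  note F = submoduleE[OF assms(1)] submodule_zero[OF assms(1)]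
  show "{a \<odot>\<^bsub>M\<^esub> e \<oplus>\<^bsub>M\<^esub> f | a f. a \<in> carrier R \<and> f \<in> F} \<subseteq> carrier M"
    using F(1) assms(2) by auto
  show "\<zero>\<^bsub>M\<^esub> \<in> {a \<odot>\<^bsub>M\<^esub> e \<oplus>\<^bsub>M\<^esub> f | a f. a \<in> carrier R \<and> f \<in> F}"
    using submodule_zero[OF assms(1)] assms(2)
    by (auto intro!: exI[of _ \<zero>] exI[of _ "\<zero>\<^bsub>M\<^esub>"])
  fix x y assume "x \<in> {a \<odot>\<^bsub>M\<^esub> e \<oplus>\<^bsub>M\<^esub> f | a f. a \<in> carrier R \<and> f \<in> F}"
    "y \<in> {a \<odot>\<^bsub>M\<^esub> e \<oplus>\<^bsub>M\<^esub> f | a f. a \<in> carrier R \<and> f \<in> F}"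
  then obtain a f b g where *: "a \<in> carrier R" "f \<in> F" "b \<in> carrier R" "g \<in> F"
    "x = a \<odot>\<^bsub>M\<^esub> e \<oplus>\<^bsub>M\<^esub> f" "y = b \<odot>\<^bsub>M\<^esub> e \<oplus>\<^bsub>M\<^esub> g" by auto
  have "x \<oplus>\<^bsub>M\<^esub> y = (a \<oplus> b) \<odot>\<^bsub>M\<^esub> e \<oplus>\<^bsub>M\<^esub> (f \<oplus>\<^bsub>M\<^esub> g)"
    using * assms(2) F(1) by (simp add: smult_l_distr M.a_ac subset_iff)
  then show "x \<oplus>\<^bsub>M\<^esub> y \<in> {a \<odot>\<^bsub>M\<^esub> e \<oplus>\<^bsub>M\<^esub> f | a f. a \<in> carrier R \<and> f \<in> F}"
    using * F(5) by blast
next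
  note F = submoduleE[OF assms(1)]
  fix c x assume c: "c \<in> carrier R"
    and "x \<in> {a \<odot>\<^bsub>M\<^esub> e \<oplus>\<^bsub>M\<^esub> f | a f. a \<in> carrier R \<and> f \<in> F}"
  then obtain a f where *: "a \<in> carrier R" "f \<in> F" "x = a \<odot>\<^bsub>M\<^esub> e \<oplus>\<^bsub>M\<^esub> f" by auto
  have "c \<odot>\<^bsub>M\<^esub> x = (c \<otimes> a) \<odot>\<^bsub>M\<^esub> e \<oplus>\<^bsub>M\<^esub> c \<odot>\<^bsub>M\<^esub> f"
    using * assms(2) F(1) c by (simp add: smult_r_distr smult_assoc1 subset_iff)
  then show "c \<odot>\<^bsub>M\<^esub> x \<in> {a \<odot>\<^bsub>M\<^esub> e \<oplus>\<^bsub>M\<^esub> f | a f. a \<in> carrier R \<and> f \<in> F}"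
    using * F(4) c by blast
qed

lemma submodule_lin_span: "set es \<subseteq> carrier M \<Longrightarrow> submodule (lin_span R M es) R M"
proof (induction es)
  case Nil
  show ?case by (rule submodule_of_closed) auto
next
  case (Cons e es)
  then show ?case using submodule_lin_comb by simp
qed

lemma lin_span_mem: "set es \<subseteq> carrier M \<Longrightarrow> e \<in> set es \<Longrightarrow> e \<in> lin_span R M es"
proof (induction es)
  case (Cons d es)
  note S = submodule_lin_span[of es]
  have z: "\<zero>\<^bsub>M\<^esub> \<in> lin_span R M es" using S Cons.prems submodule_zero by auto
  show ?case
  proof (cases "e = d")
    case True
    have "e = \<one> \<odot>\<^bsub>M\<^esub> e \<oplus>\<^bsub>M\<^esub> \<zero>\<^bsub>M\<^esub>" using Cons.prems by auto
    then show ?thesis using z True by auto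
  next
    case False
    then have e: "e \<in> lin_span R M es" using Cons by auto
    have "e = \<zero> \<odot>\<^bsub>M\<^esub> d \<oplus>\<^bsub>M\<^esub> e" using Cons.prems by auto
    then show ?thesis using e R.zero_closed by auto
  qed
qed simp

lemma lin_span_subset:
  assumes "submodule H R M" shows "set es \<subseteq> H \<Longrightarrow> lin_span R M es \<subseteq> H"
proof (induction es)
  case Nil show ?case using submodule_zero[OF assms] by simp
next
  case (Cons e es)
  then show ?case using submoduleE(4,5)[OF assms] by auto
qed

lemma leading_coeffs_ideal:
  assumes "submodule F R M" "submodule N R M" "e \<in> carrier M"
  shows "ideal {a \<in> carrier R. \<exists>f\<in>F. a \<odot>\<^bsub>M\<^esub> e \<oplus>\<^bsub>M\<^esub> f \<in> N} R"
proof (rule R.ideal_of_closed)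
  note F = submoduleE[OF assms(1)] and N = submoduleE[OF assms(2)]
  show "{a \<in> carrier R. \<exists>f\<in>F. a \<odot>\<^bsub>M\<^esub> e \<oplus>\<^bsub>M\<^esub> f \<in> N} \<subseteq> carrier R" by auto
  show "\<zero> \<in> {a \<in> carrier R. \<exists>f\<in>F. a \<odot>\<^bsub>M\<^esub> e \<oplus>\<^bsub>M\<^esub> f \<in> N}"
    using submodule_zero[OF assms(1)] submodule_zero[OF assms(2)] assms(3)
    by (auto intro!: bexI[of _ "\<zero>\<^bsub>M\<^esub>"])
next
  note F = submoduleE[OF assms(1)] and N = submoduleE[OF assms(2)]
  fix a b assume "a \<in> {a \<in> carrier R. \<exists>f\<in>F. a \<odot>\<^bsub>M\<^esub> e \<oplus>\<^bsub>M\<^esub> f \<in> N}"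
    "b \<in> {a \<in> carrier R. \<exists>f\<in>F. a \<odot>\<^bsub>M\<^esub> e \<oplus>\<^bsub>M\<^esub> f \<in> N}"
  then obtain f g where *: "a \<in> carrier R" "f \<in> F" "b \<in> carrier R" "g \<in> F"
    "a \<odot>\<^bsub>M\<^esub> e \<oplus>\<^bsub>M\<^esub> f \<in> N" "b \<odot>\<^bsub>M\<^esub> e \<oplus>\<^bsub>M\<^esub> g \<in> N" by auto
  have "(a \<odot>\<^bsub>M\<^esub> e \<oplus>\<^bsub>M\<^esub> f) \<oplus>\<^bsub>M\<^esub> (b \<odot>\<^bsub>M\<^esub> e \<oplus>\<^bsub>M\<^esub> g) = (a \<oplus> b) \<odot>\<^bsub>M\<^esub> e \<oplus>\<^bsub>M\<^esub> (f \<oplus>\<^bsub>M\<^esub> g)"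
    using * assms(3) F(1) by (simp add: smult_l_distr M.a_ac subset_iff)
  then have "(a \<oplus> b) \<odot>\<^bsub>M\<^esub> e \<oplus>\<^bsub>M\<^esub> (f \<oplus>\<^bsub>M\<^esub> g) \<in> N" using * N(5) by metis
  then show "a \<oplus> b \<in> {a \<in> carrier R. \<exists>f\<in>F. a \<odot>\<^bsub>M\<^esub> e \<oplus>\<^bsub>M\<^esub> f \<in> N}"
    using * F(5) by auto
next
  note F = submoduleE[OF assms(1)] and N = submoduleE[OF assms(2)]
  fix c a assume c: "c \<in> carrier R" and "a \<in> {a \<in> carrier R. \<exists>f\<in>F. a \<odot>\<^bsub>M\<^esub> e \<oplus>\<^bsub>M\<^esub> f \<in> N}"
  then obtain f where *: "a \<in> carrier R" "f \<in> F" "a \<odot>\<^bsub>M\<^esub> e \<oplus>\<^bsub>M\<^esub> f \<in> N" by auto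
  have "c \<odot>\<^bsub>M\<^esub> (a \<odot>\<^bsub>M\<^esub> e \<oplus>\<^bsub>M\<^esub> f) = (c \<otimes> a) \<odot>\<^bsub>M\<^esub> e \<oplus>\<^bsub>M\<^esub> c \<odot>\<^bsub>M\<^esub> f"
    using * assms(3) F(1) c by (simp add: smult_r_distr smult_assoc1 subset_iff)
  then have "(c \<otimes> a) \<odot>\<^bsub>M\<^esub> e \<oplus>\<^bsub>M\<^esub> c \<odot>\<^bsub>M\<^esub> f \<in> N" using * N(4) c by metis
  then show "c \<otimes> a \<in> {a \<in> carrier R. \<exists>f\<in>F. a \<odot>\<^bsub>M\<^esub> e \<oplus>\<^bsub>M\<^esub> f \<in> N}"
    using * F(4) c by auto
qed

text \<open>
  Induction on the number of generators: the coefficients at the first generator of the elements of \<open>N\<close> form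
  an ideal, which has finitely many generators.  Lifts of these to \<open>N\<close>, together with generators of the part of
  \<open>N\<close> in the span of the other generators, generate \<open>N\<close>.
\<close>

lemma noetherian_submodule_finitely_generated:
  assumes "noetherian_ring R"
  shows "set es \<subseteq> carrier M \<Longrightarrow> submodule N R M \<Longrightarrow> N \<subseteq> lin_span R M es \<Longrightarrow>
    \<exists>fs. set fs \<subseteq> N \<and> N = lin_span R M fs"
proof (induction es arbitrary: N)
  case Nil
  then have "N = {\<zero>\<^bsub>M\<^esub>}" using submodule_zero by auto
  then show ?case by (intro exI[of _ "[]"]) auto
next
  case (Cons e es)
  let ?F = "lin_span R M es"
  have e: "e \<in> carrier M" and es: "set es \<subseteq> carrier M" using Cons.prems by auto
  note F = submodule_lin_span[OF es]
  note N = Cons.prems(2)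
  have "submodule (N \<inter> ?F) R M"
    using submoduleE[OF N] submoduleE[OF F] submodule_zero[OF N] submodule_zero[OF F]
    by (intro submodule_of_closed) auto
  then obtain fs where fs: "set fs \<subseteq> N \<inter> ?F" "N \<inter> ?F = lin_span R M fs"
    using Cons.IH[OF es] by (metis Int_lower2)
  let ?J = "\<lambda>N. {a \<in> carrier R. \<exists>f\<in>?F. a \<odot>\<^bsub>M\<^esub> e \<oplus>\<^bsub>M\<^esub> f \<in> N}"
  obtain A where A: "A \<subseteq> carrier R" "finite A" "?J N = Idl A"
    using noetherian_ring.finetely_gen[OF assms leading_coeffs_ideal[OF F N e]] by auto
  have "A \<subseteq> ?J N" using R.genideal_self[OF A(1)] A(3) by simp
  then have "\<forall>a\<in>A. \<exists>f. f \<in> ?F \<and> a \<odot>\<^bsub>M\<^esub> e \<oplus>\<^bsub>M\<^esub> f \<in> N" by auto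
  then obtain g where g: "\<And>a. a \<in> A \<Longrightarrow> g a \<in> ?F \<and> a \<odot>\<^bsub>M\<^esub> e \<oplus>\<^bsub>M\<^esub> g a \<in> N" by metis
  obtain as where as: "set as = A" using A(2) finite_list by auto
  define hs where "hs = fs @ map (\<lambda>a. a \<odot>\<^bsub>M\<^esub> e \<oplus>\<^bsub>M\<^esub> g a) as"
  have hsN: "set hs \<subseteq> N" using fs(1) g as by (auto simp: hs_def)
  then have hsM: "set hs \<subseteq> carrier M" using submoduleE(1)[OF N] by auto
  note H = submodule_lin_span[OF hsM]
  have sub: "lin_span R M hs \<subseteq> N" by (rule lin_span_subset[OF N hsN])
  have "A \<subseteq> ?J (lin_span R M hs)"
    using g A(1) lin_span_mem[OF hsM] as by (fastforce simp: hs_def)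
  then have J: "?J N \<subseteq> ?J (lin_span R M hs)"
    using R.genideal_minimal[OF leading_coeffs_ideal[OF F H e]] A(3) by simp
  have fsH: "lin_span R M fs \<subseteq> lin_span R M hs"
    by (rule lin_span_subset[OF H]) (use lin_span_mem[OF hsM] in \<open>auto simp: hs_def\<close>)
  have "N \<subseteq> lin_span R M hs"
  proof
    fix n assume n: "n \<in> N"
    then obtain a f where af: "a \<in> carrier R" "f \<in> ?F" "n = a \<odot>\<^bsub>M\<^esub> e \<oplus>\<^bsub>M\<^esub> f"
      using Cons.prems(3) by auto
    then have "a \<in> ?J (lin_span R M hs)" using n J by blast
    then obtain f' where f': "f' \<in> ?F" "a \<odot>\<^bsub>M\<^esub> e \<oplus>\<^bsub>M\<^esub> f' \<in> lin_span R M hs" by auto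
    have c: "f \<in> carrier M" "f' \<in> carrier M" "n \<in> carrier M"
      using af f' submoduleE(1)[OF F] n submoduleE(1)[OF N] by auto
    have eq: "n \<ominus>\<^bsub>M\<^esub> (a \<odot>\<^bsub>M\<^esub> e \<oplus>\<^bsub>M\<^esub> f') = f \<ominus>\<^bsub>M\<^esub> f'"
      using c af e by (simp add: a_minus_def M.minus_add M.a_ac M.r_neg M.r_neg1 M.r_neg2)
    have "f \<ominus>\<^bsub>M\<^esub> f' \<in> N" using submodule_diff[OF N n] f' sub eq by (metis subsetD)
    moreover have "f \<ominus>\<^bsub>M\<^esub> f' \<in> ?F" using submodule_diff[OF F] af f' by auto
    ultimately have "f \<ominus>\<^bsub>M\<^esub> f' \<in> lin_span R M hs" using fs(2) fsH by auto
    then have "(f \<ominus>\<^bsub>M\<^esub> f') \<oplus>\<^bsub>M\<^esub> (a \<odot>\<^bsub>M\<^esub> e \<oplus>\<^bsub>M\<^esub> f') \<in> lin_span R M hs"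
      using submoduleE(5)[OF H] f' by auto
    moreover have "(f \<ominus>\<^bsub>M\<^esub> f') \<oplus>\<^bsub>M\<^esub> (a \<odot>\<^bsub>M\<^esub> e \<oplus>\<^bsub>M\<^esub> f') = n"
      using c af e M.minus_add_add[of f f' "a \<odot>\<^bsub>M\<^esub> e"] by simp
    ultimately show "n \<in> lin_span R M hs" by simp
  qed
  with sub hsN show ?case by auto
qed

lemma noetherian_chain_stationary:
  assumes "noetherian_ring R" "set es \<subseteq> carrier M"
    and N: "\<And>t::nat. submodule (N t) R M" "\<And>t. N t \<subseteq> N (Suc t)"
  shows "\<exists>T. \<forall>t. N t \<inter> lin_span R M es \<subseteq> N T"
proof -
  note F = submodule_lin_span[OF assms(2)]
  have mono: "s \<le> t \<Longrightarrow> N s \<subseteq> N t" for s t using N(2) lift_Suc_mono_le by metis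
  let ?U = "(\<Union>t. N t \<inter> lin_span R M es)"
  have "submodule ?U R M"
  proof (rule submodule_of_closed)
    show "?U \<subseteq> carrier M" using submoduleE(1)[OF F] by auto
    show "\<zero>\<^bsub>M\<^esub> \<in> ?U" using submodule_zero[OF F] submodule_zero[OF N(1)] by auto
    fix a b assume "a \<in> ?U" "b \<in> ?U"
    then obtain s t where "a \<in> N s" "b \<in> N t" and ab: "a \<in> lin_span R M es" "b \<in> lin_span R M es" by auto
    then have "a \<in> N (max s t)" "b \<in> N (max s t)" using mono by (meson max.cobounded1 max.cobounded2 subsetD)+
    then have "a \<oplus>\<^bsub>M\<^esub> b \<in> N (max s t) \<inter> lin_span R M es"
      using submoduleE(5)[OF N(1)] submoduleE(5)[OF F] ab by simp
    then show "a \<oplus>\<^bsub>M\<^esub> b \<in> ?U" by (rule UN_I[OF UNIV_I])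
  next
    fix a x assume "a \<in> carrier R" "x \<in> ?U"
    then show "a \<odot>\<^bsub>M\<^esub> x \<in> ?U" using submoduleE(4)[OF N(1)] submoduleE(4)[OF F] by auto
  qed
  then obtain fs where fs: "set fs \<subseteq> ?U" "?U = lin_span R M fs"
    using noetherian_submodule_finitely_generated[OF assms(1,2), of ?U] by (metis Int_lower2 UN_least)
  have "\<exists>T. set fs \<subseteq> N T" using fs(1)
  proof (induction fs)
    case (Cons f fs)
    then obtain T s where "set fs \<subseteq> N T" "f \<in> N s" by auto
    then have "set (f # fs) \<subseteq> N (max s T)" using mono[of s "max s T"] mono[of T "max s T"] by auto
    then show ?case by blast
  qed simp
  then obtain T where "set fs \<subseteq> N T" by blast
  then have "lin_span R M fs \<subseteq> N T" by (rule lin_span_subset[OF N(1)])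
  then show ?thesis using fs(2) by blast
qed

end

section \<open>Splitting torsion off injective modules\<close>

lemma linear_homI:
  assumes "\<And>x. x \<in> carrier M \<Longrightarrow> f x \<in> carrier N"
    and "\<And>x y. x \<in> carrier M \<Longrightarrow> y \<in> carrier M \<Longrightarrow> f (x \<oplus>\<^bsub>M\<^esub> y) = f x \<oplus>\<^bsub>N\<^esub> f y"
    and "\<And>r x. r \<in> carrier R \<Longrightarrow> x \<in> carrier M \<Longrightarrow> f (r \<odot>\<^bsub>M\<^esub> x) = r \<odot>\<^bsub>N\<^esub> f x"
  shows "f \<in> linear_hom R M N"
  using assms by (auto simp: linear_hom_def hom_def)

lemma linear_homD:
  assumes "f \<in> linear_hom R M N"
  shows "x \<in> carrier M \<Longrightarrow> f x \<in> carrier N"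
    and "x \<in> carrier M \<Longrightarrow> y \<in> carrier M \<Longrightarrow> f (x \<oplus>\<^bsub>M\<^esub> y) = f x \<oplus>\<^bsub>N\<^esub> f y"
    and "r \<in> carrier R \<Longrightarrow> x \<in> carrier M \<Longrightarrow> f (r \<odot>\<^bsub>M\<^esub> x) = r \<odot>\<^bsub>N\<^esub> f x"
  using assms by (auto simp: linear_hom_def hom_def)

lemma linear_hom_zero:
  assumes "module R M" "module R N" "f \<in> linear_hom R M N"
  shows "f \<zero>\<^bsub>M\<^esub> = \<zero>\<^bsub>N\<^esub>"
proof -
  interpret M: module R M by fact
  interpret N: module R N by fact
  have "f (\<zero>\<^bsub>R\<^esub> \<odot>\<^bsub>M\<^esub> \<zero>\<^bsub>M\<^esub>) = \<zero>\<^bsub>R\<^esub> \<odot>\<^bsub>N\<^esub> f \<zero>\<^bsub>M\<^esub>" by (rule linear_homD(3)[OF assms(3)]) auto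
  then show ?thesis using linear_homD(1)[OF assms(3)] by simp
qed

lemma linear_hom_uminus:
  assumes "module R M" "module R N" "f \<in> linear_hom R M N" "x \<in> carrier M"
  shows "f (\<ominus>\<^bsub>M\<^esub> x) = \<ominus>\<^bsub>N\<^esub> f x"
proof -
  interpret M: module R M by fact
  interpret N: module R N by fact
  have "f ((\<ominus>\<^bsub>R\<^esub> \<one>\<^bsub>R\<^esub>) \<odot>\<^bsub>M\<^esub> x) = (\<ominus>\<^bsub>R\<^esub> \<one>\<^bsub>R\<^esub>) \<odot>\<^bsub>N\<^esub> f x"
    using assms(4) by (intro linear_homD(3)[OF assms(3)]) auto
  then show ?thesis
    using linear_homD(1)[OF assms(3,4)] assms(4) M.smult_l_minus N.smult_l_minus by simp
qed

lemma linear_hom_minus: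
  assumes "module R M" "module R N" "f \<in> linear_hom R M N" "x \<in> carrier M" "y \<in> carrier M"
  shows "f (x \<ominus>\<^bsub>M\<^esub> y) = f x \<ominus>\<^bsub>N\<^esub> f y"
proof -
  interpret M: module R M by fact
  show ?thesis
    unfolding a_minus_def using assms linear_homD(2)[OF assms(3)] linear_hom_uminus[OF assms(1-3)] by simp
qed

lemma (in module) smult_minus_distr:
  assumes "r \<in> carrier R" "x \<in> carrier M" "y \<in> carrier M"
  shows "r \<odot>\<^bsub>M\<^esub> (x \<ominus>\<^bsub>M\<^esub> y) = r \<odot>\<^bsub>M\<^esub> x \<ominus>\<^bsub>M\<^esub> r \<odot>\<^bsub>M\<^esub> y"
  using assms by (simp add: a_minus_def smult_r_distr smult_r_minus)

lemma (in abelian_group) minus_eq_zero_iff: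
  assumes "x \<in> carrier G" "y \<in> carrier G"
  shows "x \<ominus> y = \<zero> \<longleftrightarrow> x = y"
  using assms minus_add_cancel[of x y] by (auto simp: a_minus_def r_neg)

text \<open>
  The test modules of \<^const>\<open>injective_module\<close> live on a sum type; copies of the submodule and of the module itself
  in the right summand serve as test modules.
\<close>

lemma injective_module_extend_to_itself:
  fixes E :: "('a, 'b) module" and R :: "('a, 'r) ring_scheme"
  assumes inj: "injective_module R E" and A: "submodule A R E"
    and g: "g \<in> linear_hom R (E\<lparr>carrier := A\<rparr>) E"
  obtains h where "h \<in> linear_hom R E E" "\<And>x. x \<in> A \<Longrightarrow> h x = g x"
proof -
  interpret E: module R E using inj by (simp add: injective_module_def)
  define B where "B = (\<lambda>X. \<lparr>carrier = Inr ` X, mult = undefined, one = undefined, zero = Inr \<zero>\<^bsub>E\<^esub>,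
     add = (\<lambda>x y. Inr (projr x \<oplus>\<^bsub>E\<^esub> projr y)), smult = (\<lambda>r x. Inr (r \<odot>\<^bsub>E\<^esub> projr x))\<rparr> :: ('a, 'a + 'b) module)"
  have B: "module R (B X)" if X: "submodule X R E" for X
  proof (rule moduleI)
    note X' = E.submoduleE[OF X] E.submodule_zero[OF X]
    have X'': "x \<in> X \<Longrightarrow> x \<in> carrier E" for x using X' by auto
    show "cring R" by (rule E.R.is_cring)
    show "abelian_group (B X)"
    proof (rule abelian_groupI)
      fix x assume "x \<in> carrier (B X)"
      then obtain y where y: "y \<in> X" "x = Inr y" by (auto simp: B_def)
      show "\<exists>y\<in>carrier (B X). y \<oplus>\<^bsub>B X\<^esub> x = \<zero>\<^bsub>B X\<^esub>"
        using y X'(3)[of y] X'' by (auto simp: B_def E.M.l_neg intro!: bexI[of _ "\<ominus>\<^bsub>E\<^esub> y"])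
    qed (auto simp: B_def X' X'' E.M.a_ac)
  qed (use E.submoduleE[OF X] in \<open>auto simp: B_def E.smult_l_distr E.smult_r_distr E.smult_assoc1 subset_iff\<close>)
  have "(\<forall>(A :: ('a, 'a + 'b) module) (B :: ('a, 'a + 'b) module) f g.
        Module.module R A \<and> Module.module R B \<and>
        f \<in> linear_hom R A B \<and> inj_on f (carrier A) \<and> g \<in> linear_hom R A E \<longrightarrow>
        (\<exists>h\<in>linear_hom R B E. \<forall>x\<in>carrier A. h (f x) = g x))"
    using inj by (simp add: injective_module_def)
  note * = this[rule_format, of "B A" "B (carrier E)" id "g \<circ> projr"]
  have "\<exists>h\<in>linear_hom R (B (carrier E)) E. \<forall>x\<in>carrier (B A). h (id x) = (g \<circ> projr) x"
  proof (intro * conjI)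
    show "module R (B A)" "module R (B (carrier E))" using B A E.carrier_is_submodule by auto
    show "id \<in> linear_hom R (B A) (B (carrier E))"
      by (rule linear_homI) (use E.submoduleE(1)[OF A] in \<open>auto simp: B_def\<close>)
    show "g \<circ> projr \<in> linear_hom R (B A) E"
      by (rule linear_homI) (use linear_homD[OF g] in \<open>auto simp: B_def\<close>)
  qed simp
  then obtain h where h: "h \<in> linear_hom R (B (carrier E)) E" "\<And>x. x \<in> A \<Longrightarrow> h (Inr x) = g x"
    by (auto simp: B_def)
  have "h \<circ> Inr \<in> linear_hom R E E"
  proof (rule linear_homI)
    fix x y assume "x \<in> carrier E" "y \<in> carrier E"
    then show "(h \<circ> Inr) (x \<oplus>\<^bsub>E\<^esub> y) = (h \<circ> Inr) x \<oplus>\<^bsub>E\<^esub> (h \<circ> Inr) y"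
      using linear_homD(2)[OF h(1), of "Inr x" "Inr y"] by (simp add: B_def)
  next
    fix r x assume "r \<in> carrier R" "x \<in> carrier E"
    then show "(h \<circ> Inr) (r \<odot>\<^bsub>E\<^esub> x) = r \<odot>\<^bsub>E\<^esub> (h \<circ> Inr) x"
      using linear_homD(3)[OF h(1), of r "Inr x"] by (simp add: B_def)
  qed (use linear_homD(1)[OF h(1)] in \<open>auto simp: B_def\<close>)
  then show ?thesis using that h(2) by simp
qed

text \<open>
  The submodules of \<open>F\<close> annihilated by powers of \<open>x\<close> become stationary, say at the exponent \<open>T\<close>.  Hence
  \<open>x\<^sup>T F\<close> contains no nonzero \<open>x\<close>-torsion, the assignment of \<open>x\<^sup>T f\<close> to \<open>x\<^sup>T\<^sup>+\<^sup>1 f\<close> is well defined, and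
  injectivity extends it to an endomorphism \<open>\<rho>\<close> of \<open>E\<close>.  Then \<open>x\<^sup>T \<rho> (x f) = \<rho> (x\<^sup>T\<^sup>+\<^sup>1 f) = x\<^sup>T f\<close>.
\<close>

lemma injective_module_torsion_splitting:
  fixes E :: "('a, 'b) module" and R :: "('a, 'r) ring_scheme"
  assumes noeth: "noetherian_ring R" and inj: "injective_module R E"
    and x: "x \<in> carrier R" and es: "set es \<subseteq> carrier E"
  obtains \<rho> t where "\<rho> \<in> linear_hom R E E"
    "\<And>f. f \<in> lin_span R E es \<Longrightarrow> (x [^]\<^bsub>R\<^esub> (t::nat)) \<odot>\<^bsub>E\<^esub> (f \<ominus>\<^bsub>E\<^esub> \<rho> (x \<odot>\<^bsub>E\<^esub> f)) = \<zero>\<^bsub>E\<^esub>"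
proof -
  interpret E: module R E using inj by (simp add: injective_module_def)
  define F where "F = lin_span R E es"
  have F: "submodule F R E" unfolding F_def using E.submodule_lin_span[OF es] .
  have FE: "f \<in> F \<Longrightarrow> f \<in> carrier E" for f using E.submoduleE(1)[OF F] by auto
  have xp [simp]: "x [^]\<^bsub>R\<^esub> (t::nat) \<in> carrier R" for t using x by simp
  have diff_iff: "r \<odot>\<^bsub>E\<^esub> (f \<ominus>\<^bsub>E\<^esub> f') = \<zero>\<^bsub>E\<^esub> \<longleftrightarrow> r \<odot>\<^bsub>E\<^esub> f = r \<odot>\<^bsub>E\<^esub> f'"
    if "r \<in> carrier R" "f \<in> carrier E" "f' \<in> carrier E" for r f f'
    using that by (simp add: E.smult_minus_distr E.M.minus_eq_zero_iff)
  define N where "N = (\<lambda>t. {e \<in> carrier E. x [^]\<^bsub>R\<^esub> (t::nat) \<odot>\<^bsub>E\<^esub> e = \<zero>\<^bsub>E\<^esub>})"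
  have Suc: "x [^]\<^bsub>R\<^esub> Suc t \<odot>\<^bsub>E\<^esub> e = x \<odot>\<^bsub>E\<^esub> (x [^]\<^bsub>R\<^esub> t \<odot>\<^bsub>E\<^esub> e)"
    "x [^]\<^bsub>R\<^esub> Suc t \<odot>\<^bsub>E\<^esub> e = x [^]\<^bsub>R\<^esub> t \<odot>\<^bsub>E\<^esub> (x \<odot>\<^bsub>E\<^esub> e)" if "e \<in> carrier E" for t e
    using that x by (metis E.R.nat_pow_Suc E.R.m_comm E.smult_assoc1 xp)+
  have Nsub: "submodule (N t) R E" for t
  proof (rule E.submodule_of_closed)
    fix a y assume a: "a \<in> carrier R" and y: "y \<in> N t"
    have "x [^]\<^bsub>R\<^esub> t \<odot>\<^bsub>E\<^esub> (a \<odot>\<^bsub>E\<^esub> y) = a \<odot>\<^bsub>E\<^esub> (x [^]\<^bsub>R\<^esub> t \<odot>\<^bsub>E\<^esub> y)"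
      using a y by (metis (mono_tags, lifting) E.R.m_comm E.smult_assoc1 N_def mem_Collect_eq xp)
    then show "a \<odot>\<^bsub>E\<^esub> y \<in> N t" using a y by (simp add: N_def)
  qed (auto simp: N_def E.smult_r_distr)
  have Nmono: "N t \<subseteq> N (Suc t)" for t
    using Suc(1) x by (auto simp: N_def)
  obtain T where T: "\<And>t. N t \<inter> F \<subseteq> N T"
    using E.noetherian_chain_stationary[of es N, OF noeth es Nsub Nmono] unfolding F_def by auto
  define xS where "xS = x [^]\<^bsub>R\<^esub> Suc T"
  have xS [simp]: "xS \<in> carrier R" unfolding xS_def by (rule xp)
  define A where "A = {xS \<odot>\<^bsub>E\<^esub> f | f. f \<in> F}"
  define g where "g = (\<lambda>a. x [^]\<^bsub>R\<^esub> T \<odot>\<^bsub>E\<^esub> (SOME f. f \<in> F \<and> a = xS \<odot>\<^bsub>E\<^esub> f))"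
  have g: "g (xS \<odot>\<^bsub>E\<^esub> f) = x [^]\<^bsub>R\<^esub> T \<odot>\<^bsub>E\<^esub> f" if f: "f \<in> F" for f
  proof -
    define f' where "f' = (SOME f'. f' \<in> F \<and> xS \<odot>\<^bsub>E\<^esub> f = xS \<odot>\<^bsub>E\<^esub> f')"
    have f': "f' \<in> F \<and> xS \<odot>\<^bsub>E\<^esub> f = xS \<odot>\<^bsub>E\<^esub> f'"
      unfolding f'_def by (rule someI[of _ f]) (use f in simp)
    have "xS \<odot>\<^bsub>E\<^esub> (f \<ominus>\<^bsub>E\<^esub> f') = \<zero>\<^bsub>E\<^esub>"
      using f f' FE diff_iff[OF xS] by blast
    then have "f \<ominus>\<^bsub>E\<^esub> f' \<in> N (Suc T)" using f f' FE unfolding N_def xS_def by blast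
    moreover have "f \<ominus>\<^bsub>E\<^esub> f' \<in> F" using E.submodule_diff[OF F] f f' by auto
    ultimately have "f \<ominus>\<^bsub>E\<^esub> f' \<in> N T" using T by auto
    then have "x [^]\<^bsub>R\<^esub> T \<odot>\<^bsub>E\<^esub> f = x [^]\<^bsub>R\<^esub> T \<odot>\<^bsub>E\<^esub> f'"
      using f f' FE diff_iff[OF xp] by (simp add: N_def)
    then show ?thesis by (simp add: g_def f'_def)
  qed
  have A: "submodule A R E"
  proof (rule E.submodule_of_closed)
    show "A \<subseteq> carrier E" using FE xp x by (auto simp: A_def)
    show "\<zero>\<^bsub>E\<^esub> \<in> A" unfolding A_def using E.submodule_zero[OF F] E.smult_r_null[OF xS] by force
    fix a b assume "a \<in> A" "b \<in> A"
    then show "a \<oplus>\<^bsub>E\<^esub> b \<in> A" unfolding A_def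
      using E.smult_r_distr[OF xS] FE E.submoduleE(5)[OF F] by (smt (verit) mem_Collect_eq)
  next
    fix a y assume "a \<in> carrier R" "y \<in> A"
    then show "a \<odot>\<^bsub>E\<^esub> y \<in> A" unfolding A_def
      using E.smult_assoc1 E.R.m_comm xS FE E.submoduleE(4)[OF F] by (smt (verit) mem_Collect_eq)
  qed
  have "g \<in> linear_hom R (E\<lparr>carrier := A\<rparr>) E"
  proof (rule linear_homI)
    fix a assume "a \<in> carrier (E\<lparr>carrier := A\<rparr>)"
    then show "g a \<in> carrier E" using g FE xp by (force simp: A_def)
  next
    fix a b assume "a \<in> carrier (E\<lparr>carrier := A\<rparr>)" "b \<in> carrier (E\<lparr>carrier := A\<rparr>)"
    then obtain f f' where f: "f \<in> F" "f' \<in> F" "a = xS \<odot>\<^bsub>E\<^esub> f" "b = xS \<odot>\<^bsub>E\<^esub> f'"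
      by (auto simp: A_def)
    have "a \<oplus>\<^bsub>E\<^esub> b = xS \<odot>\<^bsub>E\<^esub> (f \<oplus>\<^bsub>E\<^esub> f')"
      using f FE E.smult_r_distr[OF xS] by simp
    then have "g (a \<oplus>\<^bsub>E\<^esub> b) = x [^]\<^bsub>R\<^esub> T \<odot>\<^bsub>E\<^esub> (f \<oplus>\<^bsub>E\<^esub> f')"
      using g E.submoduleE(5)[OF F] f by simp
    then show "g (a \<oplus>\<^bsub>E\<lparr>carrier := A\<rparr>\<^esub> b) = g a \<oplus>\<^bsub>E\<^esub> g b"
      using f FE g E.smult_r_distr[OF xp] by simp
  next
    fix r a assume r: "r \<in> carrier R" and "a \<in> carrier (E\<lparr>carrier := A\<rparr>)"
    then obtain f where f: "f \<in> F" "a = xS \<odot>\<^bsub>E\<^esub> f" by (auto simp: A_def)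
    have sw: "r \<odot>\<^bsub>E\<^esub> (c \<odot>\<^bsub>E\<^esub> f) = c \<odot>\<^bsub>E\<^esub> (r \<odot>\<^bsub>E\<^esub> f)" if "c \<in> carrier R" for c
      using that r f FE by (metis E.R.m_comm E.smult_assoc1)
    have "g (r \<odot>\<^bsub>E\<^esub> a) = x [^]\<^bsub>R\<^esub> T \<odot>\<^bsub>E\<^esub> (r \<odot>\<^bsub>E\<^esub> f)"
      using f r sw g E.submoduleE(4)[OF F] by simp
    then show "g (r \<odot>\<^bsub>E\<lparr>carrier := A\<rparr>\<^esub> a) = r \<odot>\<^bsub>E\<^esub> g a" using f g sw by simp
  qed
  then obtain h where h: "h \<in> linear_hom R E E" "\<And>a. a \<in> A \<Longrightarrow> h a = g a"
    using injective_module_extend_to_itself[OF inj A] by blast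
  show ?thesis
  proof (rule that[OF h(1)])
    fix f assume "f \<in> lin_span R E es"
    then have f: "f \<in> F" by (simp add: F_def)
    note fE = FE[OF f]
    have "x [^]\<^bsub>R\<^esub> T \<odot>\<^bsub>E\<^esub> h (x \<odot>\<^bsub>E\<^esub> f) = h (xS \<odot>\<^bsub>E\<^esub> f)"
      using linear_homD(3)[OF h(1) xp] Suc(2)[OF fE] x fE unfolding xS_def by simp
    also have "\<dots> = x [^]\<^bsub>R\<^esub> T \<odot>\<^bsub>E\<^esub> f" using h(2)[of "xS \<odot>\<^bsub>E\<^esub> f"] g f by (auto simp: A_def)
    finally show "x [^]\<^bsub>R\<^esub> T \<odot>\<^bsub>E\<^esub> (f \<ominus>\<^bsub>E\<^esub> h (x \<odot>\<^bsub>E\<^esub> f)) = \<zero>\<^bsub>E\<^esub>"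
      using E.smult_minus_distr[OF xp fE] linear_homD(1)[OF h(1)] x fE E.M.minus_eq_zero_iff by simp
  qed
qed

section \<open>Direct sums and column-finite matrices\<close>

text \<open>
  The families have the whole type as their domain and vanish outside the index set, so that equality of
  families is equality of functions.
\<close>

definition direct_sum :: "'i set \<Rightarrow> ('a, 'b, 'm) module_scheme \<Rightarrow> ('a, 'i \<Rightarrow> 'b) module" where
  "direct_sum B M =
     \<lparr>carrier = {y. (\<forall>b. y b \<in> carrier M) \<and> (\<forall>b. b \<notin> B \<longrightarrow> y b = \<zero>\<^bsub>M\<^esub>) \<and> finite {b. y b \<noteq> \<zero>\<^bsub>M\<^esub>}},
      mult = undefined, one = undefined, zero = (\<lambda>b. \<zero>\<^bsub>M\<^esub>), add = (\<lambda>y z b. y b \<oplus>\<^bsub>M\<^esub> z b),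
      smult = (\<lambda>r y b. r \<odot>\<^bsub>M\<^esub> y b)\<rparr>"

lemma direct_sum_simps [simp]:
  "y \<oplus>\<^bsub>direct_sum B M\<^esub> z = (\<lambda>b. y b \<oplus>\<^bsub>M\<^esub> z b)"
  "r \<odot>\<^bsub>direct_sum B M\<^esub> y = (\<lambda>b. r \<odot>\<^bsub>M\<^esub> y b)"
  "\<zero>\<^bsub>direct_sum B M\<^esub> = (\<lambda>b. \<zero>\<^bsub>M\<^esub>)"
  by (simp_all add: direct_sum_def)

lemma direct_sum_carrier:
  "y \<in> carrier (direct_sum B M) \<longleftrightarrow>
     (\<forall>b. y b \<in> carrier M) \<and> (\<forall>b. b \<notin> B \<longrightarrow> y b = \<zero>\<^bsub>M\<^esub>) \<and> finite {b. y b \<noteq> \<zero>\<^bsub>M\<^esub>}"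
  by (simp add: direct_sum_def)

lemma (in module) direct_sum_module: "module R (direct_sum B M)"
proof (rule moduleI)
  have fin: "finite {b. y b \<oplus>\<^bsub>M\<^esub> z b \<noteq> \<zero>\<^bsub>M\<^esub>}"
    if "finite {b. y b \<noteq> \<zero>\<^bsub>M\<^esub>}" "finite {b. z b \<noteq> \<zero>\<^bsub>M\<^esub>}" for y z :: "'e \<Rightarrow> 'c"
    by (rule finite_subset[OF _ finite_UnI[OF that]]) auto
  show "abelian_group (direct_sum B M)"
  proof (rule abelian_groupI)
    fix y assume y: "y \<in> carrier (direct_sum B M)"
    show "\<exists>z\<in>carrier (direct_sum B M). z \<oplus>\<^bsub>direct_sum B M\<^esub> y = \<zero>\<^bsub>direct_sum B M\<^esub>"
    proof (rule bexI)
      show "(\<lambda>b. \<ominus>\<^bsub>M\<^esub> y b) \<oplus>\<^bsub>direct_sum B M\<^esub> y = \<zero>\<^bsub>direct_sum B M\<^esub>"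
        using y by (simp add: direct_sum_carrier M.l_neg)
      have "{b. \<ominus>\<^bsub>M\<^esub> y b \<noteq> \<zero>\<^bsub>M\<^esub>} \<subseteq> {b. y b \<noteq> \<zero>\<^bsub>M\<^esub>}" by auto
      then show "(\<lambda>b. \<ominus>\<^bsub>M\<^esub> y b) \<in> carrier (direct_sum B M)"
        using y finite_subset by (fastforce simp: direct_sum_carrier)
    qed
  qed (auto simp: direct_sum_carrier M.a_ac fin)
  fix r y assume r: "r \<in> carrier R" and y: "y \<in> carrier (direct_sum B M)"
  have "{b. r \<odot>\<^bsub>M\<^esub> y b \<noteq> \<zero>\<^bsub>M\<^esub>} \<subseteq> {b. y b \<noteq> \<zero>\<^bsub>M\<^esub>}" using r by auto
  then show "r \<odot>\<^bsub>direct_sum B M\<^esub> y \<in> carrier (direct_sum B M)"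
    using r y finite_subset by (fastforce simp: direct_sum_carrier)
qed (auto simp: direct_sum_carrier smult_l_distr smult_r_distr smult_assoc1 R.is_cring)

lemma direct_sum_minus:
  assumes "module R M" "y \<in> carrier (direct_sum B M)" "z \<in> carrier (direct_sum B M)"
  shows "y \<ominus>\<^bsub>direct_sum B M\<^esub> z = (\<lambda>b. y b \<ominus>\<^bsub>M\<^esub> z b)"
proof -
  interpret M: module R M by fact
  interpret D: module R "direct_sum B M" by (rule M.direct_sum_module)
  have "y b = (y \<ominus>\<^bsub>direct_sum B M\<^esub> z) b \<oplus>\<^bsub>M\<^esub> z b" for b
    using D.M.minus_add_cancel[OF assms(2,3)] by (simp add: fun_eq_iff)
  moreover have "(y \<ominus>\<^bsub>direct_sum B M\<^esub> z) b \<in> carrier M" "z b \<in> carrier M" for b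
    using D.M.minus_closed[OF assms(2,3)] assms(3) by (auto simp: direct_sum_carrier)
  ultimately have "(y \<ominus>\<^bsub>direct_sum B M\<^esub> z) b = y b \<ominus>\<^bsub>M\<^esub> z b" for b
    using M.M.minus_eqI by metis
  then show ?thesis by (rule ext)
qed

lemma direct_sum_map:
  assumes "module R M" "module R N" "f \<in> linear_hom R M N"
  shows "(\<lambda>y. f \<circ> y) \<in> linear_hom R (direct_sum B M) (direct_sum B N)"
proof (rule linear_homI)
  note f = linear_homD[OF assms(3)] linear_hom_zero[OF assms]
  fix y assume y: "y \<in> carrier (direct_sum B M)"
  have "{b. f (y b) \<noteq> \<zero>\<^bsub>N\<^esub>} \<subseteq> {b. y b \<noteq> \<zero>\<^bsub>M\<^esub>}" using f(4) by auto
  then show "f \<circ> y \<in> carrier (direct_sum B N)"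
    using y f finite_subset by (fastforce simp: direct_sum_carrier)
qed (use linear_homD[OF assms(3)] in \<open>auto simp: direct_sum_carrier\<close>)

text \<open>
  Preimages of the entries are chosen one by one; the entry \<open>0\<close> gets the preimage \<open>0\<close>, which keeps the support
  finite.
\<close>

lemma direct_sum_preimage:
  assumes v: "v \<in> carrier (direct_sum B N)" and A: "A \<subseteq> carrier M" "\<zero>\<^bsub>M\<^esub> \<in> A"
    and f: "f \<zero>\<^bsub>M\<^esub> = \<zero>\<^bsub>N\<^esub>" and img: "\<And>b. v b \<in> f ` A"
  obtains u where "u \<in> carrier (direct_sum B M)" "\<And>b. u b \<in> A" "v = f \<circ> u"
proof -
  define u where "u = (\<lambda>b. if v b = \<zero>\<^bsub>N\<^esub> then \<zero>\<^bsub>M\<^esub> else SOME a. a \<in> A \<and> v b = f a)"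
  have u: "u b \<in> A \<and> v b = f (u b)" for b
  proof (cases "v b = \<zero>\<^bsub>N\<^esub>")
    case False
    have "(SOME a. a \<in> A \<and> v b = f a) \<in> A \<and> v b = f (SOME a. a \<in> A \<and> v b = f a)"
      by (rule someI_ex) (use img[of b] in auto)
    then show ?thesis using False by (simp add: u_def)
  qed (use A f in \<open>simp add: u_def\<close>)
  have "{b. u b \<noteq> \<zero>\<^bsub>M\<^esub>} \<subseteq> {b. v b \<noteq> \<zero>\<^bsub>N\<^esub>}" by (auto simp: u_def)
  then have "finite {b. u b \<noteq> \<zero>\<^bsub>M\<^esub>}" using v finite_subset by (auto simp: direct_sum_carrier)
  moreover have "b \<notin> B \<Longrightarrow> u b = \<zero>\<^bsub>M\<^esub>" for b using v by (simp add: u_def direct_sum_carrier)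
  ultimately have "u \<in> carrier (direct_sum B M)" using u A by (auto simp: direct_sum_carrier)
  then show ?thesis using that u by (auto simp: fun_eq_iff)
qed

lemma regular_module_simps [simp]:
  "carrier (regular_module R) = carrier R" "\<zero>\<^bsub>regular_module R\<^esub> = \<zero>\<^bsub>R\<^esub>"
  "x \<oplus>\<^bsub>regular_module R\<^esub> y = x \<oplus>\<^bsub>R\<^esub> y" "r \<odot>\<^bsub>regular_module R\<^esub> x = r \<otimes>\<^bsub>R\<^esub> x"
  by (simp_all add: regular_module_def)

lemma finsum_regular_module: "finsum (regular_module R) f A = finsum R f A"
  by (simp add: finsum_def finprod_def regular_module_def)

lemma (in cring) regular_module_module: "module R (regular_module R)"
proof (rule moduleI)
  show "abelian_group (regular_module R)"
  proof (rule abelian_groupI)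
    fix x assume "x \<in> carrier (regular_module R)"
    then show "\<exists>y\<in>carrier (regular_module R). y \<oplus>\<^bsub>regular_module R\<^esub> x = \<zero>\<^bsub>regular_module R\<^esub>"
      by (auto intro!: bexI[of _ "\<ominus> x"] simp: l_neg)
  qed (auto simp: a_ac)
qed (auto simp: l_distr r_distr m_assoc is_cring)

text \<open>
  A matrix assigns to each source index the family of its coefficients over the target indices, that is, the
  image of a basis vector.
\<close>

definition column_finite :: "('a, 'r) ring_scheme \<Rightarrow> 'i set \<Rightarrow> 'j set \<Rightarrow> ('i \<Rightarrow> 'j \<Rightarrow> 'a) \<Rightarrow> bool" where
  "column_finite R B B' K \<longleftrightarrow> (\<forall>b\<in>B. K b \<in> carrier (direct_sum B' (regular_module R)))"

text \<open>
  The map that a matrix \<open>K\<close> induces between the tensor products of a module \<open>M\<close> with two free modules.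
\<close>

definition act :: "('a, 'b, 'm) module_scheme \<Rightarrow> ('i \<Rightarrow> 'j \<Rightarrow> 'a) \<Rightarrow> ('i \<Rightarrow> 'b) \<Rightarrow> 'j \<Rightarrow> 'b" where
  "act M K y = (\<lambda>b'. \<Oplus>\<^bsub>M\<^esub>b\<in>{b. y b \<noteq> \<zero>\<^bsub>M\<^esub>}. K b b' \<odot>\<^bsub>M\<^esub> y b)"

lemma column_finiteD:
  assumes "column_finite R B B' K" "b \<in> B"
  shows "K b b' \<in> carrier R" "b' \<notin> B' \<Longrightarrow> K b b' = \<zero>\<^bsub>R\<^esub>" "finite {b'. K b b' \<noteq> \<zero>\<^bsub>R\<^esub>}"
    "K b \<in> carrier (direct_sum B' (regular_module R))"
  using assms by (auto simp: column_finite_def direct_sum_carrier)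

context module
begin

text \<open>
  The one exchange of summations behind both the functoriality of \<open>act\<close> and the description of linear maps by
  matrices.
\<close>

lemma finsum_smult_swap:
  assumes "finite A" "finite U" "\<And>a. a \<in> A \<Longrightarrow> c a \<in> carrier R"
    "\<And>a u. a \<in> A \<Longrightarrow> u \<in> U \<Longrightarrow> K a u \<in> carrier R" "\<And>u. u \<in> U \<Longrightarrow> v u \<in> carrier M"
  shows "(\<Oplus>\<^bsub>M\<^esub>a\<in>A. c a \<odot>\<^bsub>M\<^esub> (\<Oplus>\<^bsub>M\<^esub>u\<in>U. K a u \<odot>\<^bsub>M\<^esub> v u)) =
         (\<Oplus>\<^bsub>M\<^esub>u\<in>U. (\<Oplus>a\<in>A. c a \<otimes> K a u) \<odot>\<^bsub>M\<^esub> v u)"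
  using assms(1,3,4)
proof (induction A rule: finite_induct)
  case empty
  have "(\<Oplus>\<^bsub>M\<^esub>u\<in>U. \<zero> \<odot>\<^bsub>M\<^esub> v u) = (\<Oplus>\<^bsub>M\<^esub>u\<in>U. \<zero>\<^bsub>M\<^esub>)"
    by (rule M.finsum_cong') (use assms in auto)
  then show ?case by simp
next
  case (insert a A)
  have "(\<Oplus>\<^bsub>M\<^esub>a\<in>insert a A. c a \<odot>\<^bsub>M\<^esub> (\<Oplus>\<^bsub>M\<^esub>u\<in>U. K a u \<odot>\<^bsub>M\<^esub> v u)) =
     c a \<odot>\<^bsub>M\<^esub> (\<Oplus>\<^bsub>M\<^esub>u\<in>U. K a u \<odot>\<^bsub>M\<^esub> v u) \<oplus>\<^bsub>M\<^esub>
     (\<Oplus>\<^bsub>M\<^esub>a\<in>A. c a \<odot>\<^bsub>M\<^esub> (\<Oplus>\<^bsub>M\<^esub>u\<in>U. K a u \<odot>\<^bsub>M\<^esub> v u))"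
    using insert assms(5) by (intro M.finsum_insert) (auto intro!: M.finsum_closed)
  also have "c a \<odot>\<^bsub>M\<^esub> (\<Oplus>\<^bsub>M\<^esub>u\<in>U. K a u \<odot>\<^bsub>M\<^esub> v u) = (\<Oplus>\<^bsub>M\<^esub>u\<in>U. c a \<odot>\<^bsub>M\<^esub> (K a u \<odot>\<^bsub>M\<^esub> v u))"
    using insert assms(2,5) by (intro finsum_smult_ldistr) auto
  also have "\<dots> = (\<Oplus>\<^bsub>M\<^esub>u\<in>U. (c a \<otimes> K a u) \<odot>\<^bsub>M\<^esub> v u)"
    using insert assms(5) by (intro M.finsum_cong') (auto simp: smult_assoc1)
  also have "(\<Oplus>\<^bsub>M\<^esub>a\<in>A. c a \<odot>\<^bsub>M\<^esub> (\<Oplus>\<^bsub>M\<^esub>u\<in>U. K a u \<odot>\<^bsub>M\<^esub> v u)) =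
      (\<Oplus>\<^bsub>M\<^esub>u\<in>U. (\<Oplus>a\<in>A. c a \<otimes> K a u) \<odot>\<^bsub>M\<^esub> v u)"
    using insert by auto
  also have "(\<Oplus>\<^bsub>M\<^esub>u\<in>U. (c a \<otimes> K a u) \<odot>\<^bsub>M\<^esub> v u) \<oplus>\<^bsub>M\<^esub> (\<Oplus>\<^bsub>M\<^esub>u\<in>U. (\<Oplus>a\<in>A. c a \<otimes> K a u) \<odot>\<^bsub>M\<^esub> v u) =
     (\<Oplus>\<^bsub>M\<^esub>u\<in>U. (c a \<otimes> K a u) \<odot>\<^bsub>M\<^esub> v u \<oplus>\<^bsub>M\<^esub> (\<Oplus>a\<in>A. c a \<otimes> K a u) \<odot>\<^bsub>M\<^esub> v u)"
    using insert assms(5) by (intro M.finsum_addf[symmetric]) (auto intro!: R.finsum_closed)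
  also have "\<dots> = (\<Oplus>\<^bsub>M\<^esub>u\<in>U. (\<Oplus>a\<in>insert a A. c a \<otimes> K a u) \<odot>\<^bsub>M\<^esub> v u)"
  proof (rule M.finsum_cong')
    show "(\<lambda>u. (\<Oplus>a\<in>insert a A. c a \<otimes> K a u) \<odot>\<^bsub>M\<^esub> v u) \<in> U \<rightarrow> carrier M"
      using insert assms(5) by (auto intro!: smult_closed R.finsum_closed)
    fix u assume u: "u \<in> U"
    have "(\<Oplus>a\<in>insert a A. c a \<otimes> K a u) = c a \<otimes> K a u \<oplus> (\<Oplus>a\<in>A. c a \<otimes> K a u)"
      using insert u by (intro R.finsum_insert) auto
    moreover have "(\<Oplus>a\<in>A. c a \<otimes> K a u) \<in> carrier R"
      using insert u by (intro R.finsum_closed) auto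
    ultimately show "(c a \<otimes> K a u) \<odot>\<^bsub>M\<^esub> v u \<oplus>\<^bsub>M\<^esub> (\<Oplus>a\<in>A. c a \<otimes> K a u) \<odot>\<^bsub>M\<^esub> v u =
        (\<Oplus>a\<in>insert a A. c a \<otimes> K a u) \<odot>\<^bsub>M\<^esub> v u"
      using insert u assms(5) by (simp add: smult_l_distr)
  qed simp
  finally show ?case .
qed

lemma act_eq_finsum:
  assumes K: "column_finite R B B' K" and y: "y \<in> carrier (direct_sum B M)"
    and U: "finite U" "U \<subseteq> B" "{b. y b \<noteq> \<zero>\<^bsub>M\<^esub>} \<subseteq> U"
  shows "act M K y b' = (\<Oplus>\<^bsub>M\<^esub>b\<in>U. K b b' \<odot>\<^bsub>M\<^esub> y b)"
  unfolding act_def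
proof (rule M.add.finprod_mono_neutral_cong_left[OF U(1,3)])
  show "(\<lambda>b. K b b' \<odot>\<^bsub>M\<^esub> y b) \<in> U \<rightarrow> carrier M"
    using U(2) column_finiteD(1)[OF K] y by (auto simp: direct_sum_carrier)
  fix b assume "b \<in> U - {b. y b \<noteq> \<zero>\<^bsub>M\<^esub>}"
  then show "K b b' \<odot>\<^bsub>M\<^esub> y b = \<zero>\<^bsub>M\<^esub>" using U(2) column_finiteD(1)[OF K] by auto
qed simp

lemma direct_sum_support:
  assumes "y \<in> carrier (direct_sum B M)"
  shows "finite {b. y b \<noteq> \<zero>\<^bsub>M\<^esub>}" "{b. y b \<noteq> \<zero>\<^bsub>M\<^esub>} \<subseteq> B" "y b \<in> carrier M"
  using assms by (auto simp: direct_sum_carrier)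

lemma act_value_closed:
  assumes "column_finite R B B' K" "y \<in> carrier (direct_sum B M)"
  shows "act M K y b' \<in> carrier M"
  unfolding act_def
  using column_finiteD(1)[OF assms(1)] direct_sum_support[OF assms(2)] by (intro M.finsum_closed) auto

lemma act_support:
  assumes K: "column_finite R B B' K" and y: "y \<in> carrier (direct_sum B M)"
  shows "{b'. act M K y b' \<noteq> \<zero>\<^bsub>M\<^esub>} \<subseteq> (\<Union>b\<in>{b. y b \<noteq> \<zero>\<^bsub>M\<^esub>}. {b'. K b b' \<noteq> \<zero>})"
proof safe
  fix b' assume nz: "act M K y b' \<noteq> \<zero>\<^bsub>M\<^esub>"
  show "b' \<in> (\<Union>b\<in>{b. y b \<noteq> \<zero>\<^bsub>M\<^esub>}. {b'. K b b' \<noteq> \<zero>})"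
  proof (rule ccontr)
    assume "b' \<notin> (\<Union>b\<in>{b. y b \<noteq> \<zero>\<^bsub>M\<^esub>}. {b'. K b b' \<noteq> \<zero>})"
    then have "act M K y b' = \<zero>\<^bsub>M\<^esub>"
      unfolding act_def using direct_sum_support[OF y]
      by (intro M.add.finprod_one_eqI) auto
    then show False using nz by simp
  qed
qed

lemma act_closed:
  assumes K: "column_finite R B B' K" and y: "y \<in> carrier (direct_sum B M)"
  shows "act M K y \<in> carrier (direct_sum B' M)"
proof -
  note s = direct_sum_support[OF y]
  have sub: "(\<Union>b\<in>{b. y b \<noteq> \<zero>\<^bsub>M\<^esub>}. {b'. K b b' \<noteq> \<zero>}) \<subseteq> B'"
    using s(2) column_finiteD(2)[OF K] by auto
  have fin: "finite (\<Union>b\<in>{b. y b \<noteq> \<zero>\<^bsub>M\<^esub>}. {b'. K b b' \<noteq> \<zero>})"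
    using s(1,2) column_finiteD(3)[OF K] by auto
  show ?thesis unfolding direct_sum_carrier
    using act_value_closed[OF assms] act_support[OF assms] sub finite_subset[OF _ fin] by blast
qed

lemma act_linear_hom:
  assumes K: "column_finite R B B' K"
  shows "act M K \<in> linear_hom R (direct_sum B M) (direct_sum B' M)"
proof (rule linear_homI)
  interpret D: module R "direct_sum B M" by (rule direct_sum_module)
  fix y z assume y: "y \<in> carrier (direct_sum B M)" and z: "z \<in> carrier (direct_sum B M)"
  let ?U = "{b. y b \<noteq> \<zero>\<^bsub>M\<^esub>} \<union> {b. z b \<noteq> \<zero>\<^bsub>M\<^esub>}"
  note sy = direct_sum_support[OF y] and sz = direct_sum_support[OF z]
  have U: "finite ?U" "?U \<subseteq> B" using sy sz by auto
  have "act M K (y \<oplus>\<^bsub>direct_sum B M\<^esub> z) b' = act M K y b' \<oplus>\<^bsub>M\<^esub> act M K z b'" for b'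
  proof -
    have "act M K (y \<oplus>\<^bsub>direct_sum B M\<^esub> z) b' = (\<Oplus>\<^bsub>M\<^esub>b\<in>?U. K b b' \<odot>\<^bsub>M\<^esub> (y b \<oplus>\<^bsub>M\<^esub> z b))"
      by (subst act_eq_finsum[OF K D.M.a_closed[OF y z] U]) auto
    also have "\<dots> = (\<Oplus>\<^bsub>M\<^esub>b\<in>?U. K b b' \<odot>\<^bsub>M\<^esub> y b \<oplus>\<^bsub>M\<^esub> K b b' \<odot>\<^bsub>M\<^esub> z b)"
      using U(2) column_finiteD(1)[OF K] sy(3) sz(3) by (intro M.finsum_cong') (auto simp: smult_r_distr)
    also have "\<dots> = (\<Oplus>\<^bsub>M\<^esub>b\<in>?U. K b b' \<odot>\<^bsub>M\<^esub> y b) \<oplus>\<^bsub>M\<^esub> (\<Oplus>\<^bsub>M\<^esub>b\<in>?U. K b b' \<odot>\<^bsub>M\<^esub> z b)"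
      using U(2) column_finiteD(1)[OF K] sy(3) sz(3) by (intro M.finsum_addf) auto
    also have "\<dots> = act M K y b' \<oplus>\<^bsub>M\<^esub> act M K z b'"
      using act_eq_finsum[OF K y U, of b'] act_eq_finsum[OF K z U, of b'] by auto
    finally show ?thesis .
  qed
  then show "act M K (y \<oplus>\<^bsub>direct_sum B M\<^esub> z) = act M K y \<oplus>\<^bsub>direct_sum B' M\<^esub> act M K z" by auto
next
  interpret D: module R "direct_sum B M" by (rule direct_sum_module)
  fix r y assume r: "r \<in> carrier R" and y: "y \<in> carrier (direct_sum B M)"
  let ?U = "{b. y b \<noteq> \<zero>\<^bsub>M\<^esub>}"
  note sy = direct_sum_support[OF y]
  have "act M K (r \<odot>\<^bsub>direct_sum B M\<^esub> y) b' = r \<odot>\<^bsub>M\<^esub> act M K y b'" for b'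
  proof -
    have "act M K (r \<odot>\<^bsub>direct_sum B M\<^esub> y) b' = (\<Oplus>\<^bsub>M\<^esub>b\<in>?U. K b b' \<odot>\<^bsub>M\<^esub> (r \<odot>\<^bsub>M\<^esub> y b))"
      using r by (subst act_eq_finsum[OF K D.smult_closed[OF r y] sy(1,2)]) auto
    also have "\<dots> = (\<Oplus>\<^bsub>M\<^esub>b\<in>?U. r \<odot>\<^bsub>M\<^esub> (K b b' \<odot>\<^bsub>M\<^esub> y b))"
    proof (rule M.finsum_cong')
      fix b assume "b \<in> ?U"
      then have "K b b' \<in> carrier R" using sy(2) column_finiteD(1)[OF K] by auto
      then show "K b b' \<odot>\<^bsub>M\<^esub> (r \<odot>\<^bsub>M\<^esub> y b) = r \<odot>\<^bsub>M\<^esub> (K b b' \<odot>\<^bsub>M\<^esub> y b)"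
        using r sy(3) by (metis R.m_comm smult_assoc1)
    qed (use sy(2,3) column_finiteD(1)[OF K] r in auto)
    also have "\<dots> = r \<odot>\<^bsub>M\<^esub> act M K y b'"
      unfolding act_def using sy column_finiteD(1)[OF K] r by (intro finsum_smult_ldistr[symmetric]) auto
    finally show ?thesis .
  qed
  then show "act M K (r \<odot>\<^bsub>direct_sum B M\<^esub> y) = r \<odot>\<^bsub>direct_sum B' M\<^esub> act M K y" by auto
qed (use act_closed[OF K] in auto)

text \<open>
  The product of two matrices has as columns the images of the columns of the first one; so it can be written
  with \<open>act\<close> for the regular module.
\<close>

lemma act_act:
  assumes K: "column_finite R B B' K" and L: "column_finite R B' B'' L" and y: "y \<in> carrier (direct_sum B M)"
  shows "act M L (act M K y) = act M (\<lambda>b. act (regular_module R) L (K b)) y"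
proof
  fix b''
  interpret S: module R "regular_module R" by (rule R.regular_module_module)
  note s = direct_sum_support[OF y]
  let ?U = "{b. y b \<noteq> \<zero>\<^bsub>M\<^esub>}"
  let ?W = "\<Union>b\<in>?U. {b'. K b b' \<noteq> \<zero>}"
  have W: "finite ?W" "?W \<subseteq> B'" using s(1,2) column_finiteD(2,3)[OF K] by auto
  have "act M L (act M K y) b'' = (\<Oplus>\<^bsub>M\<^esub>b'\<in>?W. L b' b'' \<odot>\<^bsub>M\<^esub> act M K y b')"
    by (rule act_eq_finsum[OF L act_closed[OF K y] W act_support[OF K y]])
  also have "\<dots> = (\<Oplus>\<^bsub>M\<^esub>b\<in>?U. (\<Oplus>b'\<in>?W. L b' b'' \<otimes> K b b') \<odot>\<^bsub>M\<^esub> y b)"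
    unfolding act_def using W s column_finiteD(1)[OF K] column_finiteD(1)[OF L]
    by (intro finsum_smult_swap) auto
  also have "\<dots> = (\<Oplus>\<^bsub>M\<^esub>b\<in>?U. act (regular_module R) L (K b) b'' \<odot>\<^bsub>M\<^esub> y b)"
  proof (rule M.finsum_cong')
    fix b assume b: "b \<in> ?U"
    then have "b \<in> B" using s(2) by auto
    have "act (regular_module R) L (K b) b'' = (\<Oplus>\<^bsub>regular_module R\<^esub>b'\<in>?W. L b' b'' \<odot>\<^bsub>regular_module R\<^esub> K b b')"
      by (rule S.act_eq_finsum[OF L column_finiteD(4)[OF K \<open>b \<in> B\<close>] W]) (use b in auto)
    then show "(\<Oplus>b'\<in>?W. L b' b'' \<otimes> K b b') \<odot>\<^bsub>M\<^esub> y b = act (regular_module R) L (K b) b'' \<odot>\<^bsub>M\<^esub> y b"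
      by (simp add: finsum_regular_module)
  next
    show "(\<lambda>b. act (regular_module R) L (K b) b'' \<odot>\<^bsub>M\<^esub> y b) \<in> ?U \<rightarrow> carrier M"
      using S.act_value_closed[OF L column_finiteD(4)[OF K]] s by auto
  qed simp
  finally show "act M L (act M K y) b'' = act M (\<lambda>b. act (regular_module R) L (K b)) y b''"
    by (simp add: act_def)
qed

lemma act_cong:
  assumes "y \<in> carrier (direct_sum B M)" "column_finite R B B' K" "\<And>b b'. b \<in> B \<Longrightarrow> K b b' = L b b'"
  shows "act M K y = act M L y"
proof
  fix b'
  have L: "column_finite R B B' L" using assms(2,3) unfolding column_finite_def by (metis ext)
  show "act M K y b' = act M L y b'"
    unfolding act_def using direct_sum_support[OF assms(1)] assms(3) column_finiteD(1)[OF L]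
    by (intro M.finsum_cong') auto
qed

lemma act_matrix_add:
  assumes K: "column_finite R B B' K" and L: "column_finite R B B' L" and y: "y \<in> carrier (direct_sum B M)"
  shows "act M (\<lambda>b b'. K b b' \<oplus> L b b') y = act M K y \<oplus>\<^bsub>direct_sum B' M\<^esub> act M L y"
proof -
  note s = direct_sum_support[OF y]
  have "act M (\<lambda>b b'. K b b' \<oplus> L b b') y b' = act M K y b' \<oplus>\<^bsub>M\<^esub> act M L y b'" for b'
  proof -
    have "act M (\<lambda>b b'. K b b' \<oplus> L b b') y b' =
        (\<Oplus>\<^bsub>M\<^esub>b\<in>{b. y b \<noteq> \<zero>\<^bsub>M\<^esub>}. K b b' \<odot>\<^bsub>M\<^esub> y b \<oplus>\<^bsub>M\<^esub> L b b' \<odot>\<^bsub>M\<^esub> y b)"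
      unfolding act_def using s column_finiteD(1)[OF K] column_finiteD(1)[OF L]
      by (intro M.finsum_cong') (auto simp: smult_l_distr subset_iff)
    also have "\<dots> = act M K y b' \<oplus>\<^bsub>M\<^esub> act M L y b'"
      unfolding act_def using s column_finiteD(1)[OF K] column_finiteD(1)[OF L] by (intro M.finsum_addf) auto
    finally show ?thesis .
  qed
  then show ?thesis by auto
qed

lemma act_scalar:
  assumes x: "x \<in> carrier R" and y: "y \<in> carrier (direct_sum B M)"
  shows "act M (\<lambda>b b'. if b = b' then x else \<zero>) y = x \<odot>\<^bsub>direct_sum B M\<^esub> y"
proof -
  note s = direct_sum_support[OF y]
  have "act M (\<lambda>b b'. if b = b' then x else \<zero>) y b' = x \<odot>\<^bsub>M\<^esub> y b'" for b'
  proof (cases "y b' = \<zero>\<^bsub>M\<^esub>")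
    case True
    have "act M (\<lambda>b b'. if b = b' then x else \<zero>) y b' = \<zero>\<^bsub>M\<^esub>"
      unfolding act_def using s True by (intro M.add.finprod_one_eqI) auto
    then show ?thesis using True x by simp
  next
    case False
    have "(\<Oplus>\<^bsub>M\<^esub>b\<in>{b. y b \<noteq> \<zero>\<^bsub>M\<^esub>}. (if b = b' then x else \<zero>) \<odot>\<^bsub>M\<^esub> y b) =
        (\<Oplus>\<^bsub>M\<^esub>b\<in>{b. y b \<noteq> \<zero>\<^bsub>M\<^esub>}. if b' = b then x \<odot>\<^bsub>M\<^esub> y b else \<zero>\<^bsub>M\<^esub>)"
      using s x by (intro M.finsum_cong') auto
    also have "\<dots> = x \<odot>\<^bsub>M\<^esub> y b'"
      using False s x by (intro M.finsum_singleton) auto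
    finally show ?thesis by (simp add: act_def)
  qed
  then show ?thesis by auto
qed

end

text \<open>
  The horizontal and the vertical maps of the double complex commute because matrices over \<open>R\<close> commute with
  \<open>R\<close>-linear maps of the entries.
\<close>

lemma act_natural:
  assumes "module R M" "module R N" "f \<in> linear_hom R M N"
    and K: "column_finite R B B' K" and y: "y \<in> carrier (direct_sum B M)"
  shows "act N K (f \<circ> y) = f \<circ> act M K y"
proof
  fix b'
  interpret M: module R M by fact
  interpret N: module R N by fact
  note s = M.direct_sum_support[OF y]
  note f = linear_homD[OF assms(3)] linear_hom_zero[OF assms(1-3)]
  have "act N K (f \<circ> y) b' = (\<Oplus>\<^bsub>N\<^esub>b\<in>{b. y b \<noteq> \<zero>\<^bsub>M\<^esub>}. K b b' \<odot>\<^bsub>N\<^esub> (f \<circ> y) b)"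
    using linear_homD(1)[OF direct_sum_map[OF assms(1-3)] y] f(4)
    by (intro N.act_eq_finsum[OF K _ s(1,2)]) auto
  also have "\<dots> = (\<Oplus>\<^bsub>N\<^esub>b\<in>{b. y b \<noteq> \<zero>\<^bsub>M\<^esub>}. f (K b b' \<odot>\<^bsub>M\<^esub> y b))"
    using s column_finiteD(1)[OF K] f by (intro N.M.finsum_cong') auto
  also have "\<dots> = f (act M K y b')"
  proof -
    have "f (\<Oplus>\<^bsub>M\<^esub>b\<in>U. K b b' \<odot>\<^bsub>M\<^esub> y b) = (\<Oplus>\<^bsub>N\<^esub>b\<in>U. f (K b b' \<odot>\<^bsub>M\<^esub> y b))"
      if "finite U" "U \<subseteq> B" for U using that
    proof (induction U rule: finite_induct)
      case (insert b U)
      have "(\<lambda>b. K b b' \<odot>\<^bsub>M\<^esub> y b) \<in> insert b U \<rightarrow> carrier M"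
        using insert s(3) column_finiteD(1)[OF K] by auto
      then show ?case using insert f
        by (simp add: M.M.finsum_insert N.M.finsum_insert Pi_iff M.M.finsum_closed)
    qed (simp add: f)
    then show ?thesis using s by (simp add: act_def)
  qed
  finally show "act N K (f \<circ> y) b' = (f \<circ> act M K y) b'" by simp
qed

section \<open>A double complex with torsion\<close>

text \<open>
  The product of the ideals \<open>A k, \<dots>, A (k + p)\<close>, bracketed in the order in which the induction along an
  antidiagonal of the double complex uses its factors.
\<close>

primrec ideal_prod_from :: "('a, 'r) ring_scheme \<Rightarrow> (nat \<Rightarrow> 'a set) \<Rightarrow> nat \<Rightarrow> nat \<Rightarrow> 'a set" where
  "ideal_prod_from R A 0 k = A k"
| "ideal_prod_from R A (Suc p) k = A k \<cdot>\<^bsub>R\<^esub> ideal_prod_from R A p (Suc k)"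

lemma (in cring) ideal_prod_from_ideal:
  "(\<And>k. ideal (A k) R) \<Longrightarrow> ideal (ideal_prod_from R A p k) R"
  by (induction p arbitrary: k) (auto intro: ideal_prod_is_ideal)

text \<open>
  The first index is shifted by one: position \<open>Suc p\<close> holds the \<open>p\<close>-th module of the given complex, and
  position \<open>0\<close> holds a zero module.  Thus coboundaries are always images of the preceding horizontal map.
\<close>

locale torsion_double_complex = R?: cring R for R :: "('a, 'r) ring_scheme" (structure) +
  fixes T :: "nat \<Rightarrow> nat \<Rightarrow> ('a, 't) module" and dh dv :: "nat \<Rightarrow> nat \<Rightarrow> 't \<Rightarrow> 't"
    and \<Gamma> :: "nat \<Rightarrow> nat \<Rightarrow> 't set" and A :: "nat \<Rightarrow> 'a set"
  assumes T_module: "\<And>p q. module R (T p q)"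
    and dh: "\<And>p q. dh p q \<in> linear_hom R (T p q) (T (Suc p) q)"
    and dv: "\<And>p q. dv p q \<in> linear_hom R (T p q) (T p (Suc q))"
    and dh_dh: "\<And>p q y. y \<in> carrier (T p q) \<Longrightarrow> dh (Suc p) q (dh p q y) = \<zero>\<^bsub>T (Suc (Suc p)) q\<^esub>"
    and dv_dv: "\<And>p q y. y \<in> carrier (T p q) \<Longrightarrow> dv p (Suc q) (dv p q y) = \<zero>\<^bsub>T p (Suc (Suc q))\<^esub>"
    and commute: "\<And>p q y. y \<in> carrier (T p q) \<Longrightarrow> dv (Suc p) q (dh p q y) = dh p (Suc q) (dv p q y)"
    and T_0: "\<And>q. carrier (T 0 q) = {\<zero>\<^bsub>T 0 q\<^esub>}"
    and \<Gamma>_submodule: "\<And>p q. submodule (\<Gamma> p q) R (T p q)"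
    and dh_\<Gamma>: "\<And>p q y. y \<in> \<Gamma> p q \<Longrightarrow> dh p q y \<in> \<Gamma> (Suc p) q"
    and dv_\<Gamma>: "\<And>p q y. y \<in> \<Gamma> p q \<Longrightarrow> dv p q y \<in> \<Gamma> p (Suc q)"
    and rows_exact_mod_\<Gamma>: "\<And>p q y. y \<in> carrier (T (Suc p) q) \<Longrightarrow> dh (Suc p) q y \<in> \<Gamma> (Suc (Suc p)) q \<Longrightarrow>
        \<exists>w\<in>carrier (T p q). y \<ominus>\<^bsub>T (Suc p) q\<^esub> dh p q w \<in> \<Gamma> (Suc p) q"
    and columns_exact: "\<And>p q y. y \<in> carrier (T p (Suc q)) \<Longrightarrow> dv p (Suc q) y = \<zero>\<^bsub>T p (Suc (Suc q))\<^esub> \<Longrightarrow>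
        y \<in> dv p q ` carrier (T p q)"
    and A_ideal: "\<And>q. ideal (A q) R"
    and A_annihilates_0: "\<And>p c g. c \<in> A 0 \<Longrightarrow> g \<in> \<Gamma> p 0 \<Longrightarrow> dv p 0 g = \<zero>\<^bsub>T p (Suc 0)\<^esub> \<Longrightarrow>
        c \<odot>\<^bsub>T p 0\<^esub> g = \<zero>\<^bsub>T p 0\<^esub>"
    and A_annihilates_Suc: "\<And>p q c g. c \<in> A (Suc q) \<Longrightarrow> g \<in> \<Gamma> p (Suc q) \<Longrightarrow>
        dv p (Suc q) g = \<zero>\<^bsub>T p (Suc (Suc q))\<^esub> \<Longrightarrow> c \<odot>\<^bsub>T p (Suc q)\<^esub> g \<in> dv p q ` \<Gamma> p q"
begin

definition coboundary :: "nat \<Rightarrow> nat \<Rightarrow> 't set" where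
  "coboundary p q = (case q of 0 \<Rightarrow> {\<zero>\<^bsub>T p 0\<^esub>} | Suc k \<Rightarrow> dv p k ` \<Gamma> p k)"

lemma coboundary_add:
  assumes "v \<in> coboundary p q" "w \<in> coboundary p q"
  shows "v \<oplus>\<^bsub>T p q\<^esub> w \<in> coboundary p q"
proof (cases q)
  case 0
  interpret T: module R "T p 0" by (rule T_module)
  show ?thesis using assms 0 by (simp add: coboundary_def)
next
  case (Suc k)
  interpret T: module R "T p k" by (rule T_module)
  obtain a b where ab: "a \<in> \<Gamma> p k" "b \<in> \<Gamma> p k" "v = dv p k a" "w = dv p k b"
    using assms Suc by (auto simp: coboundary_def)
  then have "a \<in> carrier (T p k)" "b \<in> carrier (T p k)"
    using T.submoduleE(1)[OF \<Gamma>_submodule] by auto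
  then have "v \<oplus>\<^bsub>T p q\<^esub> w = dv p k (a \<oplus>\<^bsub>T p k\<^esub> b)"
    using ab Suc linear_homD(2)[OF dv] by simp
  then show ?thesis
    using ab Suc T.submoduleE(5)[OF \<Gamma>_submodule] by (auto simp: coboundary_def)
qed

lemma coboundary_carrier: "coboundary p q \<subseteq> carrier (T p q)"
proof (cases q)
  case 0
  interpret T: module R "T p 0" by (rule T_module)
  show ?thesis using 0 by (simp add: coboundary_def)
next
  case (Suc k)
  interpret T: module R "T p k" by (rule T_module)
  show ?thesis using Suc linear_homD(1)[OF dv] T.submoduleE(1)[OF \<Gamma>_submodule]
    by (auto simp: coboundary_def)
qed

lemma A_annihilates:
  assumes "c \<in> A q" "g \<in> \<Gamma> p q" "dv p q g = \<zero>\<^bsub>T p (Suc q)\<^esub>"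
  shows "c \<odot>\<^bsub>T p q\<^esub> g \<in> coboundary p q"
  using assms A_annihilates_0 A_annihilates_Suc by (cases q) (auto simp: coboundary_def)

text \<open>
  The ring elements that make \<open>y\<close> horizontally a coboundary of a vertical cocycle, up to a vertical
  coboundary of torsion.  In the row \<open>q = 0\<close> the latter is zero and vertical cocycles are elements of the
  complex that the columns resolve, so there the elements of this set make \<open>y\<close> a coboundary of that complex.
\<close>

definition lifting_multipliers :: "nat \<Rightarrow> nat \<Rightarrow> 't \<Rightarrow> 'a set" where
  "lifting_multipliers p q y = {c \<in> carrier R. \<exists>w\<in>carrier (T p q). dv p q w = \<zero>\<^bsub>T p (Suc q)\<^esub> \<and>
     (\<exists>v\<in>coboundary (Suc p) q. c \<odot>\<^bsub>T (Suc p) q\<^esub> y = dh p q w \<oplus>\<^bsub>T (Suc p) q\<^esub> v)}"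

lemma lifting_multipliers_add:
  assumes "c \<in> lifting_multipliers p q y" "d \<in> lifting_multipliers p q y" "y \<in> carrier (T (Suc p) q)"
  shows "c \<oplus> d \<in> lifting_multipliers p q y"
proof -
  interpret T: module R "T p q" by (rule T_module)
  interpret T': module R "T (Suc p) q" by (rule T_module)
  interpret T'': module R "T p (Suc q)" by (rule T_module)
  obtain w v where w: "c \<in> carrier R" "w \<in> carrier (T p q)" "dv p q w = \<zero>\<^bsub>T p (Suc q)\<^esub>"
    "v \<in> coboundary (Suc p) q" "c \<odot>\<^bsub>T (Suc p) q\<^esub> y = dh p q w \<oplus>\<^bsub>T (Suc p) q\<^esub> v"
    using assms(1) by (auto simp: lifting_multipliers_def)
  obtain w' v' where w': "d \<in> carrier R" "w' \<in> carrier (T p q)" "dv p q w' = \<zero>\<^bsub>T p (Suc q)\<^esub>"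
    "v' \<in> coboundary (Suc p) q" "d \<odot>\<^bsub>T (Suc p) q\<^esub> y = dh p q w' \<oplus>\<^bsub>T (Suc p) q\<^esub> v'"
    using assms(2) by (auto simp: lifting_multipliers_def)
  have v: "v \<in> carrier (T (Suc p) q)" "v' \<in> carrier (T (Suc p) q)"
    using coboundary_carrier w(4) w'(4) by auto
  have "(c \<oplus> d) \<odot>\<^bsub>T (Suc p) q\<^esub> y = dh p q (w \<oplus>\<^bsub>T p q\<^esub> w') \<oplus>\<^bsub>T (Suc p) q\<^esub> (v \<oplus>\<^bsub>T (Suc p) q\<^esub> v')"
    using w w' v assms(3) linear_homD(1,2)[OF dh]
    by (simp add: T'.smult_l_distr T'.M.a_ac)
  moreover have "dv p q (w \<oplus>\<^bsub>T p q\<^esub> w') = \<zero>\<^bsub>T p (Suc q)\<^esub>"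
    using w w' linear_homD(2)[OF dv] by simp
  ultimately show ?thesis
    unfolding lifting_multipliers_def using coboundary_add[OF w(4) w'(4)] w w' by blast
qed

text \<open>
  If \<open>b y\<close> is the horizontal coboundary of a vertical cocycle up to torsion \<open>g\<close>, then \<open>g\<close> is a vertical cocycle
  as well, and a factor from \<open>A q\<close> turns it into a vertical coboundary.
\<close>

lemma lifting_multipliers_mult:
  assumes y: "y \<in> carrier (T (Suc p) q)" "dv (Suc p) q y = \<zero>\<^bsub>T (Suc p) (Suc q)\<^esub>"
    and b: "b \<in> carrier R" and w: "w \<in> carrier (T p q)" "dv p q w = \<zero>\<^bsub>T p (Suc q)\<^esub>"
    and g: "g \<in> \<Gamma> (Suc p) q" and eq: "b \<odot>\<^bsub>T (Suc p) q\<^esub> y = dh p q w \<oplus>\<^bsub>T (Suc p) q\<^esub> g"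
    and c: "c \<in> A q"
  shows "c \<otimes> b \<in> lifting_multipliers p q y"
proof -
  interpret T: module R "T p q" by (rule T_module)
  interpret T': module R "T (Suc p) q" by (rule T_module)
  interpret T'': module R "T p (Suc q)" by (rule T_module)
  interpret T3: module R "T (Suc p) (Suc q)" by (rule T_module)
  have cR: "c \<in> carrier R" using ideal.Icarr[OF A_ideal c] .
  have gT: "g \<in> carrier (T (Suc p) q)" using T'.submoduleE(1)[OF \<Gamma>_submodule] g by auto
  have dw: "dh p q w \<in> carrier (T (Suc p) q)" using linear_homD(1)[OF dh] w by auto
  have "dv (Suc p) q (dh p q w) = \<zero>\<^bsub>T (Suc p) (Suc q)\<^esub>"
    using commute[OF w(1)] w(2) linear_hom_zero[OF T_module T_module dh] by simp
  moreover have "dv (Suc p) q (b \<odot>\<^bsub>T (Suc p) q\<^esub> y) = \<zero>\<^bsub>T (Suc p) (Suc q)\<^esub>"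
    using linear_homD(3)[OF dv b y(1)] y(2) b by simp
  ultimately have "dv (Suc p) q g = \<zero>\<^bsub>T (Suc p) (Suc q)\<^esub>"
    using eq linear_homD(2)[OF dv dw gT] linear_homD(1)[OF dv gT] by simp
  then have "c \<odot>\<^bsub>T (Suc p) q\<^esub> g \<in> coboundary (Suc p) q" using A_annihilates c g by blast
  moreover have "(c \<otimes> b) \<odot>\<^bsub>T (Suc p) q\<^esub> y = dh p q (c \<odot>\<^bsub>T p q\<^esub> w) \<oplus>\<^bsub>T (Suc p) q\<^esub> c \<odot>\<^bsub>T (Suc p) q\<^esub> g"
    using cR b y eq dw gT w linear_homD(3)[OF dh] by (simp add: T'.smult_assoc1 T'.smult_r_distr)
  moreover have "dv p q (c \<odot>\<^bsub>T p q\<^esub> w) = \<zero>\<^bsub>T p (Suc q)\<^esub>"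
    using linear_homD(3)[OF dv cR w(1)] w(2) cR by simp
  ultimately show ?thesis unfolding lifting_multipliers_def using cR b w by blast
qed

text \<open>
  Modulo torsion, \<open>y\<close> is the horizontal image of some \<open>w\<close>.  The induction hypothesis applies to \<open>dv w\<close>, which
  sits one step further along the antidiagonal: a multiple \<open>b\<close> of it is \<open>dh u\<close> plus \<open>dv \<beta>\<close> with a vertical cocycle
  \<open>u = dv u'\<close> and torsion \<open>\<beta>\<close>.  Hence \<open>b w - dh u' - \<beta>\<close> is a vertical cocycle, and its horizontal image differs
  from \<open>b y\<close> by torsion only.
\<close>

theorem ideal_prod_from_lifts:
  assumes "y \<in> carrier (T (Suc p) q)" "dv (Suc p) q y = \<zero>\<^bsub>T (Suc p) (Suc q)\<^esub>"
    and "dh (Suc p) q y \<in> \<Gamma> (Suc (Suc p)) q"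
  shows "ideal_prod_from R A p q \<subseteq> lifting_multipliers p q y"
  using assms
proof (induction p arbitrary: q y)
  case 0
  interpret T: module R "T 0 q" by (rule T_module)
  interpret T': module R "T (Suc 0) q" by (rule T_module)
  obtain w where w: "w \<in> carrier (T 0 q)" and g: "y \<ominus>\<^bsub>T (Suc 0) q\<^esub> dh 0 q w \<in> \<Gamma> (Suc 0) q"
    using rows_exact_mod_\<Gamma>[OF 0(1,3)] by auto
  have w0: "w = \<zero>\<^bsub>T 0 q\<^esub>" "dh 0 q w = \<zero>\<^bsub>T (Suc 0) q\<^esub>"
    using w T_0 linear_hom_zero[OF T_module T_module dh] by auto
  then have "y \<in> \<Gamma> (Suc 0) q" using g 0(1) T'.M.minus_add_cancel[of y "\<zero>\<^bsub>T (Suc 0) q\<^esub>"] by simp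
  then have "c \<otimes> \<one> \<in> lifting_multipliers 0 q y" if "c \<in> A q" for c
    using lifting_multipliers_mult[OF 0(1,2), of \<one> "\<zero>\<^bsub>T 0 q\<^esub>" y c] 0(1) w0 that
      linear_hom_zero[OF T_module T_module dv] by simp
  moreover have "c \<otimes> \<one> = c" if "c \<in> A q" for c using ideal.Icarr[OF A_ideal that] by simp
  ultimately show ?case by (metis ideal_prod_from.simps(1) subsetI)
next
  case (Suc p)
  interpret T0: module R "T p q" by (rule T_module)
  interpret T: module R "T (Suc p) q" by (rule T_module)
  interpret T': module R "T (Suc (Suc p)) q" by (rule T_module)
  interpret Tv: module R "T (Suc p) (Suc q)" by (rule T_module)
  interpret Tv': module R "T (Suc (Suc p)) (Suc q)" by (rule T_module)
  obtain w where w: "w \<in> carrier (T (Suc p) q)"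
    and g: "y \<ominus>\<^bsub>T (Suc (Suc p)) q\<^esub> dh (Suc p) q w \<in> \<Gamma> (Suc (Suc p)) q"
    using rows_exact_mod_\<Gamma>[OF Suc.prems(1,3)] by auto
  define g where "g = y \<ominus>\<^bsub>T (Suc (Suc p)) q\<^esub> dh (Suc p) q w"
  have g: "g \<in> \<Gamma> (Suc (Suc p)) q" using g by (simp add: g_def)
  have gT: "g \<in> carrier (T (Suc (Suc p)) q)" using T'.submoduleE(1)[OF \<Gamma>_submodule] g by auto
  have dw: "dh (Suc p) q w \<in> carrier (T (Suc (Suc p)) q)" using linear_homD(1)[OF dh] w by auto
  have y: "y = g \<oplus>\<^bsub>T (Suc (Suc p)) q\<^esub> dh (Suc p) q w"
    unfolding g_def using Suc.prems(1) dw by (simp add: T'.M.minus_add_cancel)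
  define y' where "y' = dv (Suc p) q w"
  have y'T: "y' \<in> carrier (T (Suc p) (Suc q))" unfolding y'_def using linear_homD(1)[OF dv] w by auto
  have "dh (Suc p) (Suc q) y' = dv (Suc (Suc p)) q (dh (Suc p) q w)"
    unfolding y'_def using commute[OF w] by simp
  also have "dh (Suc p) q w = y \<ominus>\<^bsub>T (Suc (Suc p)) q\<^esub> g"
    using y gT dw by (intro T'.M.minus_eqI) (simp_all add: T'.M.a_comm)
  also have "dv (Suc (Suc p)) q (y \<ominus>\<^bsub>T (Suc (Suc p)) q\<^esub> g) = \<zero>\<^bsub>T (Suc (Suc p)) (Suc q)\<^esub> \<ominus>\<^bsub>T (Suc (Suc p)) (Suc q)\<^esub> dv (Suc (Suc p)) q g"
    using linear_hom_minus[OF T_module T_module dv Suc.prems(1) gT] Suc.prems(2) by simp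
  finally have dy': "dh (Suc p) (Suc q) y' \<in> \<Gamma> (Suc (Suc p)) (Suc q)"
    using Tv'.submodule_diff[OF \<Gamma>_submodule Tv'.submodule_zero[OF \<Gamma>_submodule] dv_\<Gamma>[OF g]] by simp
  have IH: "ideal_prod_from R A p (Suc q) \<subseteq> lifting_multipliers p (Suc q) y'"
    using Suc.IH[OF y'T _ dy'] dv_dv[OF w] by (simp add: y'_def)
  have mult: "c \<otimes> b \<in> lifting_multipliers (Suc p) q y" if c: "c \<in> A q"
    and b: "b \<in> ideal_prod_from R A p (Suc q)" for c b
  proof -
    have "b \<in> lifting_multipliers p (Suc q) y'" using IH b by auto
    then obtain u v where bR: "b \<in> carrier R"
      and u: "u \<in> carrier (T p (Suc q))" "dv p (Suc q) u = \<zero>\<^bsub>T p (Suc (Suc q))\<^esub>"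
      and v: "v \<in> coboundary (Suc p) (Suc q)"
        and by': "b \<odot>\<^bsub>T (Suc p) (Suc q)\<^esub> y' = dh p (Suc q) u \<oplus>\<^bsub>T (Suc p) (Suc q)\<^esub> v"
      by (auto simp: lifting_multipliers_def)
    obtain \<beta> where \<beta>: "\<beta> \<in> \<Gamma> (Suc p) q" "v = dv (Suc p) q \<beta>" using v by (auto simp: coboundary_def)
    obtain u' where u': "u' \<in> carrier (T p q)" "u = dv p q u'" using columns_exact[OF u] by auto
    have \<beta>T: "\<beta> \<in> carrier (T (Suc p) q)" using T.submoduleE(1)[OF \<Gamma>_submodule] \<beta> by auto
    have du': "dh p q u' \<in> carrier (T (Suc p) q)" using linear_homD(1)[OF dh u'(1)] .
    have bw: "b \<odot>\<^bsub>T (Suc p) q\<^esub> w \<in> carrier (T (Suc p) q)" using bR w by simp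
    define s where "s = dh p q u' \<oplus>\<^bsub>T (Suc p) q\<^esub> \<beta>"
    have sT: "s \<in> carrier (T (Suc p) q)" unfolding s_def using du' \<beta>T by simp
    define w' where "w' = b \<odot>\<^bsub>T (Suc p) q\<^esub> w \<ominus>\<^bsub>T (Suc p) q\<^esub> s"
    have w'T: "w' \<in> carrier (T (Suc p) q)" unfolding w'_def using bw sT by simp
    have dvs: "dv (Suc p) q s = b \<odot>\<^bsub>T (Suc p) (Suc q)\<^esub> y'"
      unfolding s_def using linear_homD(2)[OF dv du' \<beta>T] commute[OF u'(1)] u'(2) \<beta>(2) by' by simp
    have dvw': "dv (Suc p) q w' = \<zero>\<^bsub>T (Suc p) (Suc q)\<^esub>"
      unfolding w'_def using linear_hom_minus[OF T_module T_module dv bw sT] dvs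
        linear_homD(3)[OF dv bR w] bR y'T by (simp add: y'_def Tv.M.minus_eq_zero_iff)
    have d\<beta>: "dh (Suc p) q \<beta> \<in> carrier (T (Suc (Suc p)) q)" using linear_homD(1)[OF dh \<beta>T] .
    have dhs: "dh (Suc p) q s = dh (Suc p) q \<beta>"
      unfolding s_def using linear_homD(2)[OF dh du' \<beta>T] dh_dh[OF u'(1)] d\<beta> by simp
    have "dh (Suc p) q (b \<odot>\<^bsub>T (Suc p) q\<^esub> w) = dh (Suc p) q (w' \<oplus>\<^bsub>T (Suc p) q\<^esub> s)"
      unfolding w'_def using bw sT by (simp add: T.M.minus_add_cancel)
    then have bdw: "b \<odot>\<^bsub>T (Suc (Suc p)) q\<^esub> dh (Suc p) q w = dh (Suc p) q w' \<oplus>\<^bsub>T (Suc (Suc p)) q\<^esub> dh (Suc p) q \<beta>"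
      using linear_homD(3)[OF dh bR w] linear_homD(2)[OF dh w'T sT] dhs by simp
    define g' where "g' = b \<odot>\<^bsub>T (Suc (Suc p)) q\<^esub> g \<oplus>\<^bsub>T (Suc (Suc p)) q\<^esub> dh (Suc p) q \<beta>"
    have g': "g' \<in> \<Gamma> (Suc (Suc p)) q"
      unfolding g'_def using T'.submoduleE(4,5)[OF \<Gamma>_submodule] bR g dh_\<Gamma>[OF \<beta>(1)] by simp
    have "b \<odot>\<^bsub>T (Suc (Suc p)) q\<^esub> y = dh (Suc p) q w' \<oplus>\<^bsub>T (Suc (Suc p)) q\<^esub> g'"
      unfolding g'_def y using bR gT dw d\<beta> bdw linear_homD(1)[OF dh w'T]
      by (simp add: T'.smult_r_distr T'.M.a_ac)
    then show ?thesis using lifting_multipliers_mult[OF Suc.prems(1,2) bR w'T dvw' g' _ c] by simp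
  qed
  show ?case
  proof
    fix c assume "c \<in> ideal_prod_from R A (Suc p) q"
    then have "c \<in> A q \<cdot> ideal_prod_from R A p (Suc q)" by simp
    then show "c \<in> lifting_multipliers (Suc p) q y"
      by (induction c rule: ideal_prod.induct) (auto intro: mult lifting_multipliers_add[OF _ _ Suc.prems(1)])
  qed
qed

end

section \<open>Null-homotopies and exactness of rows modulo torsion\<close>

text \<open>
  The pair \<open>h0\<close>, \<open>h1\<close> is the part at one position of a homotopy between multiplication by \<open>x\<close> and zero.  The
  identity is required for matrices over \<open>R\<close>, which gives it for all coefficient modules
  (\<open>homotopy_at_act\<close>).
\<close>

definition homotopy_at ::
    "('a, 'r) ring_scheme \<Rightarrow> 'i set \<Rightarrow> 'i set \<Rightarrow> 'i set \<Rightarrow> ('i \<Rightarrow> 'i \<Rightarrow> 'a) \<Rightarrow> ('i \<Rightarrow> 'i \<Rightarrow> 'a) \<Rightarrow>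
     'a \<Rightarrow> ('i \<Rightarrow> 'i \<Rightarrow> 'a) \<Rightarrow> ('i \<Rightarrow> 'i \<Rightarrow> 'a) \<Rightarrow> bool" where
  "homotopy_at R B0 B1 B2 D0 D1 x h0 h1 \<longleftrightarrow> column_finite R B1 B0 h0 \<and> column_finite R B2 B1 h1 \<and>
     (\<forall>b\<in>B1. \<forall>b'. (if b = b' then x else \<zero>\<^bsub>R\<^esub>) =
        act (regular_module R) D0 (h0 b) b' \<oplus>\<^bsub>R\<^esub> act (regular_module R) h1 (D1 b) b')"

context module
begin

lemma column_finite_comp:
  assumes "column_finite R B B' K" "column_finite R B' B'' L"
  shows "column_finite R B B'' (\<lambda>b. act (regular_module R) L (K b))"
proof -
  interpret S: module R "regular_module R" by (rule R.regular_module_module)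
  show ?thesis unfolding column_finite_def
    using S.act_closed[OF assms(2)] column_finiteD(4)[OF assms(1)] by blast
qed

lemma homotopy_at_act:
  assumes D0: "column_finite R B0 B1 D0" and D1: "column_finite R B1 B2 D1" and x: "x \<in> carrier R"
    and h: "homotopy_at R B0 B1 B2 D0 D1 x h0 h1" and y: "y \<in> carrier (direct_sum B1 M)"
  shows "x \<odot>\<^bsub>direct_sum B1 M\<^esub> y = act M D0 (act M h0 y) \<oplus>\<^bsub>direct_sum B1 M\<^esub> act M h1 (act M D1 y)"
proof -
  have h0: "column_finite R B1 B0 h0" and h1: "column_finite R B2 B1 h1"
    and eq: "\<And>b b'. b \<in> B1 \<Longrightarrow> (if b = b' then x else \<zero>) =
        act (regular_module R) D0 (h0 b) b' \<oplus> act (regular_module R) h1 (D1 b) b'"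
    using h by (auto simp: homotopy_at_def)
  have sc: "column_finite R B1 B1 (\<lambda>b b'. if b = b' then x else \<zero>)"
    unfolding column_finite_def direct_sum_carrier using x by auto
  have "x \<odot>\<^bsub>direct_sum B1 M\<^esub> y = act M (\<lambda>b b'. if b = b' then x else \<zero>) y"
    using act_scalar[OF x y] by simp
  also have "\<dots> = act M (\<lambda>b b'. act (regular_module R) D0 (h0 b) b' \<oplus> act (regular_module R) h1 (D1 b) b') y"
    by (rule act_cong[OF y sc]) (rule eq)
  also have "\<dots> = act M D0 (act M h0 y) \<oplus>\<^bsub>direct_sum B1 M\<^esub> act M h1 (act M D1 y)"
    using act_matrix_add[OF column_finite_comp[OF h0 D0] column_finite_comp[OF D1 h1] y]
      act_act[OF h0 D0 y] act_act[OF D1 h1 y] by simp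
  finally show ?thesis .
qed

lemma act_matrix_smult:
  assumes K: "column_finite R B B' K" and x: "x \<in> carrier R" and y: "y \<in> carrier (direct_sum B M)"
  shows "act M (\<lambda>b b'. x \<otimes> K b b') y = x \<odot>\<^bsub>direct_sum B' M\<^esub> act M K y"
proof -
  note s = direct_sum_support[OF y]
  have "act M (\<lambda>b b'. x \<otimes> K b b') y b' = x \<odot>\<^bsub>M\<^esub> act M K y b'" for b'
  proof -
    have "act M (\<lambda>b b'. x \<otimes> K b b') y b' =
        (\<Oplus>\<^bsub>M\<^esub>b\<in>{b. y b \<noteq> \<zero>\<^bsub>M\<^esub>}. x \<odot>\<^bsub>M\<^esub> (K b b' \<odot>\<^bsub>M\<^esub> y b))"
      unfolding act_def using s column_finiteD(1)[OF K] x
      by (intro M.finsum_cong') (auto simp: smult_assoc1 subset_iff)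
    also have "\<dots> = x \<odot>\<^bsub>M\<^esub> act M K y b'"
      unfolding act_def using s column_finiteD(1)[OF K] x by (intro finsum_smult_ldistr[symmetric]) auto
    finally show ?thesis .
  qed
  then show ?thesis by auto
qed

lemma submodule_finsum:
  assumes "submodule N R M" "\<And>a. a \<in> A \<Longrightarrow> f a \<in> N"
  shows "finsum M f A \<in> N"
  using assms(2)
proof (induction A rule: infinite_finite_induct)
  case (insert a A)
  then have "f \<in> insert a A \<rightarrow> carrier M" using submoduleE(1)[OF assms(1)] by auto
  then show ?case using insert submoduleE(5)[OF assms(1)] by (simp add: M.finsum_insert)
qed (use submodule_zero[OF assms(1)] in auto)

lemma act_submodule:
  assumes "submodule N R M" "column_finite R B B' K" "y \<in> carrier (direct_sum B M)" "\<And>b. y b \<in> N"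
  shows "act M K y b' \<in> N"
  unfolding act_def
  using assms column_finiteD(1)[OF assms(2)] direct_sum_support(2)[OF assms(3)]
  by (intro submodule_finsum[OF assms(1)] submoduleE(4)[OF assms(1)]) auto

end

text \<open>
  The homotopy is built downwards from the position where the complex ends.  Suppose that it exists above
  a position, for \<open>X = x\<^sup>m\<close>.  For a basis vector \<open>b\<close> of this position \<open>X b - h (D b)\<close> is a cocycle, so \<open>x\<close> times it
  is a coboundary \<open>D a\<close>, and \<open>a\<close> is the value at \<open>b\<close> of a homotopy for \<open>x X\<close>; the part built before is
  multiplied by \<open>x\<close>.
\<close>

lemma (in cring) null_homotopic_power:
  fixes B :: "nat \<Rightarrow> 'i set" and D :: "nat \<Rightarrow> 'i \<Rightarrow> 'i \<Rightarrow> 'a"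
  assumes D: "\<And>p. column_finite R (B p) (B (Suc p)) (D p)"
    and DD: "\<And>p b. b \<in> B p \<Longrightarrow> act (regular_module R) (D (Suc p)) (D p b) = (\<lambda>_. \<zero>)"
    and bounded: "\<And>p. p \<ge> n \<Longrightarrow> B (Suc p) = {}" and x: "x \<in> carrier R"
    and kills: "\<And>p c. c \<in> carrier (direct_sum (B (Suc p)) (regular_module R)) \<Longrightarrow>
      act (regular_module R) (D (Suc p)) c = (\<lambda>_. \<zero>) \<Longrightarrow>
      \<exists>a\<in>carrier (direct_sum (B p) (regular_module R)).
        x \<odot>\<^bsub>direct_sum (B (Suc p)) (regular_module R)\<^esub> c = act (regular_module R) (D p) a"
  shows "\<exists>m h. \<forall>p. homotopy_at R (B p) (B (Suc p)) (B (Suc (Suc p))) (D p) (D (Suc p)) (x [^] (m::nat)) (h p) (h (Suc p))"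
proof -
  let ?S = "regular_module R"
  interpret S: module R ?S by (rule regular_module_module)
  have sum: "module R (direct_sum X ?S)" for X :: "'i set" by (rule S.direct_sum_module)
  have "\<exists>m h. \<forall>p. n - k \<le> p \<longrightarrow>
      homotopy_at R (B p) (B (Suc p)) (B (Suc (Suc p))) (D p) (D (Suc p)) (x [^] (m::nat)) (h p) (h (Suc p))"
    if "k \<le> n" for k
    using that
  proof (induction k)
    case 0
    have "B (Suc p) = {} \<and> B (Suc (Suc p)) = {}" if "n - 0 \<le> p" for p using bounded that by auto
    then show ?case by (auto simp: homotopy_at_def column_finite_def)
  next
    case (Suc k)
    then obtain m h where h: "\<And>p. n - k \<le> p \<Longrightarrow>
      homotopy_at R (B p) (B (Suc p)) (B (Suc (Suc p))) (D p) (D (Suc p)) (x [^] (m::nat)) (h p) (h (Suc p))"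
      by auto
    define q where "q = n - Suc k"
    have q: "n - k = Suc q" using Suc.prems by (simp add: q_def)
    define X where "X = x [^] m"
    have X: "X \<in> carrier R" using x by (simp add: X_def)
    have xX: "x [^] Suc m = x \<otimes> X" using x by (simp add: X_def m_comm)
    let ?B = "B (Suc q)"
    let ?T = "direct_sum ?B ?S"
    interpret T: module R ?T by (rule sum)
    have hq: "homotopy_at R (B (Suc q)) (B (Suc (Suc q))) (B (Suc (Suc (Suc q)))) (D (Suc q)) (D (Suc (Suc q))) X (h (Suc q)) (h (Suc (Suc q)))"
      using h[of "Suc q"] q by (simp add: X_def)
    then have hm: "column_finite R (B (Suc (Suc q))) ?B (h (Suc q))" by (simp add: homotopy_at_def)
    define e :: "'i \<Rightarrow> 'i \<Rightarrow> 'a" where "e = (\<lambda>b b'. if b = b' then X else \<zero>)"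
    have e: "e b \<in> carrier ?T" if "b \<in> ?B" for b
      using that X by (auto simp: e_def direct_sum_carrier)
    define u where "u = (\<lambda>b. act ?S (h (Suc q)) (D (Suc q) b))"
    have Db: "D (Suc q) b \<in> carrier (direct_sum (B (Suc (Suc q))) ?S)" if "b \<in> ?B" for b
      using column_finiteD(4)[OF D that] .
    have u: "u b \<in> carrier ?T" if "b \<in> ?B" for b
      unfolding u_def by (rule S.act_closed[OF hm Db[OF that]])
    have ex: "\<exists>a. a \<in> carrier (direct_sum (B q) ?S) \<and> x \<odot>\<^bsub>?T\<^esub> (e b \<ominus>\<^bsub>?T\<^esub> u b) = act ?S (D q) a" if b: "b \<in> ?B" for b
    proof -
      let ?T' = "direct_sum (B (Suc (Suc q))) ?S"
      interpret T': module R ?T' by (rule sum)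
      have De: "act ?S (D (Suc q)) (e b) = X \<odot>\<^bsub>?T'\<^esub> D (Suc q) b"
      proof
        fix b'
        have "act ?S (D (Suc q)) (e b) b' = (\<Oplus>\<^bsub>?S\<^esub>c\<in>{b}. D (Suc q) c b' \<odot>\<^bsub>?S\<^esub> e b c)"
          by (rule S.act_eq_finsum[OF D e[OF b]]) (use b in \<open>auto simp: e_def\<close>)
        also have "\<dots> = D (Suc q) b b' \<otimes> X"
          using column_finiteD(1)[OF D b] X by (simp add: S.M.finsum_insert e_def)
        finally show "act ?S (D (Suc q)) (e b) b' = (X \<odot>\<^bsub>?T'\<^esub> D (Suc q) b) b'"
          using column_finiteD(1)[OF D b] X by (simp add: m_comm)
      qed
      have "X \<odot>\<^bsub>?T'\<^esub> D (Suc q) b = act ?S (D (Suc q)) (u b) \<oplus>\<^bsub>?T'\<^esub> act ?S (h (Suc (Suc q))) (act ?S (D (Suc (Suc q))) (D (Suc q) b))"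
        unfolding u_def by (rule S.homotopy_at_act[OF D D X hq Db[OF b]])
      also have "act ?S (D (Suc (Suc q))) (D (Suc q) b) = \<zero>\<^bsub>direct_sum (B (Suc (Suc (Suc q)))) ?S\<^esub>"
        using DD[OF b] by simp
      also have "act ?S (h (Suc (Suc q))) \<dots> = \<zero>\<^bsub>?T'\<^esub>"
        by (rule linear_hom_zero[OF sum sum S.act_linear_hom]) (use hq in \<open>simp add: homotopy_at_def\<close>)
      finally have Du: "X \<odot>\<^bsub>?T'\<^esub> D (Suc q) b = act ?S (D (Suc q)) (u b)"
        using T'.M.r_zero[OF S.act_closed[OF D u[OF b]]] by simp
      have "act ?S (D (Suc q)) (e b \<ominus>\<^bsub>?T\<^esub> u b) = act ?S (D (Suc q)) (e b) \<ominus>\<^bsub>?T'\<^esub> act ?S (D (Suc q)) (u b)"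
        by (rule linear_hom_minus[OF sum sum S.act_linear_hom[OF D] e[OF b] u[OF b]])
      also have "\<dots> = \<zero>\<^bsub>?T'\<^esub>"
        unfolding De Du using T'.M.minus_eq_zero_iff S.act_closed[OF D u[OF b]] by simp
      finally have "act ?S (D (Suc q)) (e b \<ominus>\<^bsub>?T\<^esub> u b) = (\<lambda>_. \<zero>)" by simp
      then show ?thesis using kills[of "e b \<ominus>\<^bsub>?T\<^esub> u b" q] T.M.minus_closed[OF e[OF b] u[OF b]] by auto
    qed
    then obtain a where a: "\<And>b. b \<in> ?B \<Longrightarrow> a b \<in> carrier (direct_sum (B q) ?S)"
      "\<And>b. b \<in> ?B \<Longrightarrow> x \<odot>\<^bsub>?T\<^esub> (e b \<ominus>\<^bsub>?T\<^esub> u b) = act ?S (D q) (a b)" by metis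
    define h' where "h' = (\<lambda>p b b'. if p = q then a b b' else x \<otimes> h p b b')"
    have h'q: "h' q = a" and h': "p \<noteq> q \<Longrightarrow> h' p = (\<lambda>b b'. x \<otimes> h p b b')" for p
      by (auto simp: h'_def)
    have scaled: "column_finite R X Y (\<lambda>b b'. x \<otimes> K b b')" if "column_finite R X Y K" for X Y :: "'i set" and K
    proof -
      have "(\<lambda>b'. x \<otimes> K b b') \<in> carrier (direct_sum Y ?S)" if "b \<in> X" for b
        using module.smult_closed[OF sum x column_finiteD(4)[OF \<open>column_finite R X Y K\<close> that]] by simp
      then show ?thesis by (simp add: column_finite_def)
    qed
    have "homotopy_at R (B p) (B (Suc p)) (B (Suc (Suc p))) (D p) (D (Suc p)) (x [^] Suc m) (h' p) (h' (Suc p))"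
      if p: "n - Suc k \<le> p" for p
    proof (cases "p = q")
      case True
      have "column_finite R ?B (B q) a" unfolding column_finite_def using a(1) by blast
      moreover have "(if b = b' then x [^] Suc m else \<zero>) =
          act ?S (D q) (a b) b' \<oplus> act ?S (h' (Suc q)) (D (Suc q) b) b'" if b: "b \<in> ?B" for b b'
      proof -
        have "act ?S (h' (Suc q)) (D (Suc q) b) = x \<odot>\<^bsub>?T\<^esub> u b"
          unfolding u_def h'[of "Suc q", simplified] by (rule S.act_matrix_smult[OF hm x Db[OF b]])
        then have "act ?S (D q) (a b) \<oplus>\<^bsub>?T\<^esub> act ?S (h' (Suc q)) (D (Suc q) b) = x \<odot>\<^bsub>?T\<^esub> ((e b \<ominus>\<^bsub>?T\<^esub> u b) \<oplus>\<^bsub>?T\<^esub> u b)"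
          using a(2)[OF b] T.smult_r_distr[OF x T.M.minus_closed[OF e[OF b] u[OF b]] u[OF b]] by metis
        also have "\<dots> = x \<odot>\<^bsub>?T\<^esub> e b" using T.M.minus_add_cancel[OF e[OF b] u[OF b]] by metis
        finally have "act ?S (D q) (a b) b' \<oplus> act ?S (h' (Suc q)) (D (Suc q) b) b' = x \<otimes> e b b'"
          by (simp add: fun_eq_iff)
        then show ?thesis unfolding xX using x by (simp add: e_def)
      qed
      moreover have "column_finite R (B (Suc (Suc q))) ?B (h' (Suc q))"
        using scaled[OF hm] h'[of "Suc q"] by simp
      ultimately show ?thesis unfolding True homotopy_at_def h'q by blast
    next
      case False
      then have p': "n - k \<le> p" and ne: "p \<noteq> q" "Suc p \<noteq> q" using p q by (auto simp: q_def)
      have hp: "homotopy_at R (B p) (B (Suc p)) (B (Suc (Suc p))) (D p) (D (Suc p)) X (h p) (h (Suc p))"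
        using h[OF p'] by (simp add: X_def)
      then have hm: "column_finite R (B (Suc p)) (B p) (h p)" "column_finite R (B (Suc (Suc p))) (B (Suc p)) (h (Suc p))"
        by (auto simp: homotopy_at_def)
      have "(if b = b' then x [^] Suc m else \<zero>) =
          act ?S (D p) (h' p b) b' \<oplus> act ?S (h' (Suc p)) (D (Suc p) b) b'" if b: "b \<in> B (Suc p)" for b b'
      proof -
        have 1: "act ?S (h' (Suc p)) (D (Suc p) b) b' = x \<otimes> act ?S (h (Suc p)) (D (Suc p) b) b'"
          unfolding h'[OF ne(2)] using S.act_matrix_smult[OF hm(2) x column_finiteD(4)[OF D b]] by simp
        have 2: "act ?S (D p) (h' p b) b' = x \<otimes> act ?S (D p) (h p b) b'"
          unfolding h'[OF ne(1)]
          using linear_homD(3)[OF S.act_linear_hom[OF D] x column_finiteD(4)[OF hm(1) b]] by simp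
        have c: "act ?S (h (Suc p)) (D (Suc p) b) b' \<in> carrier R" "act ?S (D p) (h p b) b' \<in> carrier R"
          using S.act_value_closed[OF hm(2) column_finiteD(4)[OF D b]] S.act_value_closed[OF D column_finiteD(4)[OF hm(1) b]] by auto
        have 3: "(if b = b' then X else \<zero>) = act ?S (D p) (h p b) b' \<oplus> act ?S (h (Suc p)) (D (Suc p) b) b'"
          using hp b by (auto simp: homotopy_at_def)
        have "(if b = b' then x [^] Suc m else \<zero>) = x \<otimes> (if b = b' then X else \<zero>)" unfolding xX using x by simp
        then show ?thesis unfolding 1 2 3 using c x by (simp add: r_distr)
      qed
      then show ?thesis
        using scaled[OF hm(1)] scaled[OF hm(2)] h'[OF ne(1)] h'[OF ne(2)] unfolding homotopy_at_def by metis
    qed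
    then show ?case by blast
  qed
  from this[of n] show ?thesis by simp
qed

text \<open>
  The generators \<open>x\<close> of the torsion are treated one after the other: \<open>y'\<close> is what remains of \<open>y\<close> modulo
  coboundaries and torsion, and its entries are torsion for the generators treated so far.  With \<open>z\<close> a null-homotopic
  power of the next generator and \<open>\<rho>\<close> from the splitting lemma for the span of the entries of \<open>y'\<close>, the
  entries of \<open>y' - \<rho> (z y')\<close> are \<open>z\<close>-torsion.  The endomorphism \<open>\<rho>\<close> commutes with matrices, so the homotopy makes
  \<open>\<rho> (z y')\<close> a coboundary, up to the image of the torsion element \<open>D1 y'\<close>.
\<close>

lemma row_exact_mod_torsion:
  fixes R :: "('a, 'r) ring_scheme" and E :: "('a, 'e) module"
  assumes noeth: "noetherian_ring R" and inj: "injective_module R E"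
    and D0: "column_finite R B0 B1 D0" and D1: "column_finite R B1 B2 D1"
    and X: "finite X" "X \<subseteq> carrier R"
    and homotopic: "\<And>x. x \<in> X \<Longrightarrow> \<exists>m h0 h1. homotopy_at R B0 B1 B2 D0 D1 (x [^]\<^bsub>R\<^esub> (m::nat)) h0 h1"
    and \<Gamma>: "submodule \<Gamma> R E" "\<And>f e. f \<in> linear_hom R E E \<Longrightarrow> e \<in> \<Gamma> \<Longrightarrow> f e \<in> \<Gamma>"
    and torsion: "\<And>e. e \<in> carrier E \<Longrightarrow> (\<And>x. x \<in> X \<Longrightarrow> \<exists>t::nat. x [^]\<^bsub>R\<^esub> t \<odot>\<^bsub>E\<^esub> e = \<zero>\<^bsub>E\<^esub>) \<Longrightarrow> e \<in> \<Gamma>"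
    and y: "y \<in> carrier (direct_sum B1 E)" "\<And>b. act E D1 y b \<in> \<Gamma>"
  shows "\<exists>w\<in>carrier (direct_sum B0 E). \<forall>b. (y \<ominus>\<^bsub>direct_sum B1 E\<^esub> act E D0 w) b \<in> \<Gamma>"
proof -
  interpret E: module R E using inj by (simp add: injective_module_def)
  let ?T = "direct_sum B1 E"
  interpret T: module R ?T by (rule E.direct_sum_module)
  interpret T0: module R "direct_sum B0 E" by (rule E.direct_sum_module)
  have E: "module R E" by (rule E.module_axioms)
  note \<Gamma>E = E.submoduleE[OF \<Gamma>(1)]
  have "\<exists>w y'. w \<in> carrier (direct_sum B0 E) \<and> y' \<in> carrier ?T \<and>
      (\<forall>b. (y \<ominus>\<^bsub>?T\<^esub> (act E D0 w \<oplus>\<^bsub>?T\<^esub> y')) b \<in> \<Gamma>) \<and> (\<forall>b. act E D1 y' b \<in> \<Gamma>) \<and>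
      (\<forall>x\<in>X'. \<forall>b. \<exists>t::nat. x [^]\<^bsub>R\<^esub> t \<odot>\<^bsub>E\<^esub> y' b = \<zero>\<^bsub>E\<^esub>)" if "X' \<subseteq> X" for X'
    using finite_subset[OF that X(1)] that
  proof (induction X' rule: finite_induct)
    case empty
    have "act E D0 \<zero>\<^bsub>direct_sum B0 E\<^esub> = \<zero>\<^bsub>?T\<^esub>"
      by (rule linear_hom_zero[OF E.direct_sum_module E.direct_sum_module E.act_linear_hom[OF D0]])
    then have "y \<ominus>\<^bsub>?T\<^esub> (act E D0 \<zero>\<^bsub>direct_sum B0 E\<^esub> \<oplus>\<^bsub>?T\<^esub> y) = \<zero>\<^bsub>?T\<^esub>"
      using y(1) T.M.minus_eq_zero_iff[OF y(1) y(1)] T.M.l_zero[OF y(1)] by metis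
    then show ?case using y E.submodule_zero[OF \<Gamma>(1)] T0.M.zero_closed
      by (intro exI[of _ "\<zero>\<^bsub>direct_sum B0 E\<^esub>"] exI[of _ y]) auto
  next
    case (insert x X')
    then obtain w y' where w: "w \<in> carrier (direct_sum B0 E)" and y': "y' \<in> carrier ?T"
      and d: "\<And>b. (y \<ominus>\<^bsub>?T\<^esub> (act E D0 w \<oplus>\<^bsub>?T\<^esub> y')) b \<in> \<Gamma>" and D1y': "\<And>b. act E D1 y' b \<in> \<Gamma>"
      and tors: "\<And>x b. x \<in> X' \<Longrightarrow> \<exists>t::nat. x [^]\<^bsub>R\<^esub> t \<odot>\<^bsub>E\<^esub> y' b = \<zero>\<^bsub>E\<^esub>" by auto
    have xR: "x \<in> carrier R" using insert.prems X(2) by auto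
    obtain m h0 h1 where h: "homotopy_at R B0 B1 B2 D0 D1 (x [^]\<^bsub>R\<^esub> (m::nat)) h0 h1"
      using homotopic insert.prems by blast
    define z where "z = x [^]\<^bsub>R\<^esub> m"
    have z: "z \<in> carrier R" using xR by (simp add: z_def)
    have h0: "column_finite R B1 B0 h0" and h1: "column_finite R B2 B1 h1"
      using h by (auto simp: homotopy_at_def)
    have "finite (insert \<zero>\<^bsub>E\<^esub> (y' ` {b. y' b \<noteq> \<zero>\<^bsub>E\<^esub>}))" using E.direct_sum_support(1)[OF y'] by simp
    then obtain es where es: "set es = insert \<zero>\<^bsub>E\<^esub> (y' ` {b. y' b \<noteq> \<zero>\<^bsub>E\<^esub>})" using finite_list by blast
    have esE: "set es \<subseteq> carrier E" using es E.direct_sum_support(3)[OF y'] by auto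
    obtain \<rho> t where \<rho>: "\<rho> \<in> linear_hom R E E"
      and t: "\<And>f. f \<in> lin_span R E es \<Longrightarrow> z [^]\<^bsub>R\<^esub> (t::nat) \<odot>\<^bsub>E\<^esub> (f \<ominus>\<^bsub>E\<^esub> \<rho> (z \<odot>\<^bsub>E\<^esub> f)) = \<zero>\<^bsub>E\<^esub>"
      using injective_module_torsion_splitting[OF noeth inj z esE] by blast
    note \<rho>D = linear_homD[OF \<rho>]
    define \<sigma> where "\<sigma> = (\<lambda>e. e \<ominus>\<^bsub>E\<^esub> \<rho> (z \<odot>\<^bsub>E\<^esub> e))"
    have \<sigma>: "\<sigma> \<in> linear_hom R E E"
    proof (rule linear_homI)
      fix a e assume "a \<in> carrier R" "e \<in> carrier E"
      then have "z \<odot>\<^bsub>E\<^esub> (a \<odot>\<^bsub>E\<^esub> e) = a \<odot>\<^bsub>E\<^esub> (z \<odot>\<^bsub>E\<^esub> e)" using z by (metis E.R.m_comm E.smult_assoc1)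
      then show "\<sigma> (a \<odot>\<^bsub>E\<^esub> e) = a \<odot>\<^bsub>E\<^esub> \<sigma> e"
        using \<open>a \<in> _\<close> \<open>e \<in> _\<close> z \<rho>D by (simp add: \<sigma>_def E.smult_minus_distr)
    qed (use z \<rho>D in \<open>auto simp: \<sigma>_def E.smult_r_distr a_minus_def E.M.minus_add E.M.a_ac\<close>)
    note \<sigma>D = linear_homD[OF \<sigma>]
    let ?y = "\<sigma> \<circ> y'"
    let ?w = "w \<oplus>\<^bsub>direct_sum B0 E\<^esub> (\<rho> \<circ> act E h0 y')"
    have h0y': "act E h0 y' \<in> carrier (direct_sum B0 E)" by (rule E.act_closed[OF h0 y'])
    have D1y'T: "act E D1 y' \<in> carrier (direct_sum B2 E)" by (rule E.act_closed[OF D1 y'])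
    have \<rho>h: "\<rho> \<circ> act E h0 y' \<in> carrier (direct_sum B0 E)"
      using linear_homD(1)[OF direct_sum_map[OF E E \<rho>] h0y'] .
    have \<rho>D1: "\<rho> \<circ> act E D1 y' \<in> carrier (direct_sum B2 E)"
      using linear_homD(1)[OF direct_sum_map[OF E E \<rho>] D1y'T] .
    have w': "?w \<in> carrier (direct_sum B0 E)" using w \<rho>h by (rule T0.M.a_closed)
    have yT: "?y \<in> carrier ?T" using linear_homD(1)[OF direct_sum_map[OF E E \<sigma>] y'] .
    have D1\<sigma>: "act E D1 ?y = \<sigma> \<circ> act E D1 y'" by (rule act_natural[OF E E \<sigma> D1 y'])
    define k where "k = act E h1 (\<rho> \<circ> act E D1 y')"
    have k\<Gamma>: "k b \<in> \<Gamma>" for b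
      unfolding k_def by (rule E.act_submodule[OF \<Gamma>(1) h1 \<rho>D1]) (use \<Gamma>(2)[OF \<rho>] D1y' in auto)
    have kT: "k \<in> carrier ?T" unfolding k_def by (rule E.act_closed[OF h1 \<rho>D1])
    have zy': "z \<odot>\<^bsub>?T\<^esub> y' = act E D0 (act E h0 y') \<oplus>\<^bsub>?T\<^esub> act E h1 (act E D1 y')"
      using E.homotopy_at_act[OF D0 D1 z _ y'] h by (simp add: z_def)
    have "\<rho> \<circ> (z \<odot>\<^bsub>?T\<^esub> y') = (\<rho> \<circ> act E D0 (act E h0 y')) \<oplus>\<^bsub>?T\<^esub> (\<rho> \<circ> act E h1 (act E D1 y'))"
      unfolding zy' by (rule linear_homD(2)[OF direct_sum_map[OF E E \<rho>] E.act_closed[OF D0 h0y'] E.act_closed[OF h1 D1y'T]])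
    also have "\<dots> = act E D0 (\<rho> \<circ> act E h0 y') \<oplus>\<^bsub>?T\<^esub> k"
      unfolding k_def using act_natural[OF E E \<rho> D0 h0y'] act_natural[OF E E \<rho> h1 D1y'T] by simp
    finally have \<rho>z: "\<rho> \<circ> (z \<odot>\<^bsub>?T\<^esub> y') = act E D0 (\<rho> \<circ> act E h0 y') \<oplus>\<^bsub>?T\<^esub> k" .
    have D0\<rho>T: "act E D0 (\<rho> \<circ> act E h0 y') \<in> carrier ?T" by (rule E.act_closed[OF D0 \<rho>h])
    have D0wT: "act E D0 w \<in> carrier ?T" by (rule E.act_closed[OF D0 w])
    have D0w: "act E D0 ?w = act E D0 w \<oplus>\<^bsub>?T\<^esub> act E D0 (\<rho> \<circ> act E h0 y')"
      by (rule linear_homD(2)[OF E.act_linear_hom[OF D0] w \<rho>h])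
    have "(y \<ominus>\<^bsub>?T\<^esub> (act E D0 ?w \<oplus>\<^bsub>?T\<^esub> ?y)) b \<in> \<Gamma>" for b
    proof -
      have c: "y b \<in> carrier E" "act E D0 w b \<in> carrier E" "y' b \<in> carrier E" "k b \<in> carrier E"
        "act E D0 (\<rho> \<circ> act E h0 y') b \<in> carrier E"
        using y(1) D0wT y' kT D0\<rho>T by (auto simp: direct_sum_carrier)
      have dT: "act E D0 w \<oplus>\<^bsub>?T\<^esub> y' \<in> carrier ?T" using T.M.a_closed[OF D0wT y'] .
      have dT': "act E D0 ?w \<oplus>\<^bsub>?T\<^esub> ?y \<in> carrier ?T" using T.M.a_closed[OF E.act_closed[OF D0 w'] yT] .
      have \<sigma>y: "\<sigma> (y' b) = y' b \<ominus>\<^bsub>E\<^esub> (act E D0 (\<rho> \<circ> act E h0 y') b \<oplus>\<^bsub>E\<^esub> k b)"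
        using fun_cong[OF \<rho>z, of b] by (simp add: \<sigma>_def)
      have alg: "(Y \<ominus>\<^bsub>E\<^esub> (W \<oplus>\<^bsub>E\<^esub> P \<oplus>\<^bsub>E\<^esub> (Z \<ominus>\<^bsub>E\<^esub> (P \<oplus>\<^bsub>E\<^esub> K)))) = (Y \<ominus>\<^bsub>E\<^esub> (W \<oplus>\<^bsub>E\<^esub> Z)) \<oplus>\<^bsub>E\<^esub> K"
        if "Y \<in> carrier E" "W \<in> carrier E" "P \<in> carrier E" "Z \<in> carrier E" "K \<in> carrier E" for Y W P Z K
      proof -
        have "W \<oplus>\<^bsub>E\<^esub> P \<oplus>\<^bsub>E\<^esub> (Z \<ominus>\<^bsub>E\<^esub> (P \<oplus>\<^bsub>E\<^esub> K)) = (P \<oplus>\<^bsub>E\<^esub> \<ominus>\<^bsub>E\<^esub> P) \<oplus>\<^bsub>E\<^esub> (W \<oplus>\<^bsub>E\<^esub> Z \<oplus>\<^bsub>E\<^esub> \<ominus>\<^bsub>E\<^esub> K)"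
          using that by (simp add: a_minus_def E.M.minus_add E.M.a_ac)
        also have "\<dots> = W \<oplus>\<^bsub>E\<^esub> Z \<oplus>\<^bsub>E\<^esub> \<ominus>\<^bsub>E\<^esub> K" using that by (simp add: E.M.r_neg)
        finally show ?thesis using that by (simp add: a_minus_def E.M.minus_add E.M.a_ac)
      qed
      have "(y \<ominus>\<^bsub>?T\<^esub> (act E D0 ?w \<oplus>\<^bsub>?T\<^esub> ?y)) b = (y \<ominus>\<^bsub>?T\<^esub> (act E D0 w \<oplus>\<^bsub>?T\<^esub> y')) b \<oplus>\<^bsub>E\<^esub> k b"
        unfolding fun_cong[OF direct_sum_minus[OF E y(1) dT]] fun_cong[OF direct_sum_minus[OF E y(1) dT']]
        unfolding D0w using alg[OF c(1,2,5,3,4)] \<sigma>y by simp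
      then show ?thesis using d[of b] k\<Gamma>[of b] \<Gamma>E(5) by simp
    qed
    moreover have "act E D1 ?y b \<in> \<Gamma>" for b unfolding D1\<sigma> using \<Gamma>(2)[OF \<sigma> D1y'] by simp
    moreover have "\<exists>t::nat. x' [^]\<^bsub>R\<^esub> t \<odot>\<^bsub>E\<^esub> ?y b = \<zero>\<^bsub>E\<^esub>" if "x' \<in> insert x X'" for x' b
    proof (cases "x' = x")
      case True
      have "y' b \<in> lin_span R E es"
        by (rule E.lin_span_mem[OF esE]) (use es in auto)
      then have "z [^]\<^bsub>R\<^esub> t \<odot>\<^bsub>E\<^esub> ?y b = \<zero>\<^bsub>E\<^esub>" using t by (simp add: \<sigma>_def)
      then have "x [^]\<^bsub>R\<^esub> (m * t) \<odot>\<^bsub>E\<^esub> ?y b = \<zero>\<^bsub>E\<^esub>" using xR by (simp add: z_def E.R.nat_pow_pow)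
      then show ?thesis using True by blast
    next
      case False
      then have x': "x' \<in> X'" using that by auto
      then have x'R: "x' \<in> carrier R" using insert.prems X(2) by auto
      obtain s :: nat where s: "x' [^]\<^bsub>R\<^esub> s \<odot>\<^bsub>E\<^esub> y' b = \<zero>\<^bsub>E\<^esub>" using tors[OF x'] by blast
      have "x' [^]\<^bsub>R\<^esub> s \<odot>\<^bsub>E\<^esub> ?y b = \<sigma> (x' [^]\<^bsub>R\<^esub> s \<odot>\<^bsub>E\<^esub> y' b)"
        using \<sigma>D(3)[of "x' [^]\<^bsub>R\<^esub> s" "y' b"] x'R E.direct_sum_support(3)[OF y'] by simp
      then have "x' [^]\<^bsub>R\<^esub> s \<odot>\<^bsub>E\<^esub> ?y b = \<zero>\<^bsub>E\<^esub>" using s linear_hom_zero[OF E E \<sigma>] by simp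
      then show ?thesis by blast
    qed
    ultimately show ?case using w' yT by blast
  qed
  from this[OF order_refl] obtain w y' where w: "w \<in> carrier (direct_sum B0 E)" and y': "y' \<in> carrier ?T"
    and d: "\<And>b. (y \<ominus>\<^bsub>?T\<^esub> (act E D0 w \<oplus>\<^bsub>?T\<^esub> y')) b \<in> \<Gamma>"
    and tors: "\<And>x b. x \<in> X \<Longrightarrow> \<exists>t::nat. x [^]\<^bsub>R\<^esub> t \<odot>\<^bsub>E\<^esub> y' b = \<zero>\<^bsub>E\<^esub>" by auto
  have "(y \<ominus>\<^bsub>?T\<^esub> act E D0 w) b \<in> \<Gamma>" for b
  proof -
    have D0wT: "act E D0 w \<in> carrier ?T" by (rule E.act_closed[OF D0 w])
    have c: "y b \<in> carrier E" "act E D0 w b \<in> carrier E" "y' b \<in> carrier E"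
      using y(1) D0wT y' by (auto simp: direct_sum_carrier)
    have "y' b \<in> \<Gamma>" using torsion[OF c(3)] tors by blast
    then have "(y \<ominus>\<^bsub>?T\<^esub> (act E D0 w \<oplus>\<^bsub>?T\<^esub> y')) b \<oplus>\<^bsub>E\<^esub> y' b \<in> \<Gamma>" using d \<Gamma>E(5) by blast
    moreover have "(y \<ominus>\<^bsub>?T\<^esub> (act E D0 w \<oplus>\<^bsub>?T\<^esub> y')) b \<oplus>\<^bsub>E\<^esub> y' b = (y \<ominus>\<^bsub>?T\<^esub> act E D0 w) b"
      unfolding direct_sum_minus[OF E y(1) T.M.a_closed[OF D0wT y']] direct_sum_minus[OF E y(1) D0wT]
      using c by (simp add: a_minus_def E.M.minus_add E.M.a_assoc E.M.l_neg)
    ultimately show ?thesis by simp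
  qed
  then show ?thesis using w by blast
qed

section \<open>Quotient modules and finite length\<close>

lemma quotient_module_simps [simp]:
  "carrier (quotient_module M N) = a_rcosets\<^bsub>M\<^esub> N" "\<zero>\<^bsub>quotient_module M N\<^esub> = N"
  "X \<oplus>\<^bsub>quotient_module M N\<^esub> Y = X <+>\<^bsub>M\<^esub> Y"
  "r \<odot>\<^bsub>quotient_module M N\<^esub> X = (\<Union>x\<in>X. N +>\<^bsub>M\<^esub> (r \<odot>\<^bsub>M\<^esub> x))"
  by (simp_all add: quotient_module_def)

lemma coset_mem_iff: "y \<in> N +>\<^bsub>M\<^esub> x \<longleftrightarrow> (\<exists>n\<in>N. y = n \<oplus>\<^bsub>M\<^esub> x)"
  by (auto simp: a_r_coset_def r_coset_def)

context module
begin

lemma submodule_imp_abelian_subgroup: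
  assumes "submodule N R M" shows "abelian_subgroup N M"
proof (rule abelian_subgroupI3)
  show "additive_subgroup N M"
    using submodule.axioms(1)[OF assms] by (simp add: additive_subgroup_def)
qed (rule M.abelian_group_axioms)

lemma coset_eq_iff:
  assumes N: "submodule N R M" and x: "x \<in> carrier M" and y: "y \<in> carrier M"
  shows "N +>\<^bsub>M\<^esub> x = N +>\<^bsub>M\<^esub> y \<longleftrightarrow> x \<ominus>\<^bsub>M\<^esub> y \<in> N"
proof
  interpret N: abelian_subgroup N M by (rule submodule_imp_abelian_subgroup[OF N])
  assume "N +>\<^bsub>M\<^esub> x = N +>\<^bsub>M\<^esub> y"
  then have "x \<in> N +>\<^bsub>M\<^esub> y" using N.a_rcos_self[OF x] by simp
  then obtain n where n: "n \<in> N" "x = n \<oplus>\<^bsub>M\<^esub> y" by (auto simp: coset_mem_iff)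
  then have "n = x \<ominus>\<^bsub>M\<^esub> y" using submoduleE(1)[OF N] y by (intro M.minus_eqI) auto
  then show "x \<ominus>\<^bsub>M\<^esub> y \<in> N" using n by simp
next
  assume n: "x \<ominus>\<^bsub>M\<^esub> y \<in> N"
  have "x \<in> N +>\<^bsub>M\<^esub> y" unfolding coset_mem_iff
    using n M.minus_add_cancel[OF x y] by (intro bexI[of _ "x \<ominus>\<^bsub>M\<^esub> y"]) auto
  then show "N +>\<^bsub>M\<^esub> x = N +>\<^bsub>M\<^esub> y"
    using M.a_repr_independence[OF _ y submodule.axioms(1)[OF N]] by simp
qed

lemma coset_carrier:
  "X \<in> a_rcosets\<^bsub>M\<^esub> N \<longleftrightarrow> (\<exists>x\<in>carrier M. X = N +>\<^bsub>M\<^esub> x)"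
  by (auto simp: A_RCOSETS_def RCOSETS_def a_r_coset_def)

lemma quotient_smult_coset:
  assumes N: "submodule N R M" and r: "r \<in> carrier R" and x: "x \<in> carrier M"
  shows "(\<Union>y\<in>N +>\<^bsub>M\<^esub> x. N +>\<^bsub>M\<^esub> (r \<odot>\<^bsub>M\<^esub> y)) = N +>\<^bsub>M\<^esub> (r \<odot>\<^bsub>M\<^esub> x)"
proof -
  interpret N: abelian_subgroup N M by (rule submodule_imp_abelian_subgroup[OF N])
  have *: "N +>\<^bsub>M\<^esub> (r \<odot>\<^bsub>M\<^esub> y) = N +>\<^bsub>M\<^esub> (r \<odot>\<^bsub>M\<^esub> x)" if y: "y \<in> N +>\<^bsub>M\<^esub> x" for y
  proof -
    obtain n where n: "n \<in> N" "y = n \<oplus>\<^bsub>M\<^esub> x" using y by (auto simp: coset_mem_iff)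
    then have nM: "n \<in> carrier M" using submoduleE(1)[OF N] by auto
    have "r \<odot>\<^bsub>M\<^esub> y = r \<odot>\<^bsub>M\<^esub> n \<oplus>\<^bsub>M\<^esub> r \<odot>\<^bsub>M\<^esub> x" using n nM r x by (simp add: smult_r_distr)
    then have "r \<odot>\<^bsub>M\<^esub> n = r \<odot>\<^bsub>M\<^esub> y \<ominus>\<^bsub>M\<^esub> r \<odot>\<^bsub>M\<^esub> x" using nM r x by (intro M.minus_eqI) auto
    then have "r \<odot>\<^bsub>M\<^esub> y \<ominus>\<^bsub>M\<^esub> r \<odot>\<^bsub>M\<^esub> x \<in> N" using submoduleE(4)[OF N r n(1)] by simp
    then show ?thesis using coset_eq_iff[OF N] n nM r x by simp
  qed
  show ?thesis using * N.a_rcos_self[OF x] by blast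
qed

lemma quotient_module_module:
  assumes N: "submodule N R M"
  shows "module R (quotient_module M N)"
proof -
  interpret N: abelian_subgroup N M by (rule submodule_imp_abelian_subgroup[OF N])
  note NM = submoduleE(1)[OF N]
  have sum: "(N +>\<^bsub>M\<^esub> x) <+>\<^bsub>M\<^esub> (N +>\<^bsub>M\<^esub> y) = N +>\<^bsub>M\<^esub> (x \<oplus>\<^bsub>M\<^esub> y)"
    if "x \<in> carrier M" "y \<in> carrier M" for x y using N.a_rcos_sum that by simp
  have N0: "N = N +>\<^bsub>M\<^esub> \<zero>\<^bsub>M\<^esub>" using M.a_coset_add_zero[OF NM] by simp
  note sm = quotient_smult_coset[OF N]
  show ?thesis
  proof (rule moduleI)
    show "abelian_group (quotient_module M N)"
    proof (rule abelian_groupI)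
      show "\<zero>\<^bsub>quotient_module M N\<^esub> \<in> carrier (quotient_module M N)"
        using N0 coset_carrier by auto
      fix X assume "X \<in> carrier (quotient_module M N)"
      then obtain x where x: "x \<in> carrier M" "X = N +>\<^bsub>M\<^esub> x" by (auto simp: coset_carrier)
      show "\<zero>\<^bsub>quotient_module M N\<^esub> \<oplus>\<^bsub>quotient_module M N\<^esub> X = X"
        using sum[of "\<zero>\<^bsub>M\<^esub>" x] x N0 by simp
      show "\<exists>Y\<in>carrier (quotient_module M N). Y \<oplus>\<^bsub>quotient_module M N\<^esub> X = \<zero>\<^bsub>quotient_module M N\<^esub>"
        using sum[of "\<ominus>\<^bsub>M\<^esub> x" x] x N0 coset_carrier
        by (intro bexI[of _ "N +>\<^bsub>M\<^esub> (\<ominus>\<^bsub>M\<^esub> x)"]) (auto simp: M.l_neg)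
    qed (auto simp: coset_carrier sum M.a_ac)
  next
    fix a X assume a: "a \<in> carrier R" and "X \<in> carrier (quotient_module M N)"
    then obtain x where "x \<in> carrier M" "X = N +>\<^bsub>M\<^esub> x" by (auto simp: coset_carrier)
    then show "a \<odot>\<^bsub>quotient_module M N\<^esub> X \<in> carrier (quotient_module M N)"
      using sm a by (simp add: coset_carrier) blast
  next
    fix a b X assume "a \<in> carrier R" "b \<in> carrier R" "X \<in> carrier (quotient_module M N)"
    then obtain x where "a \<in> carrier R" "b \<in> carrier R" "x \<in> carrier M" "X = N +>\<^bsub>M\<^esub> x"
      by (auto simp: coset_carrier)
    then show "(a \<oplus> b) \<odot>\<^bsub>quotient_module M N\<^esub> X =
        a \<odot>\<^bsub>quotient_module M N\<^esub> X \<oplus>\<^bsub>quotient_module M N\<^esub> b \<odot>\<^bsub>quotient_module M N\<^esub> X"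
      and "(a \<otimes> b) \<odot>\<^bsub>quotient_module M N\<^esub> X =
        a \<odot>\<^bsub>quotient_module M N\<^esub> (b \<odot>\<^bsub>quotient_module M N\<^esub> X)"
      using sm sum by (simp_all add: smult_l_distr smult_assoc1)
  next
    fix a X Y assume "a \<in> carrier R" "X \<in> carrier (quotient_module M N)" "Y \<in> carrier (quotient_module M N)"
    then obtain x y where "a \<in> carrier R" "x \<in> carrier M" "X = N +>\<^bsub>M\<^esub> x" "y \<in> carrier M" "Y = N +>\<^bsub>M\<^esub> y"
      by (auto simp: coset_carrier)
    then show "a \<odot>\<^bsub>quotient_module M N\<^esub> (X \<oplus>\<^bsub>quotient_module M N\<^esub> Y) =
        a \<odot>\<^bsub>quotient_module M N\<^esub> X \<oplus>\<^bsub>quotient_module M N\<^esub> a \<odot>\<^bsub>quotient_module M N\<^esub> Y"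
      using sm sum by (simp add: smult_r_distr)
  next
    fix X assume "X \<in> carrier (quotient_module M N)"
    then obtain x where "x \<in> carrier M" "X = N +>\<^bsub>M\<^esub> x" by (auto simp: coset_carrier)
    then show "\<one> \<odot>\<^bsub>quotient_module M N\<^esub> X = X" using sm by simp
  qed (rule R.is_cring)
qed

lemma quotient_image_submodule:
  assumes N: "submodule N R M" and L: "submodule L R M"
  shows "submodule ((\<lambda>x. N +>\<^bsub>M\<^esub> x) ` L) R (quotient_module M N)"
proof -
  interpret Q: module R "quotient_module M N" by (rule quotient_module_module[OF N])
  note L' = submoduleE[OF L] and NM = submoduleE(1)[OF N]
  have N0: "N = N +>\<^bsub>M\<^esub> \<zero>\<^bsub>M\<^esub>" using M.a_coset_add_zero[OF NM] by simp
  show ?thesis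
  proof (rule Q.submodule_of_closed)
    show "(\<lambda>x. N +>\<^bsub>M\<^esub> x) ` L \<subseteq> carrier (quotient_module M N)" using L'(1) coset_carrier by auto
    show "\<zero>\<^bsub>quotient_module M N\<^esub> \<in> (\<lambda>x. N +>\<^bsub>M\<^esub> x) ` L"
      using N0 submodule_zero[OF L] by auto
    fix X Y assume "X \<in> (\<lambda>x. N +>\<^bsub>M\<^esub> x) ` L" "Y \<in> (\<lambda>x. N +>\<^bsub>M\<^esub> x) ` L"
    then obtain x y where xy: "x \<in> L" "y \<in> L" "X = N +>\<^bsub>M\<^esub> x" "Y = N +>\<^bsub>M\<^esub> y" by auto
    then have "X <+>\<^bsub>M\<^esub> Y = N +>\<^bsub>M\<^esub> (x \<oplus>\<^bsub>M\<^esub> y)"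
      using abelian_subgroup.a_rcos_sum[OF submodule_imp_abelian_subgroup[OF N]] L'(1) by auto
    then show "X \<oplus>\<^bsub>quotient_module M N\<^esub> Y \<in> (\<lambda>x. N +>\<^bsub>M\<^esub> x) ` L"
      using xy L'(5) by auto
  next
    fix a X assume a: "a \<in> carrier R" and "X \<in> (\<lambda>x. N +>\<^bsub>M\<^esub> x) ` L"
    then obtain x where x: "x \<in> L" "X = N +>\<^bsub>M\<^esub> x" by auto
    then have "a \<odot>\<^bsub>quotient_module M N\<^esub> X = N +>\<^bsub>M\<^esub> (a \<odot>\<^bsub>M\<^esub> x)"
      using quotient_smult_coset[OF N a] L'(1) by auto
    then show "a \<odot>\<^bsub>quotient_module M N\<^esub> X \<in> (\<lambda>x. N +>\<^bsub>M\<^esub> x) ` L" using x L'(4) a by blast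
  qed
qed

text \<open>
  In each factor of a composition series a submodule has as image either zero or everything.  A chain of
  submodules indexed by the integers changes this pattern only finitely often, and a comparable pair of
  submodules with the same pattern is equal.
\<close>

lemma finite_length_chain_stationary:
  fixes L :: "int \<Rightarrow> 'c set"
  assumes fl: "finite_length R M" and L: "\<And>j. submodule (L j) R M"
    and anti: "\<And>i j. i \<le> j \<Longrightarrow> L j \<subseteq> L i"
  obtains k where "k \<ge> 0" "\<And>j. j \<ge> k \<Longrightarrow> L j = L k" "\<And>j. j \<ge> k \<Longrightarrow> L (- j) = L (- k)"
proof -
  obtain n N where fl': "N (0::nat) = {\<zero>\<^bsub>M\<^esub>} \<and> N n = carrier M \<and> (\<forall>i\<le>n. submodule (N i) R M) \<and>
        (\<forall>i<n. N i \<subset> N (Suc i) \<and> \<not> (\<exists>L. submodule L R M \<and> N i \<subset> L \<and> L \<subset> N (Suc i)))"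
    using fl unfolding finite_length_def by (elim exE)
  then have N0: "N (0::nat) = {\<zero>\<^bsub>M\<^esub>}" and Nn: "N n = carrier M"
    and N: "\<And>i. i \<le> n \<Longrightarrow> submodule (N i) R M" and step: "\<And>i. i < n \<Longrightarrow> N i \<subset> N (Suc i)"
    by simp_all
  have simple: "\<not> (N i \<subset> K \<and> K \<subset> N (Suc i))" if "i < n" "submodule K R M" for i K
  proof -
    have "\<not> (\<exists>L. submodule L R M \<and> N i \<subset> L \<and> L \<subset> N (Suc i))" using fl' that(1) by simp
    then show ?thesis using that(2) by metis
  qed
  define S where "S = (\<lambda>i j. {l \<oplus>\<^bsub>M\<^esub> y | l y. l \<in> L j \<inter> N (Suc i) \<and> y \<in> N i})"
  have S: "submodule (S i j) R M" if i: "i < n" for i j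
  proof (rule submodule_of_closed)
    have iN: "i \<le> n" "Suc i \<le> n" using i by auto
    note L' = submoduleE[OF L[of j]] and Ni = submoduleE[OF N[OF iN(1)]] and Ns = submoduleE[OF N[OF iN(2)]]
    show "S i j \<subseteq> carrier M" using L'(1) Ni(1) by (auto simp: S_def)
    show "\<zero>\<^bsub>M\<^esub> \<in> S i j"
      using submodule_zero[OF L] submodule_zero[OF N[OF iN(1)]] submodule_zero[OF N[OF iN(2)]]
      unfolding S_def by (intro CollectI exI[of _ "\<zero>\<^bsub>M\<^esub>"] conjI) auto
    fix a b assume "a \<in> S i j" "b \<in> S i j"
    then obtain l y l' y' where *: "a = l \<oplus>\<^bsub>M\<^esub> y" "b = l' \<oplus>\<^bsub>M\<^esub> y'" "l \<in> L j" "l \<in> N (Suc i)" "l' \<in> L j"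
      "l' \<in> N (Suc i)" "y \<in> N i" "y' \<in> N i" by (auto simp: S_def)
    then have "a \<oplus>\<^bsub>M\<^esub> b = (l \<oplus>\<^bsub>M\<^esub> l') \<oplus>\<^bsub>M\<^esub> (y \<oplus>\<^bsub>M\<^esub> y')"
      using L'(1) Ni(1) by (simp add: M.a_ac subset_iff)
    then show "a \<oplus>\<^bsub>M\<^esub> b \<in> S i j" unfolding S_def using * L'(5) Ni(5) Ns(5) by blast
  next
    have iN: "i \<le> n" "Suc i \<le> n" using i by auto
    note L' = submoduleE[OF L[of j]] and Ni = submoduleE[OF N[OF iN(1)]] and Ns = submoduleE[OF N[OF iN(2)]]
    fix r a assume r: "r \<in> carrier R" and "a \<in> S i j"
    then obtain l y where *: "a = l \<oplus>\<^bsub>M\<^esub> y" "l \<in> L j" "l \<in> N (Suc i)" "y \<in> N i" by (auto simp: S_def)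
    then have "r \<odot>\<^bsub>M\<^esub> a = r \<odot>\<^bsub>M\<^esub> l \<oplus>\<^bsub>M\<^esub> r \<odot>\<^bsub>M\<^esub> y"
      using L'(1) Ni(1) r by (simp add: smult_r_distr subset_iff)
    then show "r \<odot>\<^bsub>M\<^esub> a \<in> S i j" unfolding S_def using * L'(4) Ni(4) Ns(4) r by blast
  qed
  have S_low: "N i \<subseteq> S i j" if i: "i < n" for i j
  proof
    fix y assume y: "y \<in> N i"
    then have "y \<in> carrier M" using submoduleE(1)[OF N] i by (metis less_imp_le subsetD)
    then show "y \<in> S i j" unfolding S_def
      using y submodule_zero[OF L[of j]] submodule_zero[OF N[of "Suc i"]] i
      by (intro CollectI exI[of _ "\<zero>\<^bsub>M\<^esub>"] exI[of _ y] conjI) auto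
  qed
  have S_high: "S i j \<subseteq> N (Suc i)" if i: "i < n" for i j
    using submoduleE(5)[OF N[of "Suc i"]] step[OF i] i by (auto simp: S_def)
  have dich: "S i j = N i" if "i < n" "\<not> N (Suc i) \<subseteq> S i j" for i j
    using simple[OF that(1) S[OF that(1)]] S_low[OF that(1)] S_high[OF that(1)] that(2) by blast
  have Santi: "S i j' \<subseteq> S i j" if "j \<le> j'" for i j j' using anti[OF that] by (auto simp: S_def)
  have eq: "L j \<subseteq> L j'" if jj: "j \<le> j'" and c: "\<And>i. i < n \<Longrightarrow> N (Suc i) \<subseteq> S i j \<Longrightarrow> N (Suc i) \<subseteq> S i j'" for j j'
  proof -
    have "i \<le> n \<Longrightarrow> L j \<inter> N i \<subseteq> L j'" for i
    proof (induction i)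
      case 0 then show ?case using N0 submodule_zero[OF L[of j']] by auto
    next
      case (Suc i)
      then have i: "i < n" by simp
      note IH = Suc.IH[OF less_imp_le[OF i]]
      show ?case
      proof
        fix x assume x: "x \<in> L j \<inter> N (Suc i)"
        show "x \<in> L j'"
        proof (cases "N (Suc i) \<subseteq> S i j")
          case True
          then have "x \<in> S i j'" using c[OF i] x by auto
          then obtain l y where *: "x = l \<oplus>\<^bsub>M\<^esub> y" "l \<in> L j'" "y \<in> N i" by (auto simp: S_def)
          have lM: "l \<in> carrier M" "y \<in> carrier M"
            using * submoduleE(1)[OF L[of j']] submoduleE(1)[OF N[OF less_imp_le[OF i]]] by auto
          have "y = x \<ominus>\<^bsub>M\<^esub> l" using * lM by (intro M.minus_eqI) (auto simp: M.a_comm)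
          moreover have "x \<ominus>\<^bsub>M\<^esub> l \<in> L j" using submodule_diff[OF L] x *(2) anti[OF jj] by blast
          ultimately have "y \<in> L j" by simp
          then have "y \<in> L j'" using IH * by auto
          then show ?thesis using * submoduleE(5)[OF L] by auto
        next
          case False
          have "x \<in> carrier M" using x submoduleE(1)[OF L[of j]] by auto
          then have "x \<in> S i j" unfolding S_def
            using x submodule_zero[OF N[OF less_imp_le[OF i]]]
            by (intro CollectI exI[of _ x] exI[of _ "\<zero>\<^bsub>M\<^esub>"] conjI) auto
          then show ?thesis using dich[OF i False] IH x by auto
        qed
      qed
    qed
    from this[of n] show ?thesis using Nn submoduleE(1)[OF L[of j]] by auto
  qed
  have const: "\<exists>k\<ge>0. \<forall>j\<ge>k. (P j \<longleftrightarrow> P k) \<and> (P (- j) \<longleftrightarrow> P (- k))"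
    if P: "\<And>i j. i \<le> j \<Longrightarrow> P j \<Longrightarrow> P i" for P :: "int \<Rightarrow> bool"
  proof -
    consider "\<forall>j. P j" | "\<forall>j. \<not> P j" | a b where "P a" "\<not> P b" by auto
    then show ?thesis
    proof cases
      case (3 a b)
      show ?thesis
      proof (intro exI[of _ "max \<bar>a\<bar> \<bar>b\<bar>"] conjI allI impI)
        fix j assume j: "max \<bar>a\<bar> \<bar>b\<bar> \<le> j"
        have "b \<le> j" "b \<le> max \<bar>a\<bar> \<bar>b\<bar>" "- j \<le> a" "- max \<bar>a\<bar> \<bar>b\<bar> \<le> a" using j by auto
        note this[THEN P]
        then have "\<not> P j" "\<not> P (max \<bar>a\<bar> \<bar>b\<bar>)" "P (- j)" "P (- max \<bar>a\<bar> \<bar>b\<bar>)" using 3 by blast+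
        then show "P j \<longleftrightarrow> P (max \<bar>a\<bar> \<bar>b\<bar>)" "P (- j) \<longleftrightarrow> P (- max \<bar>a\<bar> \<bar>b\<bar>)" by simp_all
      qed auto
    qed auto
  qed
  have "\<exists>k\<ge>0. \<forall>j\<ge>k. (N (Suc i) \<subseteq> S i j \<longleftrightarrow> N (Suc i) \<subseteq> S i k) \<and> (N (Suc i) \<subseteq> S i (- j) \<longleftrightarrow> N (Suc i) \<subseteq> S i (- k))" for i
    by (rule const) (use Santi in blast)
  then obtain k where k: "\<And>i. k i \<ge> 0"
    "\<And>i j. j \<ge> k i \<Longrightarrow> (N (Suc i) \<subseteq> S i j \<longleftrightarrow> N (Suc i) \<subseteq> S i (k i)) \<and> (N (Suc i) \<subseteq> S i (- j) \<longleftrightarrow> N (Suc i) \<subseteq> S i (- k i))"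
    by metis
  define K where "K = (\<Sum>i<n. k i)"
  have K: "i < n \<Longrightarrow> k i \<le> K" for i
    unfolding K_def using k(1) by (intro member_le_sum) auto
  show ?thesis
  proof (rule that[of K])
    show "K \<ge> 0" unfolding K_def using k(1) by (simp add: sum_nonneg)
    fix j assume j: "j \<ge> K"
    have "N (Suc i) \<subseteq> S i K \<longleftrightarrow> N (Suc i) \<subseteq> S i j" "N (Suc i) \<subseteq> S i (- K) \<longleftrightarrow> N (Suc i) \<subseteq> S i (- j)"
      if "i < n" for i
      using k(2)[of i K] k(2)[of i j] K[OF that] j by auto
    then show "L j = L K" "L (- j) = L (- K)" 
      using eq[of K j] eq[of "- j" "- K"] anti[of K j] anti[of "- j" "- K"] j by (simp_all add: subset_antisym)
  qed
qed

end

section \<open>Graded modules\<close>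

definition degree_span :: "('a, 'b, 'm) module_scheme \<Rightarrow> (int \<Rightarrow> 'b set) \<Rightarrow> int set \<Rightarrow> 'b set" where
  "degree_span M Mg K = {x. \<exists>c. (\<forall>n. c n \<in> Mg n) \<and> finite {n. c n \<noteq> \<zero>\<^bsub>M\<^esub>} \<and>
     {n. c n \<noteq> \<zero>\<^bsub>M\<^esub>} \<subseteq> K \<and> x = (\<Oplus>\<^bsub>M\<^esub>n\<in>{n. c n \<noteq> \<zero>\<^bsub>M\<^esub>}. c n)}"

locale graded = module R M for R :: "('a, 'r) ring_scheme" and M :: "('a, 'b, 'm) module_scheme" +
  fixes Rg :: "nat \<Rightarrow> 'a set" and Mg :: "int \<Rightarrow> 'b set"
  assumes graded: "graded_module R Rg M Mg"
begin

abbreviation "ds \<equiv> degree_span M Mg"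

lemma Mg_subgroup: "subgroup (Mg n) (add_monoid M)"
  using graded by (simp add: graded_module_def)

lemma Mg_carrier: "x \<in> Mg n \<Longrightarrow> x \<in> carrier M"
  using subgroup.subset[OF Mg_subgroup] by auto

lemma Mg_zero: "\<zero>\<^bsub>M\<^esub> \<in> Mg n"
  using subgroup.one_closed[OF Mg_subgroup] by simp

lemma Mg_add: "x \<in> Mg n \<Longrightarrow> y \<in> Mg n \<Longrightarrow> x \<oplus>\<^bsub>M\<^esub> y \<in> Mg n"
  using subgroup.m_closed[OF Mg_subgroup] by simp

lemma Mg_neg: "x \<in> Mg n \<Longrightarrow> \<ominus>\<^bsub>M\<^esub> x \<in> Mg n"
  using subgroup.m_inv_closed[OF Mg_subgroup] by (simp add: a_inv_def)

lemma ds_zero: "\<zero>\<^bsub>M\<^esub> \<in> ds K"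
  unfolding degree_span_def using Mg_zero by (intro CollectI exI[of _ "\<lambda>_. \<zero>\<^bsub>M\<^esub>"]) auto

lemma ds_single:
  assumes "y \<in> Mg n" "n \<in> K" shows "y \<in> ds K"
proof (cases "y = \<zero>\<^bsub>M\<^esub>")
  case False
  define c where "c = (\<lambda>k. if k = n then y else \<zero>\<^bsub>M\<^esub>)"
  have supp: "{k. c k \<noteq> \<zero>\<^bsub>M\<^esub>} = {n}" using False by (auto simp: c_def)
  have "(\<Oplus>\<^bsub>M\<^esub>k\<in>{n}. c k) = y" using Mg_carrier[OF assms(1)] by (simp add: M.finsum_insert c_def)
  then show ?thesis unfolding degree_span_def
    using supp assms Mg_zero by (intro CollectI exI[of _ c]) (auto simp: c_def)
qed (use ds_zero in simp)

lemma ds_add: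
  assumes "x \<in> ds K" "y \<in> ds K" shows "x \<oplus>\<^bsub>M\<^esub> y \<in> ds K"
proof -
  obtain c where c: "\<And>n. c n \<in> Mg n" "finite {n. c n \<noteq> \<zero>\<^bsub>M\<^esub>}" "{n. c n \<noteq> \<zero>\<^bsub>M\<^esub>} \<subseteq> K"
    "x = (\<Oplus>\<^bsub>M\<^esub>n\<in>{n. c n \<noteq> \<zero>\<^bsub>M\<^esub>}. c n)" using assms(1) by (auto simp: degree_span_def)
  obtain d where d: "\<And>n. d n \<in> Mg n" "finite {n. d n \<noteq> \<zero>\<^bsub>M\<^esub>}" "{n. d n \<noteq> \<zero>\<^bsub>M\<^esub>} \<subseteq> K"
    "y = (\<Oplus>\<^bsub>M\<^esub>n\<in>{n. d n \<noteq> \<zero>\<^bsub>M\<^esub>}. d n)" using assms(2) by (auto simp: degree_span_def)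
  let ?U = "{n. c n \<noteq> \<zero>\<^bsub>M\<^esub>} \<union> {n. d n \<noteq> \<zero>\<^bsub>M\<^esub>}"
  let ?e = "\<lambda>n. c n \<oplus>\<^bsub>M\<^esub> d n"
  have cM: "c n \<in> carrier M" "d n \<in> carrier M" for n using c(1) d(1) Mg_carrier by blast+
  have U: "finite ?U" using c d by auto
  have sub: "{n. ?e n \<noteq> \<zero>\<^bsub>M\<^esub>} \<subseteq> ?U" by auto
  have ext: "(\<Oplus>\<^bsub>M\<^esub>n\<in>{n. f n \<noteq> \<zero>\<^bsub>M\<^esub>}. f n) = (\<Oplus>\<^bsub>M\<^esub>n\<in>?U. f n)"
    if "{n. f n \<noteq> \<zero>\<^bsub>M\<^esub>} \<subseteq> ?U" "\<And>n. f n \<in> carrier M" for f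
    by (rule M.add.finprod_mono_neutral_cong_left[OF U that(1)]) (use that(2) in auto)
  have "x \<oplus>\<^bsub>M\<^esub> y = (\<Oplus>\<^bsub>M\<^esub>n\<in>?U. c n) \<oplus>\<^bsub>M\<^esub> (\<Oplus>\<^bsub>M\<^esub>n\<in>?U. d n)"
    unfolding c(4) d(4) using ext[of c] ext[of d] cM by auto
  also have "\<dots> = (\<Oplus>\<^bsub>M\<^esub>n\<in>?U. ?e n)" using cM by (intro M.finsum_addf[symmetric]) auto
  also have "\<dots> = (\<Oplus>\<^bsub>M\<^esub>n\<in>{n. ?e n \<noteq> \<zero>\<^bsub>M\<^esub>}. ?e n)" using ext[OF sub] cM by simp
  finally have "x \<oplus>\<^bsub>M\<^esub> y = (\<Oplus>\<^bsub>M\<^esub>n\<in>{n. ?e n \<noteq> \<zero>\<^bsub>M\<^esub>}. ?e n)" .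
  moreover have "finite {n. ?e n \<noteq> \<zero>\<^bsub>M\<^esub>}" using finite_subset[OF sub U] .
  moreover have "{n. ?e n \<noteq> \<zero>\<^bsub>M\<^esub>} \<subseteq> K" using sub c(3) d(3) by blast
  moreover have "\<forall>n. ?e n \<in> Mg n" using c(1) d(1) Mg_add by simp
  ultimately show ?thesis unfolding degree_span_def by (intro CollectI exI[of _ ?e] conjI)
qed

lemma ds_induct:
  assumes x: "x \<in> ds K" and 0: "P \<zero>\<^bsub>M\<^esub>" and single: "\<And>n y. n \<in> K \<Longrightarrow> y \<in> Mg n \<Longrightarrow> P y"
    and add: "\<And>x y. x \<in> carrier M \<Longrightarrow> y \<in> carrier M \<Longrightarrow> P x \<Longrightarrow> P y \<Longrightarrow> P (x \<oplus>\<^bsub>M\<^esub> y)"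
  shows "P x"
proof -
  obtain c where c: "\<And>n. c n \<in> Mg n" "finite {n. c n \<noteq> \<zero>\<^bsub>M\<^esub>}" "{n. c n \<noteq> \<zero>\<^bsub>M\<^esub>} \<subseteq> K"
    "x = (\<Oplus>\<^bsub>M\<^esub>n\<in>{n. c n \<noteq> \<zero>\<^bsub>M\<^esub>}. c n)" using x by (auto simp: degree_span_def)
  have cM: "c n \<in> carrier M" for n using c(1) Mg_carrier by blast
  have "P (\<Oplus>\<^bsub>M\<^esub>n\<in>U. c n)" if "finite U" "U \<subseteq> K" for U
    using that
  proof (induction U rule: finite_induct)
    case (insert n U)
    have "(\<Oplus>\<^bsub>M\<^esub>n\<in>U. c n) \<in> carrier M" using cM by (intro M.finsum_closed) auto
    then show ?case using insert add[OF cM _ single[OF _ c(1)]] cM by (simp add: M.finsum_insert)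
  qed (simp add: 0)
  then show ?thesis using c by simp
qed

lemma ds_mono: "K \<subseteq> K' \<Longrightarrow> ds K \<subseteq> ds K'"
  by (auto simp: degree_span_def)

lemma ds_carrier: "ds K \<subseteq> carrier M"
proof
  fix x assume "x \<in> ds K"
  then show "x \<in> carrier M" by (rule ds_induct) (auto intro: Mg_carrier)
qed

lemma ds_neg: "x \<in> ds K \<Longrightarrow> \<ominus>\<^bsub>M\<^esub> x \<in> ds K"
proof (erule ds_induct)
  show "\<ominus>\<^bsub>M\<^esub> \<zero>\<^bsub>M\<^esub> \<in> ds K" using ds_zero M.add.inv_one by (simp add: a_inv_def)
  show "\<And>n y. n \<in> K \<Longrightarrow> y \<in> Mg n \<Longrightarrow> \<ominus>\<^bsub>M\<^esub> y \<in> ds K" using ds_single Mg_neg by blast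
  show "\<And>x y. x \<in> carrier M \<Longrightarrow> y \<in> carrier M \<Longrightarrow> \<ominus>\<^bsub>M\<^esub> x \<in> ds K \<Longrightarrow> \<ominus>\<^bsub>M\<^esub> y \<in> ds K \<Longrightarrow> \<ominus>\<^bsub>M\<^esub> (x \<oplus>\<^bsub>M\<^esub> y) \<in> ds K"
    using ds_add by (simp add: M.minus_add)
qed

lemma ds_diff: "x \<in> ds K \<Longrightarrow> y \<in> ds K \<Longrightarrow> x \<ominus>\<^bsub>M\<^esub> y \<in> ds K"
  using ds_add ds_neg by (simp add: a_minus_def)

lemma carrier_finite_ds:
  assumes "x \<in> carrier M" obtains K where "finite K" "x \<in> ds K"
proof -
  have "\<exists>c. (\<forall>n. c n \<in> Mg n) \<and> finite {n. c n \<noteq> \<zero>\<^bsub>M\<^esub>} \<and> x = (\<Oplus>\<^bsub>M\<^esub>n\<in>{n. c n \<noteq> \<zero>\<^bsub>M\<^esub>}. c n)"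
    using graded assms unfolding graded_module_def by blast
  then obtain c where "\<forall>n. c n \<in> Mg n" "finite {n. c n \<noteq> \<zero>\<^bsub>M\<^esub>}" "x = (\<Oplus>\<^bsub>M\<^esub>n\<in>{n. c n \<noteq> \<zero>\<^bsub>M\<^esub>}. c n)" by blast
  then show ?thesis using that[of "{n. c n \<noteq> \<zero>\<^bsub>M\<^esub>}"] unfolding degree_span_def by blast
qed

lemma ds_disjoint:
  assumes "x \<in> ds K" "x \<in> ds K'" "K \<inter> K' = {}" shows "x = \<zero>\<^bsub>M\<^esub>"
proof -
  let ?P = "\<lambda>c. (\<forall>n. c n \<in> Mg n) \<and> finite {n. c n \<noteq> \<zero>\<^bsub>M\<^esub>} \<and> x = (\<Oplus>\<^bsub>M\<^esub>n\<in>{n. c n \<noteq> \<zero>\<^bsub>M\<^esub>}. c n)"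
  obtain c where c: "?P c" "{n. c n \<noteq> \<zero>\<^bsub>M\<^esub>} \<subseteq> K" using assms(1) unfolding degree_span_def by blast
  obtain d where d: "?P d" "{n. d n \<noteq> \<zero>\<^bsub>M\<^esub>} \<subseteq> K'" using assms(2) unfolding degree_span_def by blast
  have "x \<in> carrier M" using assms(1) ds_carrier by auto
  then have "\<exists>!c. ?P c" using graded unfolding graded_module_def by blast
  then have "c = d" using c(1) d(1) by blast
  then have "{n. c n \<noteq> \<zero>\<^bsub>M\<^esub>} = {}" using c(2) d(2) assms(3) by blast
  then show ?thesis using c(1) by simp
qed

lemma ds_split:
  assumes "x \<in> carrier M" obtains u v where "u \<in> ds K" "v \<in> ds (- K)" "x = u \<oplus>\<^bsub>M\<^esub> v"
proof -
  obtain L where "x \<in> ds L" using carrier_finite_ds[OF assms] by blast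
  then have "\<exists>u\<in>ds K. \<exists>v\<in>ds (- K). x = u \<oplus>\<^bsub>M\<^esub> v"
  proof (rule ds_induct)
    show "\<exists>u\<in>ds K. \<exists>v\<in>ds (- K). \<zero>\<^bsub>M\<^esub> = u \<oplus>\<^bsub>M\<^esub> v" using ds_zero by (metis M.zero_closed M.r_zero)
  next
    fix n y assume y: "y \<in> Mg n"
    show "\<exists>u\<in>ds K. \<exists>v\<in>ds (- K). y = u \<oplus>\<^bsub>M\<^esub> v"
    proof (cases "n \<in> K")
      case True
      then show ?thesis using ds_single[OF y] ds_zero Mg_carrier[OF y] by (metis M.r_zero)
    next
      case False
      then show ?thesis using ds_single[OF y, of "- K"] ds_zero Mg_carrier[OF y] by (metis ComplI M.l_zero)
    qed
  next
    fix x y assume "\<exists>u\<in>ds K. \<exists>v\<in>ds (- K). x = u \<oplus>\<^bsub>M\<^esub> v" "\<exists>u\<in>ds K. \<exists>v\<in>ds (- K). y = u \<oplus>\<^bsub>M\<^esub> v"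
    then obtain u v u' v' where *: "u \<in> ds K" "v \<in> ds (- K)" "x = u \<oplus>\<^bsub>M\<^esub> v" "u' \<in> ds K" "v' \<in> ds (- K)" "y = u' \<oplus>\<^bsub>M\<^esub> v'" by blast
    then have "x \<oplus>\<^bsub>M\<^esub> y = (u \<oplus>\<^bsub>M\<^esub> u') \<oplus>\<^bsub>M\<^esub> (v \<oplus>\<^bsub>M\<^esub> v')"
      using ds_carrier by (simp add: M.a_ac subset_iff)
    then show "\<exists>u\<in>ds K. \<exists>v\<in>ds (- K). x \<oplus>\<^bsub>M\<^esub> y = u \<oplus>\<^bsub>M\<^esub> v" using * ds_add by blast
  qed
  then show ?thesis using that by blast
qed

lemma ds_smult_homogeneous:
  assumes r: "r \<in> Rg m" "r \<in> carrier R" and x: "x \<in> ds K" and K: "\<And>n. n \<in> K \<Longrightarrow> int m + n \<in> K'"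
  shows "r \<odot>\<^bsub>M\<^esub> x \<in> ds K'"
  using x
proof (rule ds_induct)
  show "r \<odot>\<^bsub>M\<^esub> \<zero>\<^bsub>M\<^esub> \<in> ds K'" using ds_zero r by simp
  fix n y assume "n \<in> K" "y \<in> Mg n"
  then show "r \<odot>\<^bsub>M\<^esub> y \<in> ds K'" using graded r(1) K unfolding graded_module_def by (blast intro: ds_single)
qed (use ds_add r in \<open>auto simp: smult_r_distr\<close>)

text \<open>
  The first premise is induction over the homogeneous components of \<open>r\<close>, which have nonnegative degree and
  therefore do not lower the degree of \<open>x\<close>.
\<close>

lemma ds_smult:
  assumes gen: "\<And>P. P \<zero>\<^bsub>R\<^esub> \<Longrightarrow> (\<And>m s. s \<in> Rg m \<Longrightarrow> s \<in> carrier R \<Longrightarrow> P s) \<Longrightarrow>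
      (\<And>s t. s \<in> carrier R \<Longrightarrow> t \<in> carrier R \<Longrightarrow> P s \<Longrightarrow> P t \<Longrightarrow> P (s \<oplus>\<^bsub>R\<^esub> t)) \<Longrightarrow> P r"
    and x: "x \<in> ds {n..}"
  shows "r \<odot>\<^bsub>M\<^esub> x \<in> ds {n..}"
proof (rule gen)
  have xM: "x \<in> carrier M" using x ds_carrier by auto
  show "\<zero>\<^bsub>R\<^esub> \<odot>\<^bsub>M\<^esub> x \<in> ds {n..}" using xM ds_zero by simp
  show "s \<odot>\<^bsub>M\<^esub> x \<in> ds {n..}" if "s \<in> Rg m" "s \<in> carrier R" for m s
    using ds_smult_homogeneous[OF that x] by simp
  show "(s \<oplus>\<^bsub>R\<^esub> t) \<odot>\<^bsub>M\<^esub> x \<in> ds {n..}"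
    if "s \<in> carrier R" "t \<in> carrier R" "s \<odot>\<^bsub>M\<^esub> x \<in> ds {n..}" "t \<odot>\<^bsub>M\<^esub> x \<in> ds {n..}" for s t
    using that xM ds_add by (simp add: smult_l_distr)
qed

text \<open>
  For large \<open>k\<close> the classes of degree at least \<open>k\<close> in \<open>Z / B\<close> no longer depend on \<open>k\<close>; as an element has finitely
  many components, such a class lies in degrees beyond those of its representative and is zero.
  Likewise all classes come from degrees at least \<open>- k\<close>.  An element that raises degrees therefore acts
  nilpotently.  The premise on splitting says that \<open>B\<close> is a graded submodule.
\<close>

lemma finite_length_imp_nilpotent:
  assumes Z: "submodule Z R M" and B: "submodule B R M" "B \<subseteq> Z"
    and B_split: "\<And>n b. b \<in> B \<Longrightarrow> \<exists>u v. u \<in> B \<and> u \<in> ds {..<n} \<and> v \<in> ds {n..} \<and> b = u \<oplus>\<^bsub>M\<^esub> v"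
    and fl: "finite_length R (quotient_module (M\<lparr>carrier := Z\<rparr>) B)"
    and ideal: "\<And>r n x. r \<in> carrier R \<Longrightarrow> x \<in> ds {n..} \<Longrightarrow> r \<odot>\<^bsub>M\<^esub> x \<in> ds {n..}"
    and x: "x \<in> carrier R" and raises: "\<And>n y. y \<in> ds {n..} \<Longrightarrow> x \<odot>\<^bsub>M\<^esub> y \<in> ds {n + 1..}"
  shows "\<exists>N::nat. \<forall>z\<in>Z. x [^]\<^bsub>R\<^esub> N \<odot>\<^bsub>M\<^esub> z \<in> B"
proof -
  define MZ where "MZ = M\<lparr>carrier := Z\<rparr>"
  interpret MZ: module R MZ unfolding MZ_def by (rule submodule.submodule_is_module[OF Z module_axioms])
  have mz [simp]: "carrier MZ = Z" "\<zero>\<^bsub>MZ\<^esub> = \<zero>\<^bsub>M\<^esub>" "a \<oplus>\<^bsub>MZ\<^esub> b = a \<oplus>\<^bsub>M\<^esub> b" "r \<odot>\<^bsub>MZ\<^esub> a = r \<odot>\<^bsub>M\<^esub> a" for a b r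
    by (simp_all add: MZ_def)
  note Z' = submoduleE[OF Z] and B' = submoduleE[OF B(1)]
  have BZ: "submodule B R MZ"
    using B(2) B' submodule_zero[OF B(1)] by (intro MZ.submodule_of_closed) auto
  have dsub: "submodule (Z \<inter> ds {n..}) R MZ" for n
    using Z' submodule_zero[OF Z] ds_zero ds_add ideal by (intro MZ.submodule_of_closed) auto
  define cl where "cl = (\<lambda>z. B +>\<^bsub>MZ\<^esub> z)"
  define L where "L = (\<lambda>n. cl ` (Z \<inter> ds {n..}))"
  interpret Q: module R "quotient_module MZ B" by (rule MZ.quotient_module_module[OF BZ])
  have L: "submodule (L n) R (quotient_module MZ B)" for n
    unfolding L_def cl_def by (rule MZ.quotient_image_submodule[OF BZ dsub])
  have L_anti: "L j \<subseteq> L i" if "i \<le> j" for i j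
    using ds_mono[of "{j..}" "{i..}"] that by (auto simp: L_def)
  obtain k where k: "k \<ge> 0" "\<And>j. j \<ge> k \<Longrightarrow> L j = L k" "\<And>j. j \<ge> k \<Longrightarrow> L (- j) = L (- k)"
    using Q.finite_length_chain_stationary[of L, OF fl[folded MZ_def] L L_anti] by blast
  have represent: "\<exists>z'\<in>Z \<inter> ds {n..}. \<exists>b\<in>B. z = z' \<oplus>\<^bsub>M\<^esub> b" if z: "z \<in> Z" "cl z \<in> L n" for z n
  proof -
    obtain z' where z': "z' \<in> Z" "z' \<in> ds {n..}" "cl z = cl z'" using z(2) by (auto simp: L_def)
    have "z \<ominus>\<^bsub>MZ\<^esub> z' \<in> B" using MZ.coset_eq_iff[OF BZ, of z z'] z z' by (simp add: cl_def)
    moreover have "z = z' \<oplus>\<^bsub>M\<^esub> (z \<ominus>\<^bsub>MZ\<^esub> z')"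
    proof -
      have "z \<ominus>\<^bsub>MZ\<^esub> z' \<in> carrier MZ" using z z' by (intro MZ.M.minus_closed) auto
      then have "z \<ominus>\<^bsub>MZ\<^esub> z' \<in> carrier M" using Z'(1) by auto
      moreover have "z' \<in> carrier M" using z' Z'(1) by auto
      ultimately show ?thesis using MZ.M.minus_add_cancel[of z z'] z z' by (simp add: M.a_comm)
    qed
    ultimately show ?thesis using z' by blast
  qed
  have high: "y \<in> B" if y: "y \<in> Z" "y \<in> ds {k..}" for y
  proof -
    have yM: "y \<in> carrier M" using y Z'(1) by auto
    obtain K where K: "finite K" "y \<in> ds K" using carrier_finite_ds[OF yM] by blast
    define n where "n = max k (Max (insert 0 K) + 1)"
    have "K \<subseteq> {..<n}"
    proof
      fix j assume "j \<in> K"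
      then have "j \<le> Max (insert 0 K)" using K(1) by (intro Max_ge) auto
      then show "j \<in> {..<n}" by (simp add: n_def)
    qed
    then have low: "y \<in> ds {..<n}" using ds_mono K(2) by blast
    have "cl y \<in> L n" using k(2)[of n] y by (auto simp: L_def n_def)
    then obtain y' b where y': "y' \<in> Z" "y' \<in> ds {n..}" "b \<in> B" "y = y' \<oplus>\<^bsub>M\<^esub> b"
      using represent[OF y(1)] by blast
    obtain u v where uv: "u \<in> B" "u \<in> ds {..<n}" "v \<in> ds {n..}" "b = u \<oplus>\<^bsub>M\<^esub> v"
      using B_split[OF y'(3)] by blast
    have c: "u \<in> carrier M" "v \<in> carrier M" "y' \<in> carrier M" using uv y' ds_carrier by auto
    have "y = (y' \<oplus>\<^bsub>M\<^esub> v) \<oplus>\<^bsub>M\<^esub> u" using y' uv c by (simp add: M.a_ac)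
    then have "y' \<oplus>\<^bsub>M\<^esub> v = y \<ominus>\<^bsub>M\<^esub> u" using c by (intro M.minus_eqI) auto
    then have "y \<ominus>\<^bsub>M\<^esub> u \<in> ds {n..}" using ds_add[OF y'(2) uv(3)] by simp
    moreover have "y \<ominus>\<^bsub>M\<^esub> u \<in> ds {..<n}" using ds_diff[OF low uv(2)] .
    ultimately have "y \<ominus>\<^bsub>M\<^esub> u = \<zero>\<^bsub>M\<^esub>" by (rule ds_disjoint) auto
    then have "y = u" using M.minus_eq_zero_iff[OF yM c(1)] by simp
    then show ?thesis using uv by simp
  qed
  define N where "N = nat (2 * k)"
  have pow: "x [^]\<^bsub>R\<^esub> j \<odot>\<^bsub>M\<^esub> y \<in> ds {n + int j..}" if y: "y \<in> ds {n..}" for j n y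
  proof (induction j)
    case 0
    have "y \<in> carrier M" using y ds_carrier by blast
    then show ?case using y by simp
  next
    case (Suc j)
    have "x [^]\<^bsub>R\<^esub> Suc j \<odot>\<^bsub>M\<^esub> y = x \<odot>\<^bsub>M\<^esub> (x [^]\<^bsub>R\<^esub> j \<odot>\<^bsub>M\<^esub> y)"
      using x y ds_carrier[of "{n..}"] by (simp add: smult_assoc1[symmetric] R.m_comm subset_iff)
    then show ?case using raises[OF Suc.IH] by (simp add: algebra_simps)
  qed
  have "x [^]\<^bsub>R\<^esub> N \<odot>\<^bsub>M\<^esub> z \<in> B" if z: "z \<in> Z" for z
  proof -
    have zM: "z \<in> carrier M" using z Z'(1) by auto
    obtain K where K: "finite K" "z \<in> ds K" using carrier_finite_ds[OF zM] by blast
    define j where "j = max k (- Min (insert 0 K))"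
    have "K \<subseteq> {- j..}"
    proof
      fix i assume "i \<in> K"
      then have "Min (insert 0 K) \<le> i" using K(1) by (intro Min_le) auto
      then show "i \<in> {- j..}" by (simp add: j_def)
    qed
    then have "z \<in> ds {- j..}" using ds_mono K(2) by blast
    then have "cl z \<in> L (- k)" using k(3)[of j] z by (auto simp: L_def j_def)
    then obtain z' b where z': "z' \<in> Z" "z' \<in> ds {- k..}" "b \<in> B" "z = z' \<oplus>\<^bsub>M\<^esub> b" using represent[OF z] by blast
    have xN: "x [^]\<^bsub>R\<^esub> N \<in> carrier R" using x by simp
    have "x [^]\<^bsub>R\<^esub> N \<odot>\<^bsub>M\<^esub> z' \<in> ds {k..}" using pow[OF z'(2), of N] k(1) by (simp add: N_def)
    then have "x [^]\<^bsub>R\<^esub> N \<odot>\<^bsub>M\<^esub> z' \<in> B" using high Z'(4)[OF xN z'(1)] by simp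
    moreover have "x [^]\<^bsub>R\<^esub> N \<odot>\<^bsub>M\<^esub> b \<in> B" using B'(4)[OF xN z'(3)] .
    moreover have "x [^]\<^bsub>R\<^esub> N \<odot>\<^bsub>M\<^esub> z = x [^]\<^bsub>R\<^esub> N \<odot>\<^bsub>M\<^esub> z' \<oplus>\<^bsub>M\<^esub> x [^]\<^bsub>R\<^esub> N \<odot>\<^bsub>M\<^esub> b"
      using z' B'(1) Z'(1) xN by (auto intro: smult_r_distr)
    ultimately show ?thesis using B'(5) by simp
  qed
  then show ?thesis by blast
qed

end

section \<open>Powers of ideals and torsion\<close>

lemma (in cring) ideal_pow_ideal:
  assumes "ideal I R" shows "ideal (I [^]\<^bsub>ideals_set R\<^esub> (n::nat)) R"
proof -
  interpret S: comm_monoid "ideals_set R" by (rule ideals_set_is_comm_monoid)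
  have "I \<in> carrier (ideals_set R)" using assms by (simp add: ideals_set_def)
  then have "I [^]\<^bsub>ideals_set R\<^esub> n \<in> carrier (ideals_set R)" by (rule S.nat_pow_closed)
  then show ?thesis by (simp add: ideals_set_def)
qed

lemma (in cring) ideal_pow_Suc:
  "I [^]\<^bsub>ideals_set R\<^esub> Suc n = (I [^]\<^bsub>ideals_set R\<^esub> n) \<cdot> I"
  by (simp add: ideals_set_def nat_pow_def)

lemma (in cring) ideal_pow_antimono:
  assumes I: "ideal I R" and "m \<le> n"
  shows "I [^]\<^bsub>ideals_set R\<^esub> (n::nat) \<subseteq> I [^]\<^bsub>ideals_set R\<^esub> m"
  using assms(2)
proof (induction n rule: dec_induct)
  case (step n)
  have "I [^]\<^bsub>ideals_set R\<^esub> Suc n \<subseteq> I [^]\<^bsub>ideals_set R\<^esub> n"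
    unfolding ideal_pow_Suc using ideal_prod_inter[OF ideal_pow_ideal[OF I] I] by blast
  then show ?case using step.IH by blast
qed simp

lemma (in module) torsion_submodule_submodule:
  assumes I: "ideal I R" shows "submodule (torsion_submodule R I M) R M"
proof (rule submodule_of_closed)
  have icarr: "a \<in> I [^]\<^bsub>ideals_set R\<^esub> (n::nat) \<Longrightarrow> a \<in> carrier R" for a n
    using ideal.Icarr[OF R.ideal_pow_ideal[OF I]] .
  show "torsion_submodule R I M \<subseteq> carrier M" by (auto simp: torsion_submodule_def)
  show "\<zero>\<^bsub>M\<^esub> \<in> torsion_submodule R I M" using icarr by (auto simp: torsion_submodule_def)
  fix x y assume "x \<in> torsion_submodule R I M" "y \<in> torsion_submodule R I M"
  then obtain m n :: nat where xM: "x \<in> carrier M" "y \<in> carrier M"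
    and mn: "\<And>a. a \<in> I [^]\<^bsub>ideals_set R\<^esub> m \<Longrightarrow> a \<odot>\<^bsub>M\<^esub> x = \<zero>\<^bsub>M\<^esub>"
      "\<And>a. a \<in> I [^]\<^bsub>ideals_set R\<^esub> n \<Longrightarrow> a \<odot>\<^bsub>M\<^esub> y = \<zero>\<^bsub>M\<^esub>"
    by (auto simp: torsion_submodule_def)
  have "a \<odot>\<^bsub>M\<^esub> (x \<oplus>\<^bsub>M\<^esub> y) = \<zero>\<^bsub>M\<^esub>" if a: "a \<in> I [^]\<^bsub>ideals_set R\<^esub> (max m n)" for a
  proof -
    have "a \<odot>\<^bsub>M\<^esub> x = \<zero>\<^bsub>M\<^esub>" "a \<odot>\<^bsub>M\<^esub> y = \<zero>\<^bsub>M\<^esub>"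
      using mn a R.ideal_pow_antimono[OF I, of m "max m n"] R.ideal_pow_antimono[OF I, of n "max m n"]
      by auto
    then show ?thesis using xM icarr[OF a] by (simp add: smult_r_distr)
  qed
  then show "x \<oplus>\<^bsub>M\<^esub> y \<in> torsion_submodule R I M" using xM by (auto simp: torsion_submodule_def)
next
  have icarr: "a \<in> I [^]\<^bsub>ideals_set R\<^esub> (n::nat) \<Longrightarrow> a \<in> carrier R" for a n
    using ideal.Icarr[OF R.ideal_pow_ideal[OF I]] .
  fix r x assume r: "r \<in> carrier R" and "x \<in> torsion_submodule R I M"
  then obtain n :: nat where x: "x \<in> carrier M" "\<And>a. a \<in> I [^]\<^bsub>ideals_set R\<^esub> n \<Longrightarrow> a \<odot>\<^bsub>M\<^esub> x = \<zero>\<^bsub>M\<^esub>"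
    by (auto simp: torsion_submodule_def)
  have "a \<odot>\<^bsub>M\<^esub> (r \<odot>\<^bsub>M\<^esub> x) = \<zero>\<^bsub>M\<^esub>" if a: "a \<in> I [^]\<^bsub>ideals_set R\<^esub> n" for a
    using x(2)[OF a] smult_assoc1[OF icarr[OF a] r x(1)] smult_assoc1[OF r icarr[OF a] x(1)]
      R.m_comm[OF r icarr[OF a]] r by simp
  then show "r \<odot>\<^bsub>M\<^esub> x \<in> torsion_submodule R I M" using x r by (auto simp: torsion_submodule_def)
qed

lemma torsion_submodule_map:
  assumes "module R M" "module R N" "f \<in> linear_hom R M N" "ideal I R" "x \<in> torsion_submodule R I M"
  shows "f x \<in> torsion_submodule R I N"
proof -
  interpret M: module R M by fact
  obtain n :: nat where x: "x \<in> carrier M" "\<And>a. a \<in> I [^]\<^bsub>ideals_set R\<^esub> n \<Longrightarrow> a \<odot>\<^bsub>M\<^esub> x = \<zero>\<^bsub>M\<^esub>"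
    using assms(5) by (auto simp: torsion_submodule_def)
  have "a \<odot>\<^bsub>N\<^esub> f x = \<zero>\<^bsub>N\<^esub>" if a: "a \<in> I [^]\<^bsub>ideals_set R\<^esub> n" for a
    using x(2)[OF a] linear_homD(3)[OF assms(3) ideal.Icarr[OF M.R.ideal_pow_ideal[OF assms(4)] a] x(1)]
      linear_hom_zero[OF assms(1-3)] by simp
  then show ?thesis using x linear_homD(1)[OF assms(3)] by (auto simp: torsion_submodule_def)
qed

text \<open>
  Induction on the sum of the exponents: multiplication by a generator \<open>x\<close> lowers the exponent needed for \<open>x\<close>.
  Without generators the sum is \<open>0\<close> and the ideal is zero, while \<open>e\<close> need not vanish; this is why the exponent
  of the ideal exceeds the sum by one.
\<close>

lemma (in module) torsion_of_generators:
  assumes X: "finite X" "X \<subseteq> carrier R" and e: "e \<in> carrier M"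
    and t: "\<And>x. x \<in> X \<Longrightarrow> \<exists>t::nat. x [^]\<^bsub>R\<^esub> t \<odot>\<^bsub>M\<^esub> e = \<zero>\<^bsub>M\<^esub>"
  shows "e \<in> torsion_submodule R (genideal R X) M"
proof -
  let ?I = "genideal R X"
  have I: "ideal ?I R" by (rule R.genideal_ideal[OF X(2)])
  have icarr: "a \<in> ?I [^]\<^bsub>ideals_set R\<^esub> (n::nat) \<Longrightarrow> a \<in> carrier R" for a n
    using ideal.Icarr[OF R.ideal_pow_ideal[OF I]] .
  have main: "\<forall>a\<in>?I [^]\<^bsub>ideals_set R\<^esub> Suc s. a \<odot>\<^bsub>M\<^esub> e = \<zero>\<^bsub>M\<^esub>"
    if "e \<in> carrier M" "\<And>x. x \<in> X \<Longrightarrow> x [^]\<^bsub>R\<^esub> (t x) \<odot>\<^bsub>M\<^esub> e = \<zero>\<^bsub>M\<^esub>" "(\<Sum>x\<in>X. t x) = s" for s and t :: "'a \<Rightarrow> nat" and e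
    using that
  proof (induction s arbitrary: t e rule: less_induct)
    fix s t e
    assume IH: "\<And>s' t e. s' < s \<Longrightarrow> e \<in> carrier M \<Longrightarrow> (\<And>x. x \<in> X \<Longrightarrow> x [^]\<^bsub>R\<^esub> (t x :: nat) \<odot>\<^bsub>M\<^esub> e = \<zero>\<^bsub>M\<^esub>) \<Longrightarrow>
        (\<Sum>x\<in>X. t x) = s' \<Longrightarrow> \<forall>a\<in>?I [^]\<^bsub>ideals_set R\<^esub> Suc s'. a \<odot>\<^bsub>M\<^esub> e = \<zero>\<^bsub>M\<^esub>"
      and e: "e \<in> carrier M" and t: "\<And>x. x \<in> X \<Longrightarrow> x [^]\<^bsub>R\<^esub> (t x :: nat) \<odot>\<^bsub>M\<^esub> e = \<zero>\<^bsub>M\<^esub>" and s: "(\<Sum>x\<in>X. t x) = s"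
    let ?J = "{j \<in> carrier R. \<forall>i\<in>?I [^]\<^bsub>ideals_set R\<^esub> s. i \<odot>\<^bsub>M\<^esub> (j \<odot>\<^bsub>M\<^esub> e) = \<zero>\<^bsub>M\<^esub>}"
    have J: "ideal ?J R"
    proof (rule R.ideal_of_closed)
      show "\<zero> \<in> ?J" using e icarr by auto
      fix a b assume "a \<in> ?J" "b \<in> ?J"
      then show "a \<oplus> b \<in> ?J" using e icarr by (auto simp: smult_l_distr smult_r_distr)
    next
      fix a b assume a: "a \<in> carrier R" and b: "b \<in> ?J"
      have "i \<odot>\<^bsub>M\<^esub> ((a \<otimes> b) \<odot>\<^bsub>M\<^esub> e) = a \<odot>\<^bsub>M\<^esub> (i \<odot>\<^bsub>M\<^esub> (b \<odot>\<^bsub>M\<^esub> e))" if "i \<in> carrier R" for i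
        using a b that e R.m_comm smult_assoc1 smult_closed by (metis (no_types, lifting) mem_Collect_eq)
      then show "a \<otimes> b \<in> ?J" using a b icarr by auto
    qed auto
    have "X \<subseteq> ?J"
    proof
      fix x assume x: "x \<in> X"
      then have xR: "x \<in> carrier R" using X by auto
      show "x \<in> ?J"
      proof (cases "t x")
        case 0
        then have "e = \<zero>\<^bsub>M\<^esub>" using t[OF x] e by simp
        then show ?thesis using xR icarr by simp
      next
        case (Suc u)
        have sx: "(\<Sum>y\<in>X. t y) = t x + (\<Sum>y\<in>X - {x}. t y)" using X(1) x by (simp add: sum.remove)
        then obtain s' where s': "s = Suc s'" using s Suc by (cases s) auto
        have "(\<Sum>y\<in>X. (t(x := u)) y) = u + (\<Sum>y\<in>X - {x}. (t(x := u)) y)" using X(1) x by (simp add: sum.remove)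
        also have "(\<Sum>y\<in>X - {x}. (t(x := u)) y) = (\<Sum>y\<in>X - {x}. t y)" by (rule sum.cong) auto
        finally have sum': "(\<Sum>y\<in>X. (t(x := u)) y) = s'" using sx Suc s s' by simp
        have "y [^]\<^bsub>R\<^esub> ((t(x := u)) y) \<odot>\<^bsub>M\<^esub> (x \<odot>\<^bsub>M\<^esub> e) = \<zero>\<^bsub>M\<^esub>" if y: "y \<in> X" for y
        proof (cases "y = x")
          case True
          have "x [^]\<^bsub>R\<^esub> Suc u \<odot>\<^bsub>M\<^esub> e = x [^]\<^bsub>R\<^esub> u \<odot>\<^bsub>M\<^esub> (x \<odot>\<^bsub>M\<^esub> e)" using xR e by (simp add: smult_assoc1)
          then show ?thesis using True t[OF x] Suc by simp
        next
          case False
          have yR: "y [^]\<^bsub>R\<^esub> t y \<in> carrier R" using y X by auto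
          have "y [^]\<^bsub>R\<^esub> t y \<odot>\<^bsub>M\<^esub> (x \<odot>\<^bsub>M\<^esub> e) = x \<odot>\<^bsub>M\<^esub> (y [^]\<^bsub>R\<^esub> t y \<odot>\<^bsub>M\<^esub> e)"
            using smult_assoc1[OF yR xR e] smult_assoc1[OF xR yR e] R.m_comm[OF xR yR] by simp
          then show ?thesis using False t[OF y] xR by simp
        qed
        then have "\<forall>a\<in>?I [^]\<^bsub>ideals_set R\<^esub> Suc s'. a \<odot>\<^bsub>M\<^esub> (x \<odot>\<^bsub>M\<^esub> e) = \<zero>\<^bsub>M\<^esub>"
          using IH[OF _ smult_closed[OF xR e] _ sum'] s' by blast
        then show ?thesis using xR s' by blast
      qed
    qed
    then have IJ: "?I \<subseteq> ?J" by (rule R.genideal_minimal[OF J])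
    show "\<forall>a\<in>?I [^]\<^bsub>ideals_set R\<^esub> Suc s. a \<odot>\<^bsub>M\<^esub> e = \<zero>\<^bsub>M\<^esub>"
    proof
      fix a assume "a \<in> ?I [^]\<^bsub>ideals_set R\<^esub> Suc s"
      then have "a \<in> (?I [^]\<^bsub>ideals_set R\<^esub> s) \<cdot> ?I" unfolding R.ideal_pow_Suc .
      then have "a \<in> carrier R \<and> a \<odot>\<^bsub>M\<^esub> e = \<zero>\<^bsub>M\<^esub>"
      proof (induction a rule: ideal_prod.induct)
        case (prod i j)
        then have "i \<in> carrier R" "j \<in> ?J" using icarr IJ by auto
        then show ?case using prod e by (simp add: smult_assoc1)
      qed (use e in \<open>auto simp: smult_l_distr\<close>)
      then show "a \<odot>\<^bsub>M\<^esub> e = \<zero>\<^bsub>M\<^esub>" by simp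
    qed
  qed
  obtain \<tau> where "\<And>x. x \<in> X \<Longrightarrow> x [^]\<^bsub>R\<^esub> (\<tau> x :: nat) \<odot>\<^bsub>M\<^esub> e = \<zero>\<^bsub>M\<^esub>" using t by metis
  from main[OF e this refl] show ?thesis unfolding torsion_submodule_def using e by blast
qed

section \<open>Annihilators of cohomology modules\<close>

lemma cocycles_iff: "z \<in> cocycles C \<delta> i \<longleftrightarrow> z \<in> carrier (C i) \<and> \<delta> i z = \<zero>\<^bsub>C (Suc i)\<^esub>"
  by (simp add: cocycles_def a_kernel_def')

lemma cocycles_submodule:
  assumes "cochain_complex R C \<delta>" shows "submodule (cocycles C \<delta> i) R (C i)"
proof -
  interpret M: module R "C i" using assms by (simp add: cochain_complex_def)
  interpret N: module R "C (Suc i)" using assms by (simp add: cochain_complex_def)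
  have d: "\<delta> i \<in> linear_hom R (C i) (C (Suc i))" using assms by (simp add: cochain_complex_def)
  show ?thesis
    using linear_homD[OF d] linear_hom_zero[OF M.module_axioms N.module_axioms d]
    by (intro M.submodule_of_closed) (auto simp: cocycles_iff)
qed

lemma coboundaries_submodule:
  assumes "cochain_complex R C \<delta>"
  shows "submodule (coboundaries C \<delta> i) R (C i)" "coboundaries C \<delta> i \<subseteq> cocycles C \<delta> i"
proof -
  have mods: "module R (C j)" and d: "\<delta> j \<in> linear_hom R (C j) (C (Suc j))"
    and dd: "x \<in> carrier (C j) \<Longrightarrow> \<delta> (Suc j) (\<delta> j x) = \<zero>\<^bsub>C (Suc (Suc j))\<^esub>" for j x
    using assms by (auto simp: cochain_complex_def)
  interpret M: module R "C i" by (rule mods)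
  have "submodule (coboundaries C \<delta> i) R (C i) \<and> coboundaries C \<delta> i \<subseteq> cocycles C \<delta> i"
  proof (cases i)
    case 0
    interpret Z: module R "C 0" by (rule mods)
    show ?thesis using 0 linear_hom_zero[OF mods mods d]
      by (auto intro!: Z.submodule_of_closed simp: coboundaries_def cocycles_iff)
  next
    case (Suc k)
    interpret K: module R "C k" by (rule mods)
    note dk = linear_homD[OF d[of k]]
    have "submodule (\<delta> k ` carrier (C k)) R (C i)"
    proof (rule M.submodule_of_closed)
      show "\<delta> k ` carrier (C k) \<subseteq> carrier (C i)" using dk Suc by auto
      show "\<zero>\<^bsub>C i\<^esub> \<in> \<delta> k ` carrier (C k)"
        using linear_hom_zero[OF mods mods d[of k]] Suc by (metis K.M.zero_closed image_eqI)
      fix a b assume "a \<in> \<delta> k ` carrier (C k)" "b \<in> \<delta> k ` carrier (C k)"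
      then obtain x y where "x \<in> carrier (C k)" "y \<in> carrier (C k)" "a = \<delta> k x" "b = \<delta> k y" by auto
      then have "x \<oplus>\<^bsub>C k\<^esub> y \<in> carrier (C k)" "a \<oplus>\<^bsub>C i\<^esub> b = \<delta> k (x \<oplus>\<^bsub>C k\<^esub> y)" using dk(2) Suc by auto
      then show "a \<oplus>\<^bsub>C i\<^esub> b \<in> \<delta> k ` carrier (C k)" by blast
    next
      fix r b assume r: "r \<in> carrier R" and "b \<in> \<delta> k ` carrier (C k)"
      then obtain y where "y \<in> carrier (C k)" "b = \<delta> k y" by auto
      then have "r \<odot>\<^bsub>C k\<^esub> y \<in> carrier (C k)" "r \<odot>\<^bsub>C i\<^esub> b = \<delta> k (r \<odot>\<^bsub>C k\<^esub> y)" using dk(3) Suc r by auto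
      then show "r \<odot>\<^bsub>C i\<^esub> b \<in> \<delta> k ` carrier (C k)" by blast
    qed
    then show ?thesis using Suc dk(1) dd by (auto simp: coboundaries_def cocycles_iff)
  qed
  then show "submodule (coboundaries C \<delta> i) R (C i)" "coboundaries C \<delta> i \<subseteq> cocycles C \<delta> i" by auto
qed

lemma annihilator_cohomology_iff:
  assumes C: "cochain_complex R C \<delta>"
  shows "r \<in> annihilator R (cohomology C \<delta> i) \<longleftrightarrow>
     r \<in> carrier R \<and> (\<forall>z\<in>cocycles C \<delta> i. r \<odot>\<^bsub>C i\<^esub> z \<in> coboundaries C \<delta> i)"
proof -
  interpret M: module R "C i" using C by (simp add: cochain_complex_def)
  let ?Z = "cocycles C \<delta> i" and ?B = "coboundaries C \<delta> i"
  define MZ where "MZ = C i\<lparr>carrier := ?Z\<rparr>"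
  note Z = cocycles_submodule[OF C] and B = coboundaries_submodule[OF C]
  interpret MZ: module R MZ unfolding MZ_def by (rule submodule.submodule_is_module[OF Z M.module_axioms])
  have mz [simp]: "carrier MZ = ?Z" "\<zero>\<^bsub>MZ\<^esub> = \<zero>\<^bsub>C i\<^esub>" "a \<oplus>\<^bsub>MZ\<^esub> b = a \<oplus>\<^bsub>C i\<^esub> b" "r \<odot>\<^bsub>MZ\<^esub> a = r \<odot>\<^bsub>C i\<^esub> a" for a b r
    by (simp_all add: MZ_def)
  have BZ: "submodule ?B R MZ"
    using B(2) M.submoduleE[OF B(1)] M.submodule_zero[OF B(1)] by (intro MZ.submodule_of_closed) auto
  have B0: "?B +>\<^bsub>MZ\<^esub> \<zero>\<^bsub>MZ\<^esub> = ?B"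
    using MZ.M.a_coset_add_zero[OF MZ.submoduleE(1)[OF BZ]] by simp
  have eq: "(r \<odot>\<^bsub>cohomology C \<delta> i\<^esub> (?B +>\<^bsub>MZ\<^esub> z) = \<zero>\<^bsub>cohomology C \<delta> i\<^esub>) \<longleftrightarrow> r \<odot>\<^bsub>C i\<^esub> z \<in> ?B"
    if r: "r \<in> carrier R" and z: "z \<in> ?Z" for z
  proof -
    have rz: "r \<odot>\<^bsub>C i\<^esub> z \<in> carrier MZ" using M.submoduleE(4)[OF Z r z] by simp
    have "(r \<odot>\<^bsub>cohomology C \<delta> i\<^esub> (?B +>\<^bsub>MZ\<^esub> z)) = ?B +>\<^bsub>MZ\<^esub> (r \<odot>\<^bsub>C i\<^esub> z)"
      unfolding cohomology_def MZ_def[symmetric] using MZ.quotient_smult_coset[OF BZ r, of z] z by simp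
    moreover have "\<zero>\<^bsub>cohomology C \<delta> i\<^esub> = ?B +>\<^bsub>MZ\<^esub> \<zero>\<^bsub>MZ\<^esub>"
      unfolding cohomology_def MZ_def[symmetric] using B0 by simp
    moreover have "(r \<odot>\<^bsub>C i\<^esub> z) \<ominus>\<^bsub>MZ\<^esub> \<zero>\<^bsub>MZ\<^esub> = r \<odot>\<^bsub>C i\<^esub> z"
      using MZ.M.minus_add_cancel[OF rz MZ.M.zero_closed] MZ.M.r_zero[OF MZ.M.minus_closed[OF rz MZ.M.zero_closed]] by simp
    ultimately show ?thesis using MZ.coset_eq_iff[OF BZ rz MZ.M.zero_closed] by simp
  qed
  have carr: "X \<in> carrier (cohomology C \<delta> i) \<longleftrightarrow> (\<exists>z\<in>?Z. X = ?B +>\<^bsub>MZ\<^esub> z)" for X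
    unfolding cohomology_def MZ_def[symmetric] using MZ.coset_carrier by simp
  have "(\<forall>X\<in>carrier (cohomology C \<delta> i). r \<odot>\<^bsub>cohomology C \<delta> i\<^esub> X = \<zero>\<^bsub>cohomology C \<delta> i\<^esub>) \<longleftrightarrow>
      (\<forall>z\<in>?Z. r \<odot>\<^bsub>C i\<^esub> z \<in> ?B)" if r: "r \<in> carrier R"
  proof
    assume L: "\<forall>X\<in>carrier (cohomology C \<delta> i). r \<odot>\<^bsub>cohomology C \<delta> i\<^esub> X = \<zero>\<^bsub>cohomology C \<delta> i\<^esub>"
    show "\<forall>z\<in>?Z. r \<odot>\<^bsub>C i\<^esub> z \<in> ?B"
    proof
      fix z assume z: "z \<in> ?Z"
      then have "?B +>\<^bsub>MZ\<^esub> z \<in> carrier (cohomology C \<delta> i)" using carr by metis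
      then show "r \<odot>\<^bsub>C i\<^esub> z \<in> ?B" using L eq[OF r z] by simp
    qed
  next
    assume L: "\<forall>z\<in>?Z. r \<odot>\<^bsub>C i\<^esub> z \<in> ?B"
    show "\<forall>X\<in>carrier (cohomology C \<delta> i). r \<odot>\<^bsub>cohomology C \<delta> i\<^esub> X = \<zero>\<^bsub>cohomology C \<delta> i\<^esub>"
    proof
      fix X assume "X \<in> carrier (cohomology C \<delta> i)"
      then obtain z where "z \<in> ?Z" "X = ?B +>\<^bsub>MZ\<^esub> z" using carr by metis
      then show "r \<odot>\<^bsub>cohomology C \<delta> i\<^esub> X = \<zero>\<^bsub>cohomology C \<delta> i\<^esub>" using L eq[OF r] by simp
    qed
  qed
  then show ?thesis unfolding annihilator_def mem_Collect_eq by blast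
qed

lemma torsion_complex:
  assumes C: "cochain_complex R C \<delta>" and I: "ideal I R"
  shows "cochain_complex R (\<lambda>p. (C p)\<lparr>carrier := torsion_submodule R I (C p)\<rparr>) \<delta>"
proof -
  have mods: "module R (C j)" and d: "\<delta> j \<in> linear_hom R (C j) (C (Suc j))"
    and dd: "x \<in> carrier (C j) \<Longrightarrow> \<delta> (Suc j) (\<delta> j x) = \<zero>\<^bsub>C (Suc (Suc j))\<^esub>" for j x
    using C by (auto simp: cochain_complex_def)
  have sub: "x \<in> torsion_submodule R I (C j) \<Longrightarrow> x \<in> carrier (C j)" for x j
    by (simp add: torsion_submodule_def)
  have "module R ((C j)\<lparr>carrier := torsion_submodule R I (C j)\<rparr>)" for j
    by (rule submodule.submodule_is_module[OF module.torsion_submodule_submodule[OF mods I] mods])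
  moreover have "\<delta> j \<in> linear_hom R ((C j)\<lparr>carrier := torsion_submodule R I (C j)\<rparr>)
      ((C (Suc j))\<lparr>carrier := torsion_submodule R I (C (Suc j))\<rparr>)" for j
    using torsion_submodule_map[OF mods mods d I] linear_homD[OF d] sub by (intro linear_homI) auto
  ultimately show ?thesis unfolding cochain_complex_def using dd sub by auto
qed

section \<open>Coordinates in free modules\<close>

text \<open>
  The coefficients are indexed by the basis vectors themselves.
\<close>

definition lin_comb :: "('a, 'r) ring_scheme \<Rightarrow> ('a, 'b, 'm) module_scheme \<Rightarrow> ('b \<Rightarrow> 'a) \<Rightarrow> 'b" where
  "lin_comb R M c = (\<Oplus>\<^bsub>M\<^esub>b\<in>{b. c b \<noteq> \<zero>\<^bsub>R\<^esub>}. c b \<odot>\<^bsub>M\<^esub> b)"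

lemma module_basis_iff:
  "module_basis R M B \<longleftrightarrow> B \<subseteq> carrier M \<and>
     (\<forall>x\<in>carrier M. \<exists>!c. c \<in> carrier (direct_sum B (regular_module R)) \<and> x = lin_comb R M c)"
proof -
  have "(range c \<subseteq> carrier R \<and> (\<forall>b. b \<notin> B \<longrightarrow> c b = \<zero>\<^bsub>R\<^esub>) \<and> finite {b. c b \<noteq> \<zero>\<^bsub>R\<^esub>} \<and>
      x = (\<Oplus>\<^bsub>M\<^esub>b\<in>{b. c b \<noteq> \<zero>\<^bsub>R\<^esub>}. c b \<odot>\<^bsub>M\<^esub> b)) \<longleftrightarrow>
      (c \<in> carrier (direct_sum B (regular_module R)) \<and> x = lin_comb R M c)" for c x
    unfolding direct_sum_carrier lin_comb_def image_subset_iff by auto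
  then show ?thesis unfolding module_basis_def by simp
qed

context module
begin

lemma lin_comb_eq_finsum:
  assumes "B \<subseteq> carrier M" "c \<in> carrier (direct_sum B (regular_module R))"
    and U: "finite U" "U \<subseteq> carrier M" "{b. c b \<noteq> \<zero>} \<subseteq> U"
  shows "lin_comb R M c = (\<Oplus>\<^bsub>M\<^esub>b\<in>U. c b \<odot>\<^bsub>M\<^esub> b)"
  unfolding lin_comb_def
  by (rule M.add.finprod_mono_neutral_cong_left[OF U(1,3)])
    (use assms(1,2) U(2) in \<open>auto simp: direct_sum_carrier\<close>)

lemma lin_comb_closed:
  assumes "B \<subseteq> carrier M" "c \<in> carrier (direct_sum B (regular_module R))"
  shows "lin_comb R M c \<in> carrier M"
  unfolding lin_comb_def using assms by (intro M.finsum_closed) (auto simp: direct_sum_carrier)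

lemma lin_comb_smult:
  assumes B: "B \<subseteq> carrier M" and c: "c \<in> carrier (direct_sum B (regular_module R))" and r: "r \<in> carrier R"
  shows "lin_comb R M (\<lambda>b. r \<otimes> c b) = r \<odot>\<^bsub>M\<^esub> lin_comb R M c"
proof -
  interpret S: module R "regular_module R" by (rule R.regular_module_module)
  interpret D: module R "direct_sum B (regular_module R)" by (rule S.direct_sum_module)
  let ?U = "{b. c b \<noteq> \<zero>}"
  have U: "finite ?U" "?U \<subseteq> carrier M" using c B by (auto simp: direct_sum_carrier)
  have cR: "c b \<in> carrier R" for b using c by (auto simp: direct_sum_carrier)
  have rc: "(\<lambda>b. r \<otimes> c b) \<in> carrier (direct_sum B (regular_module R))" using D.smult_closed[OF r c] by simp
  have "lin_comb R M (\<lambda>b. r \<otimes> c b) = (\<Oplus>\<^bsub>M\<^esub>b\<in>?U. (r \<otimes> c b) \<odot>\<^bsub>M\<^esub> b)"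
    by (rule lin_comb_eq_finsum[OF B rc U]) (use r in auto)
  also have "\<dots> = (\<Oplus>\<^bsub>M\<^esub>b\<in>?U. r \<odot>\<^bsub>M\<^esub> (c b \<odot>\<^bsub>M\<^esub> b))"
    using U cR r by (intro M.finsum_cong') (auto simp: smult_assoc1 subset_iff)
  also have "\<dots> = r \<odot>\<^bsub>M\<^esub> lin_comb R M c"
    unfolding lin_comb_def using U cR r by (intro finsum_smult_ldistr[symmetric]) auto
  finally show ?thesis .
qed

lemma lin_comb_zero: "lin_comb R M (\<lambda>_. \<zero>) = \<zero>\<^bsub>M\<^esub>"
  by (simp add: lin_comb_def)

lemma lin_comb_inj:
  assumes "module_basis R M B" "c \<in> carrier (direct_sum B (regular_module R))"
    "d \<in> carrier (direct_sum B (regular_module R))" "lin_comb R M c = lin_comb R M d"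
  shows "c = d"
proof -
  have B: "B \<subseteq> carrier M" using assms(1) by (simp add: module_basis_def)
  have "\<exists>!c'. c' \<in> carrier (direct_sum B (regular_module R)) \<and> lin_comb R M c = lin_comb R M c'"
    using assms(1) lin_comb_closed[OF B assms(2)] unfolding module_basis_iff by blast
  then show ?thesis using assms(2-4) by blast
qed

end

text \<open>
  In coordinates a linear map is the action of its matrix on the free module over \<open>R\<close>.
\<close>

lemma linear_hom_lin_comb:
  assumes M: "module R M" and N: "module R N" and f: "f \<in> linear_hom R M N"
    and B: "B \<subseteq> carrier M" and B': "B' \<subseteq> carrier N" and D: "column_finite R B B' D"
    and fb: "\<And>b. b \<in> B \<Longrightarrow> f b = lin_comb R N (D b)"
    and c: "c \<in> carrier (direct_sum B (regular_module R))"
  shows "f (lin_comb R M c) = lin_comb R N (act (regular_module R) D c)"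
proof -
  interpret M: module R M by fact
  interpret N: module R N by fact
  interpret S: module R "regular_module R" by (rule M.R.regular_module_module)
  let ?U = "{b. c b \<noteq> \<zero>\<^bsub>R\<^esub>}"
  let ?W = "\<Union>b\<in>?U. {b'. D b b' \<noteq> \<zero>\<^bsub>R\<^esub>}"
  have U: "finite ?U" "?U \<subseteq> B" and cR: "c b \<in> carrier R" for b using c by (auto simp: direct_sum_carrier)
  have W: "finite ?W" "?W \<subseteq> B'" using U column_finiteD(2,3)[OF D] by auto
  then have WN: "?W \<subseteq> carrier N" using B' by auto
  note fD = linear_homD[OF f] linear_hom_zero[OF M N f]
  have "f (\<Oplus>\<^bsub>M\<^esub>b\<in>V. c b \<odot>\<^bsub>M\<^esub> b) = (\<Oplus>\<^bsub>N\<^esub>b\<in>V. c b \<odot>\<^bsub>N\<^esub> f b)" if "finite V" "V \<subseteq> B" for V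
    using that
  proof (induction V rule: finite_induct)
    case (insert b V)
    have "(\<lambda>b. c b \<odot>\<^bsub>M\<^esub> b) \<in> insert b V \<rightarrow> carrier M" "(\<lambda>b. c b \<odot>\<^bsub>N\<^esub> f b) \<in> insert b V \<rightarrow> carrier N" "b \<in> carrier M"
      using insert B cR fD(1) by auto
    then show ?case using insert fD cR
      by (simp add: M.M.finsum_insert N.M.finsum_insert Pi_iff M.M.finsum_closed)
  qed (simp add: fD)
  from this[OF U] have "f (lin_comb R M c) = (\<Oplus>\<^bsub>N\<^esub>b\<in>?U. c b \<odot>\<^bsub>N\<^esub> f b)" by (simp add: lin_comb_def)
  also have "\<dots> = (\<Oplus>\<^bsub>N\<^esub>b\<in>?U. c b \<odot>\<^bsub>N\<^esub> (\<Oplus>\<^bsub>N\<^esub>b'\<in>?W. D b b' \<odot>\<^bsub>N\<^esub> b'))"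
  proof (rule N.M.finsum_cong')
    show "(\<lambda>b. c b \<odot>\<^bsub>N\<^esub> (\<Oplus>\<^bsub>N\<^esub>b'\<in>?W. D b b' \<odot>\<^bsub>N\<^esub> b')) \<in> ?U \<rightarrow> carrier N"
      using cR U(2) WN column_finiteD(1)[OF D] by (auto intro!: N.smult_closed N.M.finsum_closed)
    fix b assume b: "b \<in> ?U"
    then have "b \<in> B" using U by auto
    have "lin_comb R N (D b) = (\<Oplus>\<^bsub>N\<^esub>b'\<in>?W. D b b' \<odot>\<^bsub>N\<^esub> b')"
      by (rule N.lin_comb_eq_finsum[OF B' column_finiteD(4)[OF D \<open>b \<in> B\<close>] W(1) WN]) (use b in auto)
    then show "c b \<odot>\<^bsub>N\<^esub> f b = c b \<odot>\<^bsub>N\<^esub> (\<Oplus>\<^bsub>N\<^esub>b'\<in>?W. D b b' \<odot>\<^bsub>N\<^esub> b')" using fb[OF \<open>b \<in> B\<close>] by simp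
  qed simp
  also have "\<dots> = (\<Oplus>\<^bsub>N\<^esub>b'\<in>?W. (\<Oplus>\<^bsub>R\<^esub>b\<in>?U. c b \<otimes>\<^bsub>R\<^esub> D b b') \<odot>\<^bsub>N\<^esub> b')"
    using U W(1) WN cR column_finiteD(1)[OF D] by (intro N.finsum_smult_swap) auto
  also have "\<dots> = (\<Oplus>\<^bsub>N\<^esub>b'\<in>?W. act (regular_module R) D c b' \<odot>\<^bsub>N\<^esub> b')"
  proof (rule N.M.finsum_cong')
    show "(\<lambda>b'. act (regular_module R) D c b' \<odot>\<^bsub>N\<^esub> b') \<in> ?W \<rightarrow> carrier N"
      using S.act_value_closed[OF D c] WN by auto
    fix b' assume b': "b' \<in> ?W"
    have "(\<Oplus>\<^bsub>R\<^esub>b\<in>?U. c b \<otimes>\<^bsub>R\<^esub> D b b') = (\<Oplus>\<^bsub>R\<^esub>b\<in>?U. D b b' \<otimes>\<^bsub>R\<^esub> c b)"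
      using U cR column_finiteD(1)[OF D] by (intro M.R.finsum_cong') (auto simp: M.R.m_comm subset_iff)
    also have "\<dots> = act (regular_module R) D c b'"
      by (simp add: act_def finsum_regular_module)
    finally show "(\<Oplus>\<^bsub>R\<^esub>b\<in>?U. c b \<otimes>\<^bsub>R\<^esub> D b b') \<odot>\<^bsub>N\<^esub> b' = act (regular_module R) D c b' \<odot>\<^bsub>N\<^esub> b'" by simp
  qed simp
  also have "\<dots> = lin_comb R N (act (regular_module R) D c)"
    using S.act_support[OF D c] by (intro N.lin_comb_eq_finsum[OF B' S.act_closed[OF D c] W(1) WN, symmetric]) simp
  finally show ?thesis .
qed

section \<open>From local cohomology to the cohomology of a free complex\<close>

lemma (in module) act_zero_matrix: "act M (\<lambda>_ _. \<zero>) y = \<zero>\<^bsub>direct_sum B M\<^esub>" if "y \<in> carrier (direct_sum B' M)"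
  unfolding act_def direct_sum_simps using direct_sum_support(3)[OF that]
  by (intro ext M.add.finprod_one_eqI) auto

text \<open>
  Coordinates turn the complex into matrices; their action on the injective modules gives a double complex of
  the kind above, whose columns are the direct sums of copies of the resolution.  The family of images under \<open>\<epsilon>\<close>
  of the coordinates of a cocycle is a vertical and horizontal cocycle in the row \<open>q = 0\<close>.  The lifting theorem
  writes its multiples as horizontal coboundaries of vertical cocycles, and these come from the complex again
  because \<open>\<epsilon>\<close> identifies \<open>R\<close> with the cocycles of \<open>E 0\<close>.
\<close>

theorem cohomology_annihilated_by_local_cohomology_annihilators:
  fixes R :: "('a, 'r) ring_scheme" and E :: "nat \<Rightarrow> ('a, 'e) module" and C :: "nat \<Rightarrow> ('a, 'c) module"
  assumes R: "cring R" and noeth: "noetherian_ring R" and nontrivial: "\<one>\<^bsub>R\<^esub> \<noteq> \<zero>\<^bsub>R\<^esub>"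
    and res: "injective_resolution R (regular_module R) E \<epsilon> dE"
    and X: "finite X" "X \<subseteq> carrier R"
    and A: "\<And>j. ideal (A j) R" "\<And>j. A j \<subseteq> annihilator R (local_cohomology R (genideal R X) E dE j)"
    and C: "cochain_complex R C \<delta>" and bounded: "\<And>i. i > r \<Longrightarrow> carrier (C i) = {\<zero>\<^bsub>C i\<^esub>}"
    and free: "\<And>i. module_basis R (C i) (B i)"
    and nilpotent: "\<And>i x. x \<in> X \<Longrightarrow> \<exists>N::nat. \<forall>z\<in>cocycles C \<delta> i. x [^]\<^bsub>R\<^esub> N \<odot>\<^bsub>C i\<^esub> z \<in> coboundaries C \<delta> i"
  shows "ideal_prod_from R A i 0 \<subseteq> annihilator R (cohomology C \<delta> i)"
proof -
  interpret R: cring R by fact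
  let ?S = "regular_module R" and ?I = "genideal R X"
  interpret S: module R ?S by (rule R.regular_module_module)
  have I: "ideal ?I R" by (rule R.genideal_ideal[OF X(2)])
  have Cm: "module R (C j)" and d: "\<delta> j \<in> linear_hom R (C j) (C (Suc j))"
    and dd: "x \<in> carrier (C j) \<Longrightarrow> \<delta> (Suc j) (\<delta> j x) = \<zero>\<^bsub>C (Suc (Suc j))\<^esub>" for j x
    using C by (auto simp: cochain_complex_def)
  have E: "cochain_complex R E dE" and inj: "injective_module R (E j)"
    and \<epsilon>: "\<epsilon> \<in> linear_hom R ?S (E 0)" and \<epsilon>_inj: "inj_on \<epsilon> (carrier R)"
    and \<epsilon>_img: "\<epsilon> ` carrier R = cocycles E dE 0"
      and E_exact: "cocycles E dE (Suc j) = coboundaries E dE (Suc j)" for j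
    using res by (auto simp: injective_resolution_def)
  have Em: "module R (E j)" and dE: "dE j \<in> linear_hom R (E j) (E (Suc j))"
    and ddE: "x \<in> carrier (E j) \<Longrightarrow> dE (Suc j) (dE j x) = \<zero>\<^bsub>E (Suc (Suc j))\<^esub>" for j x
    using E by (auto simp: cochain_complex_def)
  have BC: "B j \<subseteq> carrier (C j)" for j using free by (simp add: module_basis_def)

  define F where "F = (\<lambda>Y. direct_sum Y ?S :: ('a, 'c \<Rightarrow> 'a) module)"
  have Fm: "module R (F Y)" for Y unfolding F_def by (rule S.direct_sum_module)
  have ex_coord: "\<exists>c. c \<in> carrier (F (B j)) \<and> x = lin_comb R (C j) c" if "x \<in> carrier (C j)" for x j
    using free[of j] that unfolding module_basis_iff F_def by blast
  define coord where "coord = (\<lambda>j x. SOME c. c \<in> carrier (F (B j)) \<and> x = lin_comb R (C j) c)"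
  have coord: "coord j x \<in> carrier (F (B j)) \<and> x = lin_comb R (C j) (coord j x)" if "x \<in> carrier (C j)" for x j
    unfolding coord_def by (rule someI_ex[OF ex_coord[OF that]])
  define D where "D = (\<lambda>j b. coord (Suc j) (\<delta> j b))"
  have D: "column_finite R (B j) (B (Suc j)) (D j)" for j
    unfolding column_finite_def
  proof
    fix b assume "b \<in> B j"
    then have "\<delta> j b \<in> carrier (C (Suc j))" using BC linear_homD(1)[OF d] by blast
    then show "D j b \<in> carrier (direct_sum (B (Suc j)) ?S)" using coord by (simp add: D_def F_def)
  qed
  have \<delta>_comb: "\<delta> j (lin_comb R (C j) c) = lin_comb R (C (Suc j)) (act ?S (D j) c)"
    if "c \<in> carrier (F (B j))" for j c
  proof (rule linear_hom_lin_comb[OF Cm Cm d BC BC D])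
    fix b assume "b \<in> B j"
    then have "\<delta> j b \<in> carrier (C (Suc j))" using BC linear_homD(1)[OF d] by auto
    then show "\<delta> j b = lin_comb R (C (Suc j)) (D j b)" unfolding D_def using coord by blast
  qed (use that in \<open>simp add: F_def\<close>)
  have act_closed: "act ?S (D j) c \<in> carrier (F (B (Suc j)))" if "c \<in> carrier (F (B j))" for j c
    using S.act_closed[OF D] that by (simp add: F_def)
  have comb_closed: "lin_comb R (C j) c \<in> carrier (C j)" if "c \<in> carrier (F (B j))" for j c
    using module.lin_comb_closed[OF Cm BC] that by (simp add: F_def)
  have comb_inj: "c = e" if "c \<in> carrier (F (B j))" "e \<in> carrier (F (B j))" "lin_comb R (C j) c = lin_comb R (C j) e" for j c e
    using module.lin_comb_inj[OF Cm free] that by (simp add: F_def)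
  have zeroF: "(\<lambda>_. \<zero>\<^bsub>R\<^esub>) \<in> carrier (F Y)" for Y by (simp add: F_def direct_sum_carrier)
  have comb_zero: "lin_comb R (C j) (\<lambda>_. \<zero>\<^bsub>R\<^esub>) = \<zero>\<^bsub>C j\<^esub>" for j by (rule module.lin_comb_zero[OF Cm])
  have comb_zero_iff: "lin_comb R (C j) c = \<zero>\<^bsub>C j\<^esub> \<longleftrightarrow> c = (\<lambda>_. \<zero>\<^bsub>R\<^esub>)" if "c \<in> carrier (F (B j))" for j c
    using comb_inj[OF that zeroF] comb_zero by metis
  have cocycle_iff: "lin_comb R (C j) c \<in> cocycles C \<delta> j \<longleftrightarrow> act ?S (D j) c = (\<lambda>_. \<zero>\<^bsub>R\<^esub>)"
    if "c \<in> carrier (F (B j))" for j c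
    using that comb_zero_iff[OF act_closed[OF that]] comb_closed \<delta>_comb by (simp add: cocycles_iff)
  have comb_smult: "lin_comb R (C j) (\<lambda>b. x \<otimes>\<^bsub>R\<^esub> c b) = x \<odot>\<^bsub>C j\<^esub> lin_comb R (C j) c"
    if "c \<in> carrier (F (B j))" "x \<in> carrier R" for j c x
    using module.lin_comb_smult[OF Cm BC] that by (simp add: F_def)

  \<comment> \<open>A zero module in front of the complex makes the case of degree \<open>0\<close> an instance of the general one.\<close>
  define B' where "B' = case_nat {} B"
  define D' where "D' = case_nat (\<lambda>_ _. \<zero>\<^bsub>R\<^esub>) D"
  have B'0: "B' 0 = {}" and B'S: "\<And>p. B' (Suc p) = B p" and D'S: "\<And>p. D' (Suc p) = D p"
    by (simp_all add: B'_def D'_def)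
  have D': "column_finite R (B' p) (B' (Suc p)) (D' p)" for p
    using D by (cases p) (auto simp: B'_def D'_def column_finite_def)
  have DD: "act ?S (D' (Suc p)) (D' p b) = (\<lambda>_. \<zero>\<^bsub>R\<^esub>)" if b: "b \<in> B' p" for p b
  proof (cases p)
    case 0 then show ?thesis using b B'0 by simp
  next
    case (Suc j)
    then have bj: "b \<in> B j" using b B'S by simp
    have "D j b \<in> carrier (F (B (Suc j)))" using column_finiteD(4)[OF D bj] by (simp add: F_def)
    moreover have "\<delta> j b \<in> carrier (C (Suc j))" using linear_homD(1)[OF d] BC bj by blast
    then have "lin_comb R (C (Suc j)) (D j b) = \<delta> j b"
      unfolding D_def using conjunct2[OF coord, symmetric] by blast
    moreover have "\<delta> j b \<in> cocycles C \<delta> (Suc j)"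
      using dd[of b j] linear_homD(1)[OF d] BC bj by (auto simp: cocycles_iff)
    ultimately show ?thesis using cocycle_iff[of "D j b" "Suc j"] Suc D'S by simp
  qed
  have empty: "B' (Suc p) = {}" if "p \<ge> Suc r" for p
  proof (rule ccontr)
    assume "B' (Suc p) \<noteq> {}"
    then obtain b where b: "b \<in> B p" using B'S by auto
    let ?e = "\<lambda>b'. if b' = b then \<one>\<^bsub>R\<^esub> else \<zero>\<^bsub>R\<^esub>"
    have e: "?e \<in> carrier (F (B p))" using b by (auto simp: F_def direct_sum_carrier)
    have "lin_comb R (C p) ?e = \<zero>\<^bsub>C p\<^esub>" using comb_closed[OF e] bounded[of p] that by auto
    then have "?e b = \<zero>\<^bsub>R\<^esub>" using comb_zero_iff[OF e] by (metis (no_types))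
    then show False using nontrivial by simp
  qed
  have kills: "\<exists>a\<in>carrier (direct_sum (B' p) ?S). x \<odot>\<^bsub>direct_sum (B' (Suc p)) ?S\<^esub> c = act ?S (D' p) a"
    if xk: "x \<in> carrier R" "\<forall>z\<in>cocycles C \<delta> p. x \<odot>\<^bsub>C p\<^esub> z \<in> coboundaries C \<delta> p"
      and c: "c \<in> carrier (direct_sum (B' (Suc p)) ?S)" "act ?S (D' (Suc p)) c = (\<lambda>_. \<zero>\<^bsub>R\<^esub>)" for x p c
  proof -
    have cF: "c \<in> carrier (F (B p))" using c(1) by (simp add: B'S F_def)
    have xcF: "(\<lambda>b. x \<otimes>\<^bsub>R\<^esub> c b) \<in> carrier (F (B p))"
      using module.smult_closed[OF Fm xk(1) cF] by (simp add: F_def)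
    have "lin_comb R (C p) c \<in> cocycles C \<delta> p" using cocycle_iff[OF cF] c(2) D'S by simp
    then have cob: "lin_comb R (C p) (\<lambda>b. x \<otimes>\<^bsub>R\<^esub> c b) \<in> coboundaries C \<delta> p"
      using xk comb_smult[OF cF] by simp
    show ?thesis
    proof (cases p)
      case 0
      then have "(\<lambda>b. x \<otimes>\<^bsub>R\<^esub> c b) = (\<lambda>_. \<zero>\<^bsub>R\<^esub>)"
        using cob comb_zero_iff[OF xcF] by (simp add: coboundaries_def)
      moreover have "act ?S (D' 0) (\<lambda>_. \<zero>\<^bsub>R\<^esub>) = (\<lambda>_. \<zero>\<^bsub>R\<^esub>)" by (simp add: act_def fun_eq_iff)
      ultimately show ?thesis using zeroF 0 by (auto simp: F_def intro!: bexI[of _ "\<lambda>_. \<zero>\<^bsub>R\<^esub>"])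
    next
      case (Suc k)
      then obtain y where y: "y \<in> carrier (C k)" "lin_comb R (C p) (\<lambda>b. x \<otimes>\<^bsub>R\<^esub> c b) = \<delta> k y"
        using cob by (auto simp: coboundaries_def)
      define a where "a = coord k y"
      have a: "a \<in> carrier (F (B k))" "y = lin_comb R (C k) a" using coord[OF y(1)] by (auto simp: a_def)
      have "(\<lambda>b. x \<otimes>\<^bsub>R\<^esub> c b) = act ?S (D k) a"
        using y(2) \<delta>_comb[OF a(1)] a(2) Suc by (intro comb_inj[OF xcF]) (use act_closed[OF a(1)] in auto)
      then show ?thesis using a(1) Suc B'S D'S by (auto simp: F_def)
    qed
  qed
  have homotopic: "\<exists>m h0 h1. homotopy_at R (B' p) (B' (Suc p)) (B' (Suc (Suc p))) (D' p) (D' (Suc p)) (x [^]\<^bsub>R\<^esub> (m::nat)) h0 h1"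
    if x: "x \<in> X" for x p
  proof -
    have xR: "x \<in> carrier R" using x X by auto
    obtain N :: "nat \<Rightarrow> nat" where N: "\<And>i. \<forall>z\<in>cocycles C \<delta> i. x [^]\<^bsub>R\<^esub> N i \<odot>\<^bsub>C i\<^esub> z \<in> coboundaries C \<delta> i"
      using nilpotent[OF x] by metis
    \<comment> \<open>One exponent works for all positions, since the complex is bounded.\<close>
    define M where "M = (\<Sum>i\<le>r. N i)"
    define y where "y = x [^]\<^bsub>R\<^esub> M"
    have y: "y \<in> carrier R" using xR by (simp add: y_def)
    have "\<forall>z\<in>cocycles C \<delta> i. y \<odot>\<^bsub>C i\<^esub> z \<in> coboundaries C \<delta> i" for i
    proof (cases "i \<le> r")
      case True
      then have "N i \<le> M" unfolding M_def by (intro member_le_sum) auto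
      then have "y = x [^]\<^bsub>R\<^esub> (M - N i) \<otimes>\<^bsub>R\<^esub> x [^]\<^bsub>R\<^esub> N i" using xR by (simp add: y_def R.nat_pow_mult)
      moreover have "x [^]\<^bsub>R\<^esub> (M - N i) \<in> carrier R" "x [^]\<^bsub>R\<^esub> N i \<in> carrier R" using xR by auto
      ultimately show ?thesis
        using N[of i] module.smult_assoc1[OF Cm] module.submoduleE(4)[OF Cm coboundaries_submodule(1)[OF C]]
        by (simp add: cocycles_iff)
    next
      case False
      then have "z \<in> coboundaries C \<delta> i" if "z \<in> cocycles C \<delta> i" for z
        using that bounded[of i] module.submodule_zero[OF Cm coboundaries_submodule(1)[OF C]] by (auto simp: cocycles_iff)
      then show ?thesis using y module.submoduleE(4)[OF Cm coboundaries_submodule(1)[OF C]] by blast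
    qed
    then have k: "\<And>p c. c \<in> carrier (direct_sum (B' (Suc p)) ?S) \<Longrightarrow> act ?S (D' (Suc p)) c = (\<lambda>_. \<zero>\<^bsub>R\<^esub>) \<Longrightarrow>
        \<exists>a\<in>carrier (direct_sum (B' p) ?S). y \<odot>\<^bsub>direct_sum (B' (Suc p)) ?S\<^esub> c = act ?S (D' p) a"
      using kills[OF y] by blast
    obtain m h where "\<And>p. homotopy_at R (B' p) (B' (Suc p)) (B' (Suc (Suc p))) (D' p) (D' (Suc p)) (y [^]\<^bsub>R\<^esub> (m::nat)) (h p) (h (Suc p))"
      using R.null_homotopic_power[of B' D', OF D' DD empty y k] by blast
    moreover have "y [^]\<^bsub>R\<^esub> m = x [^]\<^bsub>R\<^esub> (M * m)" using xR by (simp add: y_def R.nat_pow_pow)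
    ultimately show ?thesis by metis
  qed

  define T where "T = (\<lambda>p q. direct_sum (B' p) (E q))"
  have Tm: "module R (T p q)" for p q unfolding T_def by (rule module.direct_sum_module[OF Em])
  define \<Gamma> where "\<Gamma> = (\<lambda>q. torsion_submodule R ?I (E q))"
  have \<Gamma>: "submodule (\<Gamma> q) R (E q)" for q
    unfolding \<Gamma>_def by (rule module.torsion_submodule_submodule[OF Em I])
  note \<Gamma>E = module.submoduleE[OF Em \<Gamma>] module.submodule_zero[OF Em \<Gamma>]
  define T\<Gamma> where "T\<Gamma> = (\<lambda>p q. {y \<in> carrier (T p q). \<forall>b. y b \<in> \<Gamma> q})"
  have dE0: "dE q \<zero>\<^bsub>E q\<^esub> = \<zero>\<^bsub>E (Suc q)\<^esub>" for q by (rule linear_hom_zero[OF Em Em dE])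
  have dE\<Gamma>: "dE q e \<in> \<Gamma> (Suc q)" if "e \<in> \<Gamma> q" for q e
    using torsion_submodule_map[OF Em Em dE I] that by (simp add: \<Gamma>_def)
  have \<Gamma>C: "cochain_complex R (\<lambda>p. (E p)\<lparr>carrier := \<Gamma> p\<rparr>) dE"
    unfolding \<Gamma>_def by (rule torsion_complex[OF E I])
  have ann: "c \<odot>\<^bsub>E q\<^esub> e \<in> coboundaries (\<lambda>p. (E p)\<lparr>carrier := \<Gamma> p\<rparr>) dE q"
    if "c \<in> A q" "e \<in> \<Gamma> q" "dE q e = \<zero>\<^bsub>E (Suc q)\<^esub>" for c q e
  proof -
    have "c \<in> annihilator R (cohomology (\<lambda>p. (E p)\<lparr>carrier := \<Gamma> p\<rparr>) dE q)"
      using A(2)[of q] that(1) by (auto simp: local_cohomology_def \<Gamma>_def)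
    then show ?thesis using that unfolding annihilator_cohomology_iff[OF \<Gamma>C] by (auto simp: cocycles_iff)
  qed
  have Ac: "c \<in> A q \<Longrightarrow> c \<in> carrier R" for c q using ideal.Icarr[OF A(1)] .
  have dvT: "dE q \<circ> y \<in> carrier (T p (Suc q))" if "y \<in> carrier (T p q)" for p q y
    using linear_homD(1)[OF direct_sum_map[OF Em Em dE] that[unfolded T_def]] by (simp add: T_def)
  interpret TD: torsion_double_complex R T "\<lambda>p q. act (E q) (D' p)" "\<lambda>p q. (\<circ>) (dE q)" T\<Gamma> A
  proof (intro torsion_double_complex.intro torsion_double_complex_axioms.intro)
    show "cring R" by fact
    show "module R (T p q)" for p q by (rule Tm)
    show "act (E q) (D' p) \<in> linear_hom R (T p q) (T (Suc p) q)" for p q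
      unfolding T_def by (rule module.act_linear_hom[OF Em D'])
    show "(\<circ>) (dE q) \<in> linear_hom R (T p q) (T p (Suc q))" for p q
      unfolding T_def by (rule direct_sum_map[OF Em Em dE])
    show "act (E q) (D' (Suc p)) (act (E q) (D' p) y) = \<zero>\<^bsub>T (Suc (Suc p)) q\<^esub>"
      if y: "y \<in> carrier (T p q)" for p q y
    proof -
      have y': "y \<in> carrier (direct_sum (B' p) (E q))" using y by (simp add: T_def)
      have "act (E q) (D' (Suc p)) (act (E q) (D' p) y) = act (E q) (\<lambda>b. act ?S (D' (Suc p)) (D' p b)) y"
        by (rule module.act_act[OF Em D' D' y'])
      also have "\<dots> = act (E q) (\<lambda>_ _. \<zero>\<^bsub>R\<^esub>) y"
        by (rule module.act_cong[OF Em y' module.column_finite_comp[OF Em D' D']]) (use DD in auto)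
      also have "\<dots> = \<zero>\<^bsub>T (Suc (Suc p)) q\<^esub>" unfolding T_def by (rule module.act_zero_matrix[OF Em y'])
      finally show ?thesis .
    qed
    show "dE (Suc q) \<circ> (dE q \<circ> y) = \<zero>\<^bsub>T p (Suc (Suc q))\<^esub>" if y: "y \<in> carrier (T p q)" for p q y
      using y ddE by (auto simp: T_def direct_sum_carrier fun_eq_iff)
    show "dE q \<circ> act (E q) (D' p) y = act (E (Suc q)) (D' p) (dE q \<circ> y)" if y: "y \<in> carrier (T p q)" for p q y
      using act_natural[OF Em Em dE D'] y by (simp add: T_def)
    show "carrier (T 0 q) = {\<zero>\<^bsub>T 0 q\<^esub>}" for q
      using module.submodule_zero[OF Em \<Gamma>[of q]] \<Gamma>E(1)[of q] by (auto simp: T_def B'0 direct_sum_carrier fun_eq_iff)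
    show "submodule (T\<Gamma> p q) R (T p q)" for p q
    proof -
      interpret T: module R "T p q" by (rule Tm)
      show ?thesis
      proof (rule T.submodule_of_closed)
        show "\<zero>\<^bsub>T p q\<^esub> \<in> T\<Gamma> p q" using T.M.zero_closed \<Gamma>E(7) by (simp add: T\<Gamma>_def T_def)
        show "x \<oplus>\<^bsub>T p q\<^esub> y \<in> T\<Gamma> p q" if "x \<in> T\<Gamma> p q" "y \<in> T\<Gamma> p q" for x y
          using that T.M.a_closed[of x y] \<Gamma>E(5) by (simp add: T\<Gamma>_def T_def)
        show "a \<odot>\<^bsub>T p q\<^esub> x \<in> T\<Gamma> p q" if "a \<in> carrier R" "x \<in> T\<Gamma> p q" for a x
          using that T.smult_closed[of a x] \<Gamma>E(4) by (simp add: T\<Gamma>_def T_def)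
      qed (simp add: T\<Gamma>_def)
    qed
    show "act (E q) (D' p) y \<in> T\<Gamma> (Suc p) q" if "y \<in> T\<Gamma> p q" for p q y
      using that module.act_closed[OF Em D'] module.act_submodule[OF Em \<Gamma> D'] by (simp add: T\<Gamma>_def T_def)
    show "dE q \<circ> y \<in> T\<Gamma> p (Suc q)" if "y \<in> T\<Gamma> p q" for p q y
      using that dvT dE\<Gamma> by (simp add: T\<Gamma>_def)
    show "\<exists>w\<in>carrier (T p q). y \<ominus>\<^bsub>T (Suc p) q\<^esub> act (E q) (D' p) w \<in> T\<Gamma> (Suc p) q"
      if y: "y \<in> carrier (T (Suc p) q)" "act (E q) (D' (Suc p)) y \<in> T\<Gamma> (Suc (Suc p)) q" for p q y
    proof -
      have "\<exists>w\<in>carrier (direct_sum (B' p) (E q)). \<forall>b. (y \<ominus>\<^bsub>direct_sum (B' (Suc p)) (E q)\<^esub> act (E q) (D' p) w) b \<in> \<Gamma> q"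
      proof (rule row_exact_mod_torsion[OF noeth inj D' D' X homotopic \<Gamma>])
        show "f e \<in> \<Gamma> q" if "f \<in> linear_hom R (E q) (E q)" "e \<in> \<Gamma> q" for f e
          using torsion_submodule_map[OF Em Em that(1) I] that(2) by (simp add: \<Gamma>_def)
        show "e \<in> \<Gamma> q" if "e \<in> carrier (E q)" "\<And>x. x \<in> X \<Longrightarrow> \<exists>t::nat. x [^]\<^bsub>R\<^esub> t \<odot>\<^bsub>E q\<^esub> e = \<zero>\<^bsub>E q\<^esub>" for e
          unfolding \<Gamma>_def by (rule module.torsion_of_generators[OF Em X that])
      qed (use y in \<open>auto simp: T_def T\<Gamma>_def\<close>)
      then obtain w where w: "w \<in> carrier (T p q)" "\<And>b. (y \<ominus>\<^bsub>T (Suc p) q\<^esub> act (E q) (D' p) w) b \<in> \<Gamma> q"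
        by (auto simp: T_def)
      interpret T: module R "T (Suc p) q" by (rule Tm)
      have "act (E q) (D' p) w \<in> carrier (T (Suc p) q)" using module.act_closed[OF Em D'] w(1)
        by (simp add: T_def)
      then show ?thesis using w y(1) T.M.minus_closed by (auto simp: T\<Gamma>_def)
    qed
    show "y \<in> (\<circ>) (dE q) ` carrier (T p q)"
      if y: "y \<in> carrier (T p (Suc q))" "dE (Suc q) \<circ> y = \<zero>\<^bsub>T p (Suc (Suc q))\<^esub>" for p q y
    proof -
      have "y b \<in> dE q ` carrier (E q)" for b
      proof -
        have "y b \<in> cocycles E dE (Suc q)"
          using y by (auto simp: T_def direct_sum_carrier cocycles_iff fun_eq_iff)
        then show ?thesis using E_exact by (simp add: coboundaries_def)
      qed
      moreover have "\<zero>\<^bsub>E q\<^esub> \<in> carrier (E q)" using \<Gamma>E(1,7)[of q] by auto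
      ultimately obtain u where "u \<in> carrier (direct_sum (B' p) (E q))" "y = dE q \<circ> u"
        using direct_sum_preimage[where f = "dE q"
          and M = "E q", OF y(1)[unfolded T_def] order_refl _ dE0] by blast
      then have "u \<in> carrier (T p q)" "y = dE q \<circ> u" by (simp_all add: T_def)
      then show ?thesis by blast
    qed
    show "ideal (A q) R" for q by (rule A)
    show "c \<odot>\<^bsub>T p 0\<^esub> g = \<zero>\<^bsub>T p 0\<^esub>"
      if "c \<in> A 0" "g \<in> T\<Gamma> p 0" "dE 0 \<circ> g = \<zero>\<^bsub>T p (Suc 0)\<^esub>" for p c g
      using that ann[of c 0] by (auto simp: T_def T\<Gamma>_def fun_eq_iff coboundaries_def)
    show "c \<odot>\<^bsub>T p (Suc q)\<^esub> g \<in> (\<circ>) (dE q) ` T\<Gamma> p q"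
      if c: "c \<in> A (Suc q)" and g: "g \<in> T\<Gamma> p (Suc q)" "dE (Suc q) \<circ> g = \<zero>\<^bsub>T p (Suc (Suc q))\<^esub>" for p q c g
    proof -
      let ?y = "c \<odot>\<^bsub>T p (Suc q)\<^esub> g"
      have yT: "?y \<in> carrier (direct_sum (B' p) (E (Suc q)))"
        using module.smult_closed[OF Tm Ac[OF c]] g(1) by (auto simp: T\<Gamma>_def T_def)
      have "?y b \<in> dE q ` \<Gamma> q" for b
        using ann[OF c, of "g b"] g by (auto simp: T_def T\<Gamma>_def fun_eq_iff coboundaries_def)
      then obtain u where "u \<in> carrier (direct_sum (B' p) (E q))" "\<And>b. u b \<in> \<Gamma> q" "?y = dE q \<circ> u"
        using direct_sum_preimage[where f = "dE q", OF yT \<Gamma>E(1)[of q] \<Gamma>E(7) dE0] by blast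
      then show ?thesis by (auto simp: T_def T\<Gamma>_def)
    qed
  qed

  show ?thesis
  proof
    fix c assume c: "c \<in> ideal_prod_from R A i 0"
    have cR: "c \<in> carrier R" using ideal.Icarr[OF R.ideal_prod_from_ideal[OF A(1)] c] .
    have "c \<odot>\<^bsub>C i\<^esub> z \<in> coboundaries C \<delta> i" if z: "z \<in> cocycles C \<delta> i" for z
    proof -
      have zC: "z \<in> carrier (C i)" using z by (simp add: cocycles_iff)
      define u where "u = coord i z"
      have u: "u \<in> carrier (F (B i))" "z = lin_comb R (C i) u" using coord[OF zC] by (auto simp: u_def)
      have u': "u \<in> carrier (direct_sum (B' (Suc i)) ?S)" using u(1) by (simp add: F_def B'S)
      have uR: "u b \<in> carrier R" for b using u(1) by (simp add: F_def direct_sum_carrier)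
      have Du: "act ?S (D' (Suc i)) u = (\<lambda>_. \<zero>\<^bsub>R\<^esub>)" using cocycle_iff[OF u(1)] z u(2) D'S by simp
      note \<epsilon>0 = linear_hom_zero[OF S.module_axioms Em \<epsilon>]
      have T1: "\<epsilon> \<circ> u \<in> carrier (T (Suc i) 0)"
        unfolding T_def by (rule linear_homD(1)[OF direct_sum_map[OF S.module_axioms Em \<epsilon>] u'])
      have \<epsilon>cyc: "dE 0 (\<epsilon> a) = \<zero>\<^bsub>E (Suc 0)\<^esub>" if "a \<in> carrier R" for a
        using \<epsilon>_img that by (auto simp: cocycles_iff)
      have T2: "dE 0 \<circ> (\<epsilon> \<circ> u) = \<zero>\<^bsub>T (Suc i) (Suc 0)\<^esub>"
        using \<epsilon>cyc uR by (auto simp: T_def fun_eq_iff)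
      have "act (E 0) (D' (Suc i)) (\<epsilon> \<circ> u) = \<epsilon> \<circ> act ?S (D' (Suc i)) u"
        by (rule act_natural[OF S.module_axioms Em \<epsilon> D' u'])
      also have "\<dots> = \<zero>\<^bsub>T (Suc (Suc i)) 0\<^esub>" using Du \<epsilon>0 by (auto simp: T_def fun_eq_iff)
      finally have T3: "act (E 0) (D' (Suc i)) (\<epsilon> \<circ> u) \<in> T\<Gamma> (Suc (Suc i)) 0"
        using module.submodule_zero[OF Tm TD.\<Gamma>_submodule] by simp
      have "c \<in> TD.lifting_multipliers i 0 (\<epsilon> \<circ> u)" using TD.ideal_prod_from_lifts[OF T1 T2 T3] c by blast
      then obtain w where w: "w \<in> carrier (T i 0)" "dE 0 \<circ> w = \<zero>\<^bsub>T i (Suc 0)\<^esub>"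
        and cw: "c \<odot>\<^bsub>T (Suc i) 0\<^esub> (\<epsilon> \<circ> u) = act (E 0) (D' i) w \<oplus>\<^bsub>T (Suc i) 0\<^esub> \<zero>\<^bsub>T (Suc i) 0\<^esub>"
        by (auto simp: TD.lifting_multipliers_def TD.coboundary_def)
      interpret T0: module R "T (Suc i) 0" by (rule Tm)
      have actw: "act (E 0) (D' i) w \<in> carrier (T (Suc i) 0)"
        using module.act_closed[OF Em D'] w(1) by (simp add: T_def)
      have "w b \<in> \<epsilon> ` carrier R" for b
        using w unfolding \<epsilon>_img by (auto simp: cocycles_iff T_def direct_sum_carrier fun_eq_iff)
      then have "w b \<in> \<epsilon> ` carrier ?S" for b by simp
      then obtain v where v: "v \<in> carrier (direct_sum (B' i) ?S)" "w = \<epsilon> \<circ> v"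
        using direct_sum_preimage[where f = \<epsilon>, OF w(1)[unfolded T_def] order_refl S.M.zero_closed \<epsilon>0] by blast
      have "\<epsilon> (c \<otimes>\<^bsub>R\<^esub> u b) = \<epsilon> (act ?S (D' i) v b)" for b
      proof -
        have "\<epsilon> (c \<otimes>\<^bsub>R\<^esub> u b) = c \<odot>\<^bsub>E 0\<^esub> \<epsilon> (u b)" using linear_homD(3)[OF \<epsilon> cR, of "u b"] uR by simp
        also have "\<dots> = act (E 0) (D' i) w b" using cw T0.M.r_zero[OF actw] by (simp add: T_def fun_eq_iff)
        also have "act (E 0) (D' i) w = \<epsilon> \<circ> act ?S (D' i) v"
          unfolding v(2) by (rule act_natural[OF S.module_axioms Em \<epsilon> D' v(1)])
        finally show ?thesis by simp
      qed
      moreover have "c \<otimes>\<^bsub>R\<^esub> u b \<in> carrier R" "act ?S (D' i) v b \<in> carrier R" for b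
        using cR uR S.act_value_closed[OF D' v(1)] by auto
      ultimately have eq: "(\<lambda>b. c \<otimes>\<^bsub>R\<^esub> u b) = act ?S (D' i) v" using \<epsilon>_inj by (auto simp: inj_on_def fun_eq_iff)
      have cz: "c \<odot>\<^bsub>C i\<^esub> z = lin_comb R (C i) (act ?S (D' i) v)"
        unfolding eq[symmetric] u(2) using comb_smult[OF u(1) cR] by simp
      show ?thesis
      proof (cases i)
        case 0
        then have "v = (\<lambda>_. \<zero>\<^bsub>R\<^esub>)" using v(1) B'0 by (auto simp: direct_sum_carrier fun_eq_iff)
        then have "act ?S (D' i) v = (\<lambda>_. \<zero>\<^bsub>R\<^esub>)" by (simp add: act_def fun_eq_iff)
        then show ?thesis using cz comb_zero 0 by (simp add: coboundaries_def)
      next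
        case (Suc k)
        then have vk: "v \<in> carrier (F (B k))" using v(1) by (simp add: F_def B'S)
        have "c \<odot>\<^bsub>C i\<^esub> z = \<delta> k (lin_comb R (C k) v)" using cz \<delta>_comb[OF vk] Suc D'S by simp
        then show ?thesis using comb_closed[OF vk] Suc by (auto simp: coboundaries_def)
      qed
    qed
    then show "c \<in> annihilator R (cohomology C \<delta> i)"
      unfolding annihilator_cohomology_iff[OF C] using cR by blast
  qed
qed

section \<open>Subrings and Noetherian rings\<close>

text \<open>
  Subsets of a commutative ring given as a type class become rings in the sense of locales; the ring of
  invariants is of this form.
\<close>

definition ring_on :: "'a::comm_ring_1 set \<Rightarrow> 'a ring" where
  "ring_on A = \<lparr>carrier = A, mult = (*), one = 1, zero = 0, add = (+)\<rparr>"

lemma ring_on_simps [simp]: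
  "carrier (ring_on A) = A" "x \<otimes>\<^bsub>ring_on A\<^esub> y = x * y" "\<one>\<^bsub>ring_on A\<^esub> = 1"
  "\<zero>\<^bsub>ring_on A\<^esub> = 0" "x \<oplus>\<^bsub>ring_on A\<^esub> y = x + y"
  by (simp_all add: ring_on_def)

definition subring_closed :: "'a::comm_ring_1 set \<Rightarrow> bool" where
  "subring_closed A \<longleftrightarrow> 1 \<in> A \<and> (\<forall>x\<in>A. \<forall>y\<in>A. x - y \<in> A \<and> x * y \<in> A)"

lemma subring_closedD:
  assumes "subring_closed A"
  shows "1 \<in> A" "0 \<in> A" "x \<in> A \<Longrightarrow> - x \<in> A" "x \<in> A \<Longrightarrow> y \<in> A \<Longrightarrow> x + y \<in> A"
    "x \<in> A \<Longrightarrow> y \<in> A \<Longrightarrow> x - y \<in> A" "x \<in> A \<Longrightarrow> y \<in> A \<Longrightarrow> x * y \<in> A" "x \<in> A \<Longrightarrow> x ^ n \<in> A"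
proof -
  note * = assms[unfolded subring_closed_def]
  show 1: "1 \<in> A" using * by blast
  then have "1 - 1 \<in> A" using * by blast
  then show 0: "0 \<in> A" by simp
  have neg: "- x \<in> A" if "x \<in> A" for x using *[THEN conjunct2, rule_format, OF 0 that] by simp
  then show "x \<in> A \<Longrightarrow> - x \<in> A" .
  show "x + y \<in> A" if "x \<in> A" "y \<in> A"
    using *[THEN conjunct2, rule_format, OF that(1) neg[OF that(2)]] by simp
  show "x \<in> A \<Longrightarrow> y \<in> A \<Longrightarrow> x - y \<in> A" and mult: "x \<in> A \<Longrightarrow> y \<in> A \<Longrightarrow> x * y \<in> A" using * by blast+
  show "x \<in> A \<Longrightarrow> x ^ n \<in> A" using * 1 by (induction n) auto
qed

lemma subring_closed_sum:
  assumes "subring_closed A" "\<And>i. i \<in> I \<Longrightarrow> f i \<in> A" shows "sum f I \<in> A"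
  using assms(2) by (induction I rule: infinite_finite_induct) (auto intro: subring_closedD[OF assms(1)])

lemma ring_on_cring: assumes "subring_closed A" shows "cring (ring_on A)"
proof (rule cringI)
  note A = subring_closedD[OF assms]
  show "abelian_group (ring_on A)"
  proof (rule abelian_groupI)
    fix x assume "x \<in> carrier (ring_on A)"
    then show "\<exists>y\<in>carrier (ring_on A). y \<oplus>\<^bsub>ring_on A\<^esub> x = \<zero>\<^bsub>ring_on A\<^esub>"
      using A(3)[of x] by (auto intro!: bexI[of _ "- x"])
  qed (use A in \<open>auto simp: algebra_simps\<close>)
  show "comm_monoid (ring_on A)"
    by (rule comm_monoidI) (use A in \<open>auto simp: algebra_simps\<close>)
qed (auto simp: algebra_simps)

lemma ideal_ring_on_iff:
  assumes "subring_closed A"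
  shows "ideal I (ring_on A) \<longleftrightarrow> I \<subseteq> A \<and> 0 \<in> I \<and> (\<forall>x\<in>I. \<forall>y\<in>I. x + y \<in> I) \<and> (\<forall>a\<in>A. \<forall>x\<in>I. a * x \<in> I)"
proof
  interpret R: cring "ring_on A" by (rule ring_on_cring[OF assms])
  assume I: "ideal I (ring_on A)"
  interpret I: ideal I "ring_on A" by fact
  show "I \<subseteq> A \<and> 0 \<in> I \<and> (\<forall>x\<in>I. \<forall>y\<in>I. x + y \<in> I) \<and> (\<forall>a\<in>A. \<forall>x\<in>I. a * x \<in> I)"
    using I.Icarr I.zero_closed I.a_closed I.I_l_closed by auto
next
  interpret R: cring "ring_on A" by (rule ring_on_cring[OF assms])
  assume "I \<subseteq> A \<and> 0 \<in> I \<and> (\<forall>x\<in>I. \<forall>y\<in>I. x + y \<in> I) \<and> (\<forall>a\<in>A. \<forall>x\<in>I. a * x \<in> I)"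
  then show "ideal I (ring_on A)" by (intro R.ideal_of_closed) auto
qed

lemma ideal_ring_onD:
  assumes "subring_closed A" "ideal I (ring_on A)"
  shows "I \<subseteq> A" "0 \<in> I" "x \<in> I \<Longrightarrow> y \<in> I \<Longrightarrow> x + y \<in> I" "a \<in> A \<Longrightarrow> x \<in> I \<Longrightarrow> a * x \<in> I"
    "x \<in> I \<Longrightarrow> y \<in> I \<Longrightarrow> x - y \<in> I"
proof -
  note * = ideal_ring_on_iff[OF assms(1), THEN iffD1, OF assms(2)]
  show "I \<subseteq> A" "0 \<in> I" "x \<in> I \<Longrightarrow> y \<in> I \<Longrightarrow> x + y \<in> I" "a \<in> A \<Longrightarrow> x \<in> I \<Longrightarrow> a * x \<in> I"
    using * by auto
  have "- 1 \<in> A" using subring_closedD[OF assms(1)] by blast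
  then have "x + (- 1) * y \<in> I" if "x \<in> I" "y \<in> I" using * that by blast
  then show "x \<in> I \<Longrightarrow> y \<in> I \<Longrightarrow> x - y \<in> I" by simp
qed

lemma noetherian_field:
  assumes A: "subring_closed A" and inv: "\<And>x. x \<in> A \<Longrightarrow> x \<noteq> 0 \<Longrightarrow> \<exists>y\<in>A. y * x = 1"
  shows "noetherian_ring (ring_on A)"
proof -
  interpret R: cring "ring_on A" by (rule ring_on_cring[OF A])
  show ?thesis
  proof (rule R.noetherian_ringI)
    fix I assume I: "ideal I (ring_on A)"
    note I' = ideal_ring_onD[OF A I]
    show "\<exists>S\<subseteq>carrier (ring_on A). finite S \<and> I = genideal (ring_on A) S"
    proof (cases "I = {0}")
      case True
      have "genideal (ring_on A) {} \<subseteq> I" by (rule R.genideal_minimal[OF I]) simp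
      moreover have "0 \<in> genideal (ring_on A) {}"
        using ideal_ring_onD(2)[OF A R.genideal_ideal[of "{}"]] by simp
      ultimately show ?thesis using True by (intro exI[of _ "{}"]) auto
    next
      case False
      then obtain x where x: "x \<in> I" "x \<noteq> 0" using I'(2) by auto
      then obtain y where "y \<in> A" "y * x = 1" using inv I'(1) by blast
      then have one: "1 \<in> I" using I'(4) x by metis
      have "genideal (ring_on A) {1} \<subseteq> I" by (rule R.genideal_minimal[OF I]) (use one in simp)
      moreover have "I \<subseteq> genideal (ring_on A) {1}"
      proof
        have g: "ideal (genideal (ring_on A) {1}) (ring_on A)" "1 \<in> genideal (ring_on A) {1}"
          using R.genideal_ideal[of "{1}"] R.genideal_self[of "{1}"] subring_closedD(1)[OF A] by auto
        fix z assume "z \<in> I"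
        then have "z * 1 \<in> genideal (ring_on A) {1}" using ideal_ring_onD(4)[OF A g(1)] g(2) I'(1) by blast
        then show "z \<in> genideal (ring_on A) {1}" by simp
      qed
      ultimately show ?thesis using subring_closedD(1)[OF A] by (intro exI[of _ "{1}"]) auto
    qed
  qed
qed

section \<open>The basis theorem\<close>

definition adjoin :: "'a::comm_ring_1 set \<Rightarrow> 'a \<Rightarrow> 'a set" where
  "adjoin A x = {poly p x | p. \<forall>i. Polynomial.coeff p i \<in> A}"

lemma adjoin_subring:
  assumes A: "subring_closed A"
  shows "subring_closed (adjoin A x)" "A \<subseteq> adjoin A x" "x \<in> adjoin A x"
proof -
  note A' = subring_closedD[OF A]
  have coeff: "poly p x \<in> adjoin A x" if "\<And>i. Polynomial.coeff p i \<in> A" for p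
    using that by (auto simp: adjoin_def)
  show "A \<subseteq> adjoin A x"
  proof
    fix a assume "a \<in> A"
    then have "poly [:a:] x \<in> adjoin A x" using A' by (intro coeff) (simp add: coeff_pCons split: nat.split)
    then show "a \<in> adjoin A x" by simp
  qed
  then have "1 \<in> adjoin A x" using A' by auto
  moreover have "u - v \<in> adjoin A x \<and> u * v \<in> adjoin A x" if uv: "u \<in> adjoin A x" "v \<in> adjoin A x" for u v
  proof -
    obtain p where p: "u = poly p x" "\<And>i. Polynomial.coeff p i \<in> A"
      using uv(1) unfolding adjoin_def by blast
    obtain q where q: "v = poly q x" "\<And>i. Polynomial.coeff q i \<in> A"
      using uv(2) unfolding adjoin_def by blast
    have "poly (p - q) x \<in> adjoin A x" using p q A' by (intro coeff) simp
    moreover have "poly (p * q) x \<in> adjoin A x"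
      using p q A' by (intro coeff) (auto simp: coeff_mult intro!: subring_closed_sum[OF A])
    ultimately show ?thesis using p q by simp
  qed
  ultimately show "subring_closed (adjoin A x)" by (auto simp: subring_closed_def)
  have "poly [:0, 1:] x \<in> adjoin A x" using A' by (intro coeff) (auto simp: coeff_pCons split: nat.split)
  then show "x \<in> adjoin A x" by simp
qed

lemma adjoin_minimal:
  assumes "subring_closed S" "A \<subseteq> S" "x \<in> S" shows "adjoin A x \<subseteq> S"
proof
  fix u assume "u \<in> adjoin A x"
  then obtain p where p: "u = poly p x" "\<And>i. Polynomial.coeff p i \<in> A" unfolding adjoin_def by blast
  have "Polynomial.coeff p i \<in> S" for i using p(2) assms(2) by blast
  then show "u \<in> S" unfolding p(1) poly_altdef
    using assms(3) subring_closedD(6,7)[OF assms(1)] by (intro subring_closed_sum[OF assms(1)]) auto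
qed

text \<open>
  An ideal of \<open>A[x]\<close> is described by polynomials over \<open>A\<close>, without regard to relations that \<open>x\<close> satisfies.  The
  ideals of leading coefficients become stationary.  Finitely many polynomials whose leading coefficients
  generate these ideals up to that point suffice: subtraction of a combination of them lowers the degree.
\<close>

theorem hilbert_basis:
  assumes A: "subring_closed A" and noeth: "noetherian_ring (ring_on A)"
  shows "noetherian_ring (ring_on (adjoin A x))"
proof -
  interpret R: cring "ring_on A" by (rule ring_on_cring[OF A])
  interpret N: noetherian_ring "ring_on A" by fact
  let ?B = "adjoin A x"
  have B: "subring_closed ?B" by (rule adjoin_subring(1)[OF A])
  interpret RB: cring "ring_on ?B" by (rule ring_on_cring[OF B])
  note A' = subring_closedD[OF A]
  show ?thesis
  proof (rule RB.noetherian_ringI)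
    fix I assume I: "ideal I (ring_on ?B)"
    note I' = ideal_ring_onD[OF B I]
    let ?in = "\<lambda>p. \<forall>i. Polynomial.coeff p i \<in> A"
    have inB: "?in p \<Longrightarrow> poly p x \<in> ?B" for p by (auto simp: adjoin_def)
    \<comment> \<open>\<open>L J n\<close> is the ideal of the coefficients at \<open>X\<^sup>n\<close> of the polynomials of degree at most \<open>n\<close> with value in \<open>J\<close>.\<close>
    define L where "L = (\<lambda>J n. {a. \<exists>p. ?in p \<and> poly p x \<in> J \<and> Polynomial.degree p \<le> n \<and> Polynomial.coeff p n = a})"
    have L_ideal: "ideal (L J n) (ring_on A)" if J: "ideal J (ring_on ?B)" for J n
    proof -
      note J' = ideal_ring_onD[OF B J]
      show ?thesis unfolding ideal_ring_on_iff[OF A]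
      proof (intro conjI ballI)
        show "L J n \<subseteq> A" by (auto simp: L_def)
        show "0 \<in> L J n" unfolding L_def using J'(2) A' by (intro CollectI exI[of _ 0]) simp
        fix a b assume "a \<in> L J n" "b \<in> L J n"
        then obtain p q where "?in p" "poly p x \<in> J" "Polynomial.degree p \<le> n" "Polynomial.coeff p n = a"
          "?in q" "poly q x \<in> J" "Polynomial.degree q \<le> n" "Polynomial.coeff q n = b" by (auto simp: L_def)
        then show "a + b \<in> L J n" unfolding L_def
          using J'(3) A' by (intro CollectI exI[of _ "p + q"]) (auto intro: degree_add_le)
      next
        fix c a assume c: "c \<in> A" and "a \<in> L J n"
        then obtain p where p: "?in p" "poly p x \<in> J" "Polynomial.degree p \<le> n" "Polynomial.coeff p n = a"
          by (auto simp: L_def)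
        have "c \<in> ?B" using c adjoin_subring(2)[OF A] by blast
        then have "poly (Polynomial.smult c p) x \<in> J" using J'(4) p by simp
        then show "c * a \<in> L J n" unfolding L_def
          using p c A' degree_smult_le[of c p] by (intro CollectI exI[of _ "Polynomial.smult c p"]) auto
      qed
    qed
    have shift: "a \<in> L J (n + k)" if J: "ideal J (ring_on ?B)" and a: "a \<in> L J n" for J a n k
    proof -
      note J' = ideal_ring_onD[OF B J]
      obtain p where p: "?in p" "poly p x \<in> J" "Polynomial.degree p \<le> n" "Polynomial.coeff p n = a"
        using a by (auto simp: L_def)
      let ?q = "Polynomial.monom 1 k * p"
      have "x ^ k \<in> ?B" using subring_closedD(7)[OF B adjoin_subring(3)[OF A]] .
      then have "poly ?q x \<in> J" using J'(4) p(2) by (simp add: poly_monom)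
      moreover have "?in ?q" using p(1) A' by (auto simp: coeff_monom_mult)
      moreover have "Polynomial.degree ?q \<le> n + k"
        using degree_mult_le[of "Polynomial.monom 1 k" p] degree_monom_le[of "1::'a" k] p(3) by linarith
      moreover have "Polynomial.coeff ?q (n + k) = a" using p(4) by (simp add: coeff_monom_mult)
      ultimately show ?thesis unfolding L_def by blast
    qed
    have L_mono: "L I m \<subseteq> L I n" if "m \<le> n" for m n
      using shift[OF I, of _ m "n - m"] that by auto
    have "\<Union>(range (L I)) \<in> range (L I)"
    proof (rule N.ideal_chain_is_trivial)
      show "subset.chain {J. ideal J (ring_on A)} (range (L I))"
        unfolding subset_chain_def using L_ideal[OF I] L_mono nat_le_linear by (auto simp del: subset_iff) blast
    qed simp
    then obtain n0 where n0: "\<Union>(range (L I)) = L I n0" by auto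
    have "\<exists>G. G \<subseteq> A \<and> finite G \<and> L I n = genideal (ring_on A) G" for n
      using N.finetely_gen[OF L_ideal[OF I]] by auto
    then obtain G where G: "\<And>n. G n \<subseteq> A" "\<And>n. finite (G n)" "\<And>n. L I n = genideal (ring_on A) (G n)" by metis
    have GL: "G n \<subseteq> L I n" for n using R.genideal_self[of "G n"] G by simp
    define w where "w = (\<lambda>n a. SOME p. ?in p \<and> poly p x \<in> I \<and> Polynomial.degree p \<le> n \<and> Polynomial.coeff p n = a)"
    have w: "?in (w n a) \<and> poly (w n a) x \<in> I \<and> Polynomial.degree (w n a) \<le> n \<and> Polynomial.coeff (w n a) n = a"
      if "a \<in> G n" for n a
    proof -
      have "a \<in> L I n" using GL that by blast
      then show ?thesis unfolding w_def L_def mem_Collect_eq by (rule someI_ex)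
    qed
    define W where "W = (\<Union>n\<le>n0. (\<lambda>a. poly (w n a) x) ` G n)"
    have W: "finite W" "W \<subseteq> I" "W \<subseteq> ?B" using G(2) w I'(1) by (auto simp: W_def)
    define J where "J = genideal (ring_on ?B) W"
    have J: "ideal J (ring_on ?B)" unfolding J_def using W by (intro RB.genideal_ideal) simp
    note J' = ideal_ring_onD[OF B J]
    have WJ: "W \<subseteq> J" unfolding J_def using W by (intro RB.genideal_self) simp
    have JI: "J \<subseteq> I" unfolding J_def by (rule RB.genideal_minimal[OF I W(2)])
    have LJ: "L I n \<subseteq> L J n" for n
    proof -
      have low: "L I m \<subseteq> L J m" if "m \<le> n0" for m
      proof -
        have "G m \<subseteq> L J m"
        proof
          fix a assume a: "a \<in> G m"
          then have "poly (w m a) x \<in> J" using WJ that by (auto simp: W_def)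
          then show "a \<in> L J m" using w[OF a] unfolding L_def by blast
        qed
        then show ?thesis unfolding G(3) by (rule R.genideal_minimal[OF L_ideal[OF J]])
      qed
      show ?thesis
      proof (cases "n \<le> n0")
        case False
        have "L I n \<subseteq> L I n0" using n0 by auto
        also have "\<dots> \<subseteq> L J n0" by (rule low) simp
        also have "\<dots> \<subseteq> L J n" using shift[OF J, of _ n0 "n - n0"] False by auto
        finally show ?thesis .
      qed (rule low)
    qed
    have main: "poly p x \<in> J" if "?in p" "poly p x \<in> I" "Polynomial.degree p \<le> n" for p n
      using that
    proof (induction n arbitrary: p)
      case 0
      then have "Polynomial.coeff p 0 \<in> L I 0" unfolding L_def by blast
      then obtain q where q: "poly q x \<in> J" "Polynomial.degree q \<le> 0" "Polynomial.coeff q 0 = Polynomial.coeff p 0" using LJ unfolding L_def by blast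
      have "p = q" by (rule poly_eqI) (use q 0 in \<open>metis coeff_eq_0 le_zero_eq neq0_conv\<close>)
      then show ?case using q by simp
    next
      case (Suc n)
      then have "Polynomial.coeff p (Suc n) \<in> L I (Suc n)" unfolding L_def by blast
      then obtain q where q: "?in q" "poly q x \<in> J" "Polynomial.degree q \<le> Suc n" "Polynomial.coeff q (Suc n) = Polynomial.coeff p (Suc n)"
        using LJ unfolding L_def by blast
      have "Polynomial.coeff (p - q) i = 0" if "i > n" for i
        using that q Suc.prems(3) by (cases "i = Suc n") (auto simp: coeff_eq_0)
      then have deg: "Polynomial.degree (p - q) \<le> n" by (intro degree_le) auto
      have "poly (p - q) x \<in> J"
        using q Suc.prems JI A' I'(5) by (intro Suc.IH deg) auto
      then have "poly (p - q) x + poly q x \<in> J" using J'(3) q by blast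
      then show ?case by simp
    qed
    have "I \<subseteq> J"
    proof
      fix u assume u: "u \<in> I"
      then obtain p where "u = poly p x" "?in p" using I'(1) by (auto simp: adjoin_def)
      then show "u \<in> J" using main[of p "Polynomial.degree p"] u by simp
    qed
    then have "I = genideal (ring_on ?B) W" using JI by (auto simp: J_def)
    then show "\<exists>S\<subseteq>carrier (ring_on ?B). finite S \<and> I = genideal (ring_on ?B) S" using W by auto
  qed
qed

text \<open>
  The last clause says that \<open>D\<close> is the subring generated by \<open>A\<close> and \<open>X\<close>.
\<close>

lemma finitely_generated_noetherian_subring:
  assumes "subring_closed A" "noetherian_ring (ring_on A)" "finite X"
  shows "\<exists>D. subring_closed D \<and> noetherian_ring (ring_on D) \<and> A \<subseteq> D \<and> X \<subseteq> D \<and>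
     (\<forall>S. subring_closed S \<longrightarrow> A \<subseteq> S \<longrightarrow> X \<subseteq> S \<longrightarrow> D \<subseteq> S)"
  using assms(3)
proof (induction X rule: finite_induct)
  case empty then show ?case using assms by auto
next
  case (insert x X)
  then obtain D where D: "subring_closed D" "noetherian_ring (ring_on D)" "A \<subseteq> D" "X \<subseteq> D"
    "\<forall>S. subring_closed S \<longrightarrow> A \<subseteq> S \<longrightarrow> X \<subseteq> S \<longrightarrow> D \<subseteq> S" by blast
  show ?case
  proof (intro exI[of _ "adjoin D x"] conjI)
    show "\<forall>S. subring_closed S \<longrightarrow> A \<subseteq> S \<longrightarrow> insert x X \<subseteq> S \<longrightarrow> adjoin D x \<subseteq> S"
      using D(5) adjoin_minimal by (metis insert_subset)
  qed (use D adjoin_subring[OF D(1), of x] hilbert_basis[OF D(1,2), of x] in auto)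
qed

section \<open>Intermediate rings of module-finite extensions\<close>

definition ambient_module :: "('a::comm_ring_1, 'a) module" where
  "ambient_module = \<lparr>carrier = UNIV, mult = (*), one = 1, zero = 0, add = (+), smult = (*)\<rparr>"

lemma ambient_module_simps [simp]:
  "carrier ambient_module = UNIV" "\<zero>\<^bsub>ambient_module\<^esub> = 0" "x \<oplus>\<^bsub>ambient_module\<^esub> y = x + y"
  "r \<odot>\<^bsub>ambient_module\<^esub> x = r * x"
  by (simp_all add: ambient_module_def)

lemma ambient_module_module: assumes "subring_closed A" shows "module (ring_on A) ambient_module"
proof (rule moduleI)
  show "abelian_group (ambient_module :: ('a, 'a) module)"
  proof (rule abelian_groupI)
    fix x :: 'a show "\<exists>y\<in>carrier ambient_module. y \<oplus>\<^bsub>ambient_module\<^esub> x = \<zero>\<^bsub>ambient_module\<^esub>"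
      by (auto intro!: exI[of _ "- x"])
  qed (auto simp: algebra_simps)
qed (use ring_on_cring[OF assms] in \<open>auto simp: algebra_simps\<close>)

text \<open>
  Ideals of \<open>S\<close> are \<open>D\<close>-submodules of the ambient ring, which is a finitely generated module over \<open>D\<close>.
\<close>

lemma noetherian_intermediate_ring:
  assumes D: "subring_closed D" "noetherian_ring (ring_on D)" and S: "subring_closed S" "D \<subseteq> S"
    and fin: "lin_span (ring_on D) ambient_module es = UNIV"
  shows "noetherian_ring (ring_on S)"
proof -
  interpret M: module "ring_on D" ambient_module by (rule ambient_module_module[OF D(1)])
  interpret RS: cring "ring_on S" by (rule ring_on_cring[OF S(1)])
  have sub: "submodule I (ring_on D) ambient_module" if I: "ideal I (ring_on S)" for I
    using ideal_ring_onD[OF S(1) I] S(2) by (intro M.submodule_of_closed) auto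
  show ?thesis
  proof (rule RS.noetherian_ringI)
    fix I assume I: "ideal I (ring_on S)"
    obtain fs where fs: "set fs \<subseteq> I" "I = lin_span (ring_on D) ambient_module fs"
      using M.noetherian_submodule_finitely_generated[OF D(2) _ sub[OF I], of es] fin by auto
    have fsS: "set fs \<subseteq> carrier (ring_on S)" using fs(1) ideal_ring_onD(1)[OF S(1) I] by auto
    have "genideal (ring_on S) (set fs) \<subseteq> I" by (rule RS.genideal_minimal[OF I fs(1)])
    moreover have "lin_span (ring_on D) ambient_module fs \<subseteq> genideal (ring_on S) (set fs)"
      by (rule M.lin_span_subset[OF sub[OF RS.genideal_ideal[OF fsS]] RS.genideal_self[OF fsS]])
    ultimately show "\<exists>X\<subseteq>carrier (ring_on S). finite X \<and> I = genideal (ring_on S) X"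
      using fs(2) fsS by (intro exI[of _ "set fs"]) auto
  qed
qed

lemma invariant_ring_eq: "invariant_ring G = ring_on {f. \<forall>g\<in>G. GL_action g f = f}"
  by (simp add: invariant_ring_def ring_on_def)

section \<open>Substitution in polynomials\<close>

abbreviation const :: "'k \<Rightarrow> ('n::finite, 'k::comm_ring_1) mpoly" where
  "const c \<equiv> Poly_Mapping.single 0 c"

abbreviation var :: "'n \<Rightarrow> ('n::finite, 'k::comm_ring_1) mpoly" where
  "var i \<equiv> Poly_Mapping.single (Poly_Mapping.single i 1) 1"

lemma poly_mapping_sum_singles:
  fixes f :: "'a \<Rightarrow>\<^sub>0 'b::comm_monoid_add"
  shows "(\<Sum>m\<in>Poly_Mapping.keys f. Poly_Mapping.single m (Poly_Mapping.lookup f m)) = f"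
proof (rule poly_mapping_eqI)
  fix k
  have "Poly_Mapping.lookup (\<Sum>m\<in>Poly_Mapping.keys f. Poly_Mapping.single m (Poly_Mapping.lookup f m)) k =
      (\<Sum>m\<in>Poly_Mapping.keys f. if m = k then Poly_Mapping.lookup f m else 0)"
    by (simp add: lookup_sum lookup_single when_def)
  also have "\<dots> = Poly_Mapping.lookup f k" by (simp add: not_in_keys_iff_lookup_eq_zero)
  finally show "Poly_Mapping.lookup (\<Sum>m\<in>Poly_Mapping.keys f. Poly_Mapping.single m (Poly_Mapping.lookup f m)) k = Poly_Mapping.lookup f k" .
qed

definition monomial_value :: "('n \<Rightarrow> 'a) \<Rightarrow> ('n::finite \<Rightarrow>\<^sub>0 nat) \<Rightarrow> 'a::comm_ring_1" where
  "monomial_value \<sigma> m = (\<Prod>i\<in>UNIV. \<sigma> i ^ Poly_Mapping.lookup m i)"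

lemma monomial_value_add: "monomial_value \<sigma> (m + m') = monomial_value \<sigma> m * monomial_value \<sigma> m'"
  by (simp add: monomial_value_def lookup_add power_add prod.distrib)

lemma monomial_value_0: "monomial_value \<sigma> 0 = 1"
  by (simp add: monomial_value_def)

lemma monomial_value_single: "monomial_value \<sigma> (Poly_Mapping.single i 1) = \<sigma> i"
proof -
  have "monomial_value \<sigma> (Poly_Mapping.single i 1) = (\<Prod>j\<in>UNIV. if j = i then \<sigma> j else 1)"
    unfolding monomial_value_def by (rule prod.cong) (auto simp: lookup_single when_def)
  then show ?thesis by simp
qed

lemma mpoly_subst_superset:
  assumes "finite U" "Poly_Mapping.keys f \<subseteq> U"
  shows "mpoly_subst \<sigma> f = (\<Sum>m\<in>U. const (Poly_Mapping.lookup f m) * monomial_value \<sigma> m)"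
  unfolding mpoly_subst_def monomial_value_def
  by (rule sum.mono_neutral_left) (use assms in \<open>auto simp: in_keys_iff\<close>)

lemma mpoly_subst_add: "mpoly_subst \<sigma> (f + g) = mpoly_subst \<sigma> f + mpoly_subst \<sigma> g"
proof -
  let ?U = "Poly_Mapping.keys f \<union> Poly_Mapping.keys g"
  have "Poly_Mapping.keys (f + g) \<subseteq> ?U" by (rule keys_add)
  then show ?thesis
    by (simp add: mpoly_subst_superset[of ?U] lookup_add single_add distrib_right sum.distrib)
qed

lemma mpoly_subst_single: "mpoly_subst \<sigma> (Poly_Mapping.single m c) = const c * monomial_value \<sigma> m"
  by (subst mpoly_subst_superset[of "{m}"]) auto

lemma mpoly_subst_zero: "mpoly_subst \<sigma> 0 = 0"
  by (simp add: mpoly_subst_def)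

lemma mpoly_subst_sum: "mpoly_subst \<sigma> (sum f I) = (\<Sum>i\<in>I. mpoly_subst \<sigma> (f i))"
  by (induction I rule: infinite_finite_induct) (auto simp: mpoly_subst_zero mpoly_subst_add)

lemma mpoly_subst_mult: "mpoly_subst \<sigma> (f * g) = mpoly_subst \<sigma> f * mpoly_subst \<sigma> g"
proof -
  let ?s = "\<lambda>f m. Poly_Mapping.single m (Poly_Mapping.lookup f m)"
  have "f * g = (\<Sum>m\<in>Poly_Mapping.keys f. ?s f m) * (\<Sum>m\<in>Poly_Mapping.keys g. ?s g m)"
    by (simp only: poly_mapping_sum_singles)
  also have "\<dots> = (\<Sum>m\<in>Poly_Mapping.keys f. \<Sum>m'\<in>Poly_Mapping.keys g. ?s f m * ?s g m')"
    by (rule sum_product)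
  finally have "mpoly_subst \<sigma> (f * g) = (\<Sum>m\<in>Poly_Mapping.keys f. \<Sum>m'\<in>Poly_Mapping.keys g. mpoly_subst \<sigma> (?s f m * ?s g m'))"
    by (simp only: mpoly_subst_sum)
  also have "\<dots> = (\<Sum>m\<in>Poly_Mapping.keys f. \<Sum>m'\<in>Poly_Mapping.keys g. mpoly_subst \<sigma> (?s f m) * mpoly_subst \<sigma> (?s g m'))"
  proof (intro sum.cong refl)
    fix m m'
    have "const (a * b) = const a * (const b :: ('a, 'b) mpoly)" for a b by (simp add: mult_single)
    then show "mpoly_subst \<sigma> (?s f m * ?s g m') = mpoly_subst \<sigma> (?s f m) * mpoly_subst \<sigma> (?s g m')"
      by (simp add: mult_single mpoly_subst_single monomial_value_add mult_ac)
  qed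
  also have "\<dots> = mpoly_subst \<sigma> (\<Sum>m\<in>Poly_Mapping.keys f. ?s f m) * mpoly_subst \<sigma> (\<Sum>m\<in>Poly_Mapping.keys g. ?s g m)"
    by (simp only: mpoly_subst_sum sum_product)
  finally show ?thesis by (simp only: poly_mapping_sum_singles)
qed

lemma mpoly_subst_const: "mpoly_subst \<sigma> (const c) = const c"
  by (simp add: mpoly_subst_single monomial_value_0)

lemma mpoly_subst_one: "mpoly_subst \<sigma> 1 = 1"
  using mpoly_subst_const[of \<sigma> 1] by simp

lemma mpoly_subst_uminus: "mpoly_subst \<sigma> (- f) = - mpoly_subst \<sigma> f"
  using mpoly_subst_add[of \<sigma> f "- f"] by (simp add: mpoly_subst_zero eq_neg_iff_add_eq_0 add.commute)

lemma mpoly_subst_diff: "mpoly_subst \<sigma> (f - g) = mpoly_subst \<sigma> f - mpoly_subst \<sigma> g"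
  using mpoly_subst_add[of \<sigma> f "- g"] by (simp add: mpoly_subst_uminus)

lemma invariants_subring: "subring_closed {f. \<forall>g\<in>G. GL_action g f = f}"
  by (auto simp: subring_closed_def GL_action_def mpoly_subst_one mpoly_subst_diff mpoly_subst_mult)

section \<open>The grading of the ring of invariants\<close>

lemma homogeneous_zero: "homogeneous n 0" by (simp add: homogeneous_def)

lemma homogeneous_add: "homogeneous n f \<Longrightarrow> homogeneous n g \<Longrightarrow> homogeneous n (f + g)"
  using keys_add[of f g] by (auto simp: homogeneous_def)

lemma homogeneous_sum: "(\<And>i. i \<in> I \<Longrightarrow> homogeneous n (f i)) \<Longrightarrow> homogeneous n (sum f I)"
  by (induction I rule: infinite_finite_induct) (auto simp: homogeneous_zero homogeneous_add)

lemma homogeneous_mult: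
  assumes "homogeneous m f" "homogeneous n g" shows "homogeneous (m + n) (f * g)"
  unfolding homogeneous_def
proof
  fix k assume "k \<in> Poly_Mapping.keys (f * g)"
  then obtain a b where "a \<in> Poly_Mapping.keys f" "b \<in> Poly_Mapping.keys g" "k = a + b"
    using keys_mult[of f g] by auto
  then show "(\<Sum>i\<in>UNIV. Poly_Mapping.lookup k i) = m + n"
    using assms by (simp add: homogeneous_def lookup_add sum.distrib)
qed

lemma homogeneous_const: "homogeneous 0 (const c)"
  by (auto simp: homogeneous_def)

lemma homogeneous_one: "homogeneous 0 1"
  by (auto simp: homogeneous_def)

lemma homogeneous_power: "homogeneous n f \<Longrightarrow> homogeneous (k * n) (f ^ k)"
proof (induction k)
  case 0 show ?case by (simp add: homogeneous_one)
next
  case (Suc k) then show ?case using homogeneous_mult[of n f "k * n" "f ^ k"] by simp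
qed

lemma homogeneous_prod:
  "(\<And>i. i \<in> I \<Longrightarrow> homogeneous (d i) (f i)) \<Longrightarrow> homogeneous (sum d I) (prod f I)"
proof (induction I rule: infinite_finite_induct)
  case (insert x F)
  then show ?case using homogeneous_mult[of "d x" "f x" "sum d F" "prod f F"] by simp
qed (auto simp: homogeneous_one)

lemma homogeneous_single: "homogeneous (\<Sum>i\<in>UNIV. Poly_Mapping.lookup m i) (Poly_Mapping.single m c)"
  by (auto simp: homogeneous_def)

lemma linear_form_homogeneous: "homogeneous 1 (linear_form c)"
  unfolding linear_form_def
proof (rule homogeneous_sum)
  fix i :: 'a
  have "(\<Sum>j\<in>UNIV. Poly_Mapping.lookup (Poly_Mapping.single i (1::nat)) j) = 1"
    by (simp add: lookup_single when_def)
  then show "homogeneous 1 (Poly_Mapping.single (Poly_Mapping.single i 1) (c $ i))"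
    using homogeneous_single[of "Poly_Mapping.single i 1" "c $ i"] by simp
qed

lemma mpoly_subst_homogeneous:
  assumes "\<And>i. homogeneous 1 (\<sigma> i)" "homogeneous n f" shows "homogeneous n (mpoly_subst \<sigma> f)"
  unfolding mpoly_subst_def
proof (rule homogeneous_sum)
  fix m assume m: "m \<in> Poly_Mapping.keys f"
  have "homogeneous (\<Sum>i\<in>UNIV. Poly_Mapping.lookup m i * 1) (\<Prod>i\<in>UNIV. \<sigma> i ^ Poly_Mapping.lookup m i)"
    by (rule homogeneous_prod) (rule homogeneous_power[OF assms(1)])
  then have "homogeneous (0 + n) (const (Poly_Mapping.lookup f m) * (\<Prod>i\<in>UNIV. \<sigma> i ^ Poly_Mapping.lookup m i))"
    using assms(2) m by (intro homogeneous_mult homogeneous_const) (simp add: homogeneous_def)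
  then show "homogeneous n (const (Poly_Mapping.lookup f m) * (\<Prod>i\<in>UNIV. \<sigma> i ^ Poly_Mapping.lookup m i))" by simp
qed

definition component :: "nat \<Rightarrow> ('n::finite, 'k::comm_ring_1) mpoly \<Rightarrow> ('n, 'k) mpoly" where
  "component n f = (\<Sum>m\<in>{m \<in> Poly_Mapping.keys f. (\<Sum>i\<in>UNIV. Poly_Mapping.lookup m i) = n}.
     Poly_Mapping.single m (Poly_Mapping.lookup f m))"

lemma component_homogeneous: "homogeneous n (component n f)"
  unfolding component_def by (rule homogeneous_sum) (use homogeneous_single in auto)

lemma lookup_component:
  "Poly_Mapping.lookup (component n f) m = (if (\<Sum>i\<in>UNIV. Poly_Mapping.lookup m i) = n then Poly_Mapping.lookup f m else 0)"
proof -
  let ?K = "{m \<in> Poly_Mapping.keys f. (\<Sum>i\<in>UNIV. Poly_Mapping.lookup m i) = n}"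
  have "Poly_Mapping.lookup (component n f) m = (\<Sum>k\<in>?K. if k = m then Poly_Mapping.lookup f k else 0)"
    by (simp add: component_def lookup_sum lookup_single when_def)
  also have "\<dots> = (if m \<in> ?K then Poly_Mapping.lookup f m else 0)" by simp
  finally show ?thesis by (auto simp: not_in_keys_iff_lookup_eq_zero)
qed

lemma sum_components:
  obtains N where "f = (\<Sum>n\<le>N. component n f)"
proof -
  define N where "N = Max (insert 0 ((\<lambda>m. \<Sum>i\<in>UNIV. Poly_Mapping.lookup m i) ` Poly_Mapping.keys f))"
  have le: "(\<Sum>i\<in>UNIV. Poly_Mapping.lookup m i) \<le> N" if "m \<in> Poly_Mapping.keys f" for m
    unfolding N_def using that by (intro Max_ge) auto
  have "f = (\<Sum>n\<le>N. component n f)"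
  proof (rule poly_mapping_eqI)
    fix m
    show "Poly_Mapping.lookup f m = Poly_Mapping.lookup (\<Sum>n\<le>N. component n f) m"
      using le[of m] by (cases "m \<in> Poly_Mapping.keys f")
        (auto simp: lookup_sum lookup_component not_in_keys_iff_lookup_eq_zero)
  qed
  then show ?thesis by (rule that)
qed

lemma lookup_homogeneous:
  "homogeneous n f \<Longrightarrow> (\<Sum>i\<in>UNIV. Poly_Mapping.lookup m i) \<noteq> n \<Longrightarrow> Poly_Mapping.lookup f m = 0"
  by (auto simp: homogeneous_def in_keys_iff)

text \<open>
  A linear substitution preserves degrees, so the image of the decomposition of \<open>f\<close> into components is the
  decomposition of the image of \<open>f\<close>.
\<close>

lemma GL_action_component:
  fixes g :: "'k::field ^ 'n::finite ^ 'n"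
  shows "GL_action g (component n f) = component n (GL_action g f)"
proof (rule poly_mapping_eqI)
  fix m :: "'n \<Rightarrow>\<^sub>0 nat"
  let ?d = "\<Sum>i\<in>UNIV. Poly_Mapping.lookup m i"
  have hom: "homogeneous k (GL_action g (component k f))" for k
    unfolding GL_action_def by (rule mpoly_subst_homogeneous[OF linear_form_homogeneous component_homogeneous])
  obtain N where N: "f = (\<Sum>k\<le>N. component k f)" by (rule sum_components)
  have "GL_action g f = (\<Sum>k\<le>N. GL_action g (component k f))"
    unfolding GL_action_def by (subst N) (rule mpoly_subst_sum)
  then have L: "Poly_Mapping.lookup (GL_action g f) m = (\<Sum>k\<le>N. Poly_Mapping.lookup (GL_action g (component k f)) m)"
    by (simp add: lookup_sum)
  have zero: "component k f = 0" if "k > N" for k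
  proof (rule poly_mapping_eqI)
    fix m
    have "Poly_Mapping.lookup f m = (\<Sum>k\<le>N. Poly_Mapping.lookup (component k f) m)"
      by (subst N) (rule lookup_sum)
    then show "Poly_Mapping.lookup (component k f) m = Poly_Mapping.lookup 0 m"
      using that by (auto simp: lookup_component split: if_splits)
  qed
  have "(\<Sum>k\<le>N. Poly_Mapping.lookup (GL_action g (component k f)) m) =
      (\<Sum>k\<le>N. if k = ?d then Poly_Mapping.lookup (GL_action g (component ?d f)) m else 0)"
    using lookup_homogeneous[OF hom] by (intro sum.cong) auto
  also have "\<dots> = Poly_Mapping.lookup (GL_action g (component ?d f)) m"
    using zero[of ?d] by (auto simp: GL_action_def mpoly_subst_zero)
  finally have "Poly_Mapping.lookup (GL_action g f) m = Poly_Mapping.lookup (GL_action g (component ?d f)) m"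
    using L by simp
  then show "Poly_Mapping.lookup (GL_action g (component n f)) m = Poly_Mapping.lookup (component n (GL_action g f)) m"
    using lookup_homogeneous[OF hom, of m n] by (auto simp: lookup_component)
qed

lemma invariant_ring_graded_induct:
  assumes f: "f \<in> carrier (invariant_ring G)"
    and "P 0" and "\<And>n s. s \<in> invariant_degree G n \<Longrightarrow> P s"
    and add: "\<And>s t. s \<in> carrier (invariant_ring G) \<Longrightarrow> t \<in> carrier (invariant_ring G) \<Longrightarrow> P s \<Longrightarrow> P t \<Longrightarrow> P (s + t)"
  shows "P f"
proof -
  have c: "component n f \<in> invariant_degree G n" for n
    using f GL_action_component[of _ n f] component_homogeneous[of n f]
    by (simp add: invariant_degree_def invariant_ring_def)
  then have cS: "component n f \<in> carrier (invariant_ring G)" for n by (simp add: invariant_degree_def)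
  have "(\<Sum>n\<in>I. component n f) \<in> carrier (invariant_ring G) \<and> P (\<Sum>n\<in>I. component n f)" if "finite I" for I
    using that
  proof (induction I rule: finite_induct)
    case empty
    have "0 \<in> carrier (invariant_ring G)"
      unfolding invariant_ring_eq using subring_closedD(2)[OF invariants_subring[of G]] by simp
    then show ?case using assms(2) by simp
  next
    case (insert n I)
    have "component n f + (\<Sum>n\<in>I. component n f) \<in> carrier (invariant_ring G)"
      using insert cS[of n] subring_closedD(4)[OF invariants_subring[of G]] unfolding invariant_ring_eq by simp
    then show ?case using insert add[OF cS _ assms(3)[OF c]] by simp
  qed
  moreover obtain N where "f = (\<Sum>n\<le>N. component n f)" by (rule sum_components)
  ultimately show ?thesis by (metis finite_atMost)
qed

section \<open>Invariance of the product of all linear forms\<close>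

lemma GL_action_linear_form:
  fixes g :: "'k::field ^ 'n::finite ^ 'n"
  shows "GL_action g (linear_form c) = linear_form (c v* matrix_inv g)"
proof -
  let ?B = "matrix_inv g"
  have "GL_action g (linear_form c) = (\<Sum>i\<in>UNIV. const (c $ i) * linear_form (?B $ i))"
    unfolding GL_action_def linear_form_def[of c] mpoly_subst_sum
    by (intro sum.cong refl) (simp only: mpoly_subst_single monomial_value_single)
  also have "\<dots> = (\<Sum>i\<in>UNIV. \<Sum>j\<in>UNIV. Poly_Mapping.single (Poly_Mapping.single j 1) (c $ i * ?B $ i $ j))"
    by (simp add: linear_form_def sum_distrib_left mult_single)
  also have "\<dots> = (\<Sum>j\<in>UNIV. \<Sum>i\<in>UNIV. Poly_Mapping.single (Poly_Mapping.single j 1) (c $ i * ?B $ i $ j))"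
    by (rule sum.swap)
  also have "\<dots> = linear_form (c v* ?B)"
  proof -
    have s: "Poly_Mapping.single m (sum a I) = (\<Sum>i\<in>I. Poly_Mapping.single m (a i))" for m :: "'n \<Rightarrow>\<^sub>0 nat"
      and a :: "'n \<Rightarrow> 'k" and I
      by (induction I rule: infinite_finite_induct) (auto simp: single_add)
    show ?thesis unfolding linear_form_def vector_matrix_mult_def
      by (simp add: s mult.commute)
  qed
  finally show ?thesis .
qed

lemma map_poly_mult_hom:
  fixes h :: "'a::comm_ring_1 \<Rightarrow> 'b::comm_ring_1"
  assumes "h 0 = 0" "\<And>x y. h (x + y) = h x + h y" "\<And>x y. h (x * y) = h x * h y"
  shows "map_poly h (p * q) = map_poly h p * map_poly h q"
proof (rule poly_eqI)
  fix n
  have sum: "h (sum f I) = (\<Sum>i\<in>I. h (f i))" for f :: "nat \<Rightarrow> 'a" and I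
    by (induction I rule: infinite_finite_induct) (auto simp: assms)
  show "Polynomial.coeff (map_poly h (p * q)) n = Polynomial.coeff (map_poly h p * map_poly h q) n"
    by (simp add: coeff_map_poly assms coeff_mult sum)
qed

definition form_product :: "('n::finite, 'k::{field,finite}) mpoly poly" where
  "form_product = (\<Prod>v\<in>range (linear_form :: 'k ^ 'n \<Rightarrow> ('n, 'k) mpoly). [:v, 1:])"

text \<open>
  A linear substitution permutes the finite set of linear forms, hence the factors of the product.
\<close>

lemma GL_action_form_product:
  fixes g :: "'k::{field,finite} ^ 'n::finite ^ 'n"
  assumes "invertible g"
  shows "GL_action g (Polynomial.coeff form_product i) = Polynomial.coeff form_product i"
proof -
  let ?h = "GL_action g"
  let ?L = "range (linear_form :: 'k ^ 'n \<Rightarrow> ('n, 'k) mpoly)"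
  have h: "?h 0 = 0" "?h 1 = 1" "\<And>x y. ?h (x + y) = ?h x + ?h y" "\<And>x y. ?h (x * y) = ?h x * ?h y"
    by (auto simp: GL_action_def mpoly_subst_zero mpoly_subst_one mpoly_subst_add mpoly_subst_mult)
  have fin: "finite ?L" by simp
  have inv: "g ** matrix_inv g = mat 1" "matrix_inv g ** g = mat 1"
    using someI_ex[OF assms[unfolded invertible_def]] by (simp_all add: matrix_inv_def)
  have "?L \<subseteq> ?h ` ?L"
  proof
    fix v assume "v \<in> ?L"
    then obtain c where c: "v = linear_form c" by auto
    have "?h (linear_form (c v* g)) = linear_form (c v* (g ** matrix_inv g))"
      unfolding GL_action_linear_form by (simp add: vector_matrix_mul_assoc)
    then show "v \<in> ?h ` ?L" using c inv by (metis imageI rangeI vector_matrix_mul_rid)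
  qed
  moreover have "?h ` ?L \<subseteq> ?L" by (auto simp: GL_action_linear_form)
  ultimately have img: "?h ` ?L = ?L" by blast
  then have inj: "inj_on ?h ?L" using fin by (simp add: finite_surj_inj eq_card_imp_inj_on)
  have "map_poly ?h (\<Prod>v\<in>I. [:v, 1:]) = (\<Prod>v\<in>I. [:?h v, 1:])" for I
  proof (induction I rule: infinite_finite_induct)
    case (insert v I)
    have "map_poly ?h [:v, 1:] = [:?h v, 1:]" by (simp add: map_poly_pCons h)
    then show ?case using insert by (simp add: map_poly_mult_hom h del: mult_pCons_left)
  qed (auto simp: h one_pCons map_poly_pCons simp flip: one_pCons)
  then have "map_poly ?h form_product = (\<Prod>v\<in>?L. [:?h v, 1:])" by (simp add: form_product_def)
  also have "\<dots> = (\<Prod>v\<in>?h ` ?L. [:v, 1:])" by (simp add: prod.reindex[OF inj])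
  also have "\<dots> = form_product" unfolding img form_product_def ..
  finally have "Polynomial.coeff (map_poly ?h form_product) i = Polynomial.coeff form_product i" by simp
  then show ?thesis by (simp add: coeff_map_poly h)
qed

lemma form_product_monic: "lead_coeff (form_product :: ('n::finite, 'k::{field,finite}) mpoly poly) = 1"
proof -
  have "lead_coeff (\<Prod>v\<in>I. [:v, 1:] :: ('n, 'k) mpoly poly) = 1" for I
  proof (induction I rule: infinite_finite_induct)
    case (insert v I)
    let ?p = "[:v, 1:]" and ?q = "\<Prod>v\<in>I. [:v, 1:] :: ('n, 'k) mpoly poly"
    have top: "Polynomial.coeff (?p * ?q) (Polynomial.degree ?p + Polynomial.degree ?q) = 1"
      unfolding coeff_mult_degree_sum using insert by simp
    then have "Polynomial.degree ?p + Polynomial.degree ?q \<le> Polynomial.degree (?p * ?q)"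
      by (intro le_degree) simp
    then have "Polynomial.degree (?p * ?q) = Polynomial.degree ?p + Polynomial.degree ?q"
      using degree_mult_le[of ?p ?q] by simp
    then have "lead_coeff (?p * ?q) = 1" using top by simp
    then show ?case unfolding prod.insert[OF insert(1,2)] .
  qed auto
  then show ?thesis by (simp add: form_product_def)
qed

text \<open>
  The negative of a variable is one of the linear forms.
\<close>

lemma form_product_root:
  "poly (form_product :: ('n::finite, 'k::{field,finite}) mpoly poly) (var i) = 0"
proof -
  have eq: "linear_form (- axis i 1) = - (var i :: ('n, 'k) mpoly)"
  proof -
    have "linear_form (- axis i 1) = (\<Sum>j\<in>UNIV. if j = i then - var i else (0 :: ('n, 'k) mpoly))"
      unfolding linear_form_def by (rule sum.cong) (auto simp: axis_def single_uminus)
    then show ?thesis by simp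
  qed
  have "poly form_product (var i) = (\<Prod>v\<in>range (linear_form :: 'k ^ 'n \<Rightarrow> ('n, 'k) mpoly). v + var i)"
    by (simp add: form_product_def poly_prod)
  also have "\<dots> = 0"
  proof (rule prod_zero)
    show "\<exists>v\<in>range (linear_form :: 'k ^ 'n \<Rightarrow> ('n, 'k) mpoly). v + var i = 0"
      using eq by (metis add.left_inverse rangeI)
  qed simp
  finally show ?thesis .
qed

section \<open>The ring of invariants is Noetherian\<close>

definition power_product :: "('n \<Rightarrow> nat) \<Rightarrow> ('n::finite, 'k::comm_ring_1) mpoly" where
  "power_product f = (\<Prod>i\<in>UNIV. var i ^ f i)"

lemma power_product_upd: "power_product (f(i := k)) = var i ^ k * power_product (f(i := 0))"
proof -
  have p: "power_product (f(i := l)) = var i ^ l * (\<Prod>j\<in>UNIV - {i}. var j ^ f j)" for l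
    unfolding power_product_def
    by (subst prod.remove[of UNIV i]) (auto intro!: arg_cong2[of _ _ _ _ "(*)"] prod.cong)
  show ?thesis unfolding p[of k] p[of 0] by simp
qed

text \<open>
  The monic polynomial \<open>P\<close>, of degree \<open>N\<close>, expresses \<open>x\<^sub>i\<^sup>N\<close> by lower powers of \<open>x\<^sub>i\<close>.  Therefore the span of the
  monomials with all exponents below \<open>N\<close> is stable under multiplication by the variables.
\<close>

lemma mpoly_finitely_generated:
  fixes D :: "('n::finite, 'k::comm_ring_1) mpoly set"
  assumes D: "subring_closed D" "range const \<subseteq> D"
    and P: "lead_coeff P = 1" "\<And>j. Polynomial.coeff P j \<in> D" "\<And>i. poly P (var i) = 0"
  shows "\<exists>es. lin_span (ring_on D) ambient_module es = UNIV"
proof -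
  interpret M: module "ring_on D" ambient_module by (rule ambient_module_module[OF D(1)])
  define N where "N = Polynomial.degree P"
  have "finite {f :: 'n \<Rightarrow> nat. \<forall>i. f i < N}"
  proof -
    have "{f :: 'n \<Rightarrow> nat. \<forall>i. f i < N} = (\<Pi>\<^sub>E i\<in>UNIV. {..<N})" by auto
    then show ?thesis by (simp add: finite_PiE)
  qed
  then obtain es where es: "set es = (power_product ` {f. \<forall>i. f i < N} :: ('n, 'k) mpoly set)"
    using finite_list[of "power_product ` {f. \<forall>i. f i < N}"] by blast
  let ?W = "lin_span (ring_on D) ambient_module es"
  have sub: "submodule ?W (ring_on D) ambient_module" by (rule M.submodule_lin_span) simp
  have zero: "0 \<in> ?W" using M.submodule_zero[OF sub] by simp
  have add: "u + v \<in> ?W" if "u \<in> ?W" "v \<in> ?W" for u v using M.submoduleE(5)[OF sub that] by simp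
  have smult: "r * v \<in> ?W" if "r \<in> D" "v \<in> ?W" for r v
    using M.submoduleE(4)[OF sub _ that(2), of r] that by simp
  have gen: "power_product f \<in> ?W" if "\<And>i. f i < N" for f
    by (rule M.lin_span_mem) (use that es in auto)
  have sumW: "sum v I \<in> ?W" if "\<And>i. i \<in> I \<Longrightarrow> v i \<in> ?W" for v and I :: "nat set"
    using that by (induction I rule: infinite_finite_induct) (auto simp: zero add)
  have N: "N > 0"
  proof (rule ccontr)
    assume "\<not> N > 0"
    then have deg: "Polynomial.degree P = 0" by (simp add: N_def)
    then obtain a where "P = [:a:]" by (rule degree_eq_zeroE)
    then show False using P(1) P(3) by simp
  qed
  have var_es: "var i * power_product f \<in> ?W" if f: "\<And>j. f j < N" for i f
  proof -
    have eq: "(var i :: ('n, 'k) mpoly) * power_product f = var i ^ Suc (f i) * power_product (f(i := 0))"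
    proof -
      have "power_product f = var i ^ f i * (power_product (f(i := 0)) :: ('n, 'k) mpoly)"
        using power_product_upd[of f i "f i"] by simp
      then show ?thesis unfolding power_Suc mult.assoc by (rule arg_cong)
    qed
    show ?thesis
    proof (cases "Suc (f i) < N")
      case True
      then have "power_product (f(i := Suc (f i))) \<in> ?W" using f by (intro gen) auto
      then show ?thesis unfolding eq power_product_upd[of f i "Suc (f i)"] .
    next
      case False
      then have Suc: "Suc (f i) = N" using f[of i] by simp
      have "0 = (\<Sum>l\<le>N. Polynomial.coeff P l * var i ^ l)" using P(3)[of i] by (simp add: poly_altdef N_def)
      also have "\<dots> = (\<Sum>l<N. Polynomial.coeff P l * var i ^ l) + var i ^ N"
        using P(1) by (simp add: lessThan_Suc_atMost[symmetric] N_def)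
      finally have "var i ^ N = (\<Sum>l<N. - Polynomial.coeff P l * var i ^ l)"
        by (simp add: sum_negf eq_neg_iff_add_eq_0 add.commute)
      then have "var i ^ N * power_product (f(i := 0)) = (\<Sum>l<N. - Polynomial.coeff P l * power_product (f(i := l)))"
        by (simp only: sum_distrib_right mult.assoc power_product_upd[of f i, symmetric])
      also have "\<dots> \<in> ?W"
      proof (intro sumW smult)
        fix l assume "l \<in> {..<N}"
        then show "power_product (f(i := l)) \<in> ?W" using f by (intro gen) auto
      qed (use P(2) subring_closedD(3)[OF D(1)] in auto)
      finally show ?thesis unfolding eq Suc .
    qed
  qed
  have "?W \<subseteq> {w. var i * w \<in> ?W}" for i
  proof (rule M.lin_span_subset)
    show "submodule {w. var i * w \<in> ?W} (ring_on D) ambient_module"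
      using zero add smult by (intro M.submodule_of_closed) (auto simp: distrib_left mult.left_commute)
  qed (use es var_es in auto)
  then have varW: "var i * w \<in> ?W" if "w \<in> ?W" for i w using that by blast
  have powW: "var i ^ k * w \<in> ?W" if "w \<in> ?W" for i k w
    using that by (induction k) (auto simp: mult.assoc varW simp del: One_nat_def)
  have "power_product (\<lambda>_. 0) \<in> ?W" using N by (intro gen) auto
  then have one: "1 \<in> ?W" by (simp add: power_product_def)
  have prodW: "(\<Prod>i\<in>I. var i ^ f i) \<in> ?W" if "finite I" for I :: "'n set" and f
    using that by (induction I rule: finite_induct) (auto simp: one powW simp del: One_nat_def)
  have "x \<in> ?W" for x :: "('n, 'k) mpoly"
  proof -
    have single: "Poly_Mapping.single m c = const c * (\<Prod>i\<in>UNIV. var i ^ Poly_Mapping.lookup m i)" for m :: "'n \<Rightarrow>\<^sub>0 nat" and c :: 'k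
    proof -
      have pw: "(var i :: ('n, 'k) mpoly) ^ k = Poly_Mapping.single (Poly_Mapping.single i k) 1" for i k
        by (induction k) (auto simp: mult_single simp flip: single_add)
      have "(\<Prod>i\<in>I. Poly_Mapping.single (h i) 1) = Poly_Mapping.single (\<Sum>i\<in>I. h i) (1::'k)" for I
        and h :: "'n \<Rightarrow> ('n \<Rightarrow>\<^sub>0 nat)"
        by (induction I rule: infinite_finite_induct) (auto simp: mult_single)
      moreover have "(\<Sum>i\<in>UNIV. Poly_Mapping.single i (Poly_Mapping.lookup m i)) = m"
        by (rule poly_mapping_eqI) (simp add: lookup_sum lookup_single when_def)
      ultimately show ?thesis by (simp add: pw mult_single del: One_nat_def)
    qed
    have "(\<Sum>m\<in>I. Poly_Mapping.single m (Poly_Mapping.lookup x m)) \<in> ?W" for I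
    proof (induction I rule: infinite_finite_induct)
      case (insert m I)
      have "Poly_Mapping.single m (Poly_Mapping.lookup x m) \<in> ?W"
        unfolding single[of m "Poly_Mapping.lookup x m"] using D(2) by (intro smult prodW) auto
      then show ?case using insert add by simp
    qed (auto simp: zero)
    from this[of "Poly_Mapping.keys x"] show ?thesis by (simp only: poly_mapping_sum_singles)
  qed
  then show ?thesis by blast
qed

text \<open>
  Let \<open>D\<close> be generated over the constants by the coefficients of the product of all \<open>X + v\<close>.  It is Noetherian by
  the basis theorem, is contained in the ring of invariants, and the polynomial ring is a finitely
  generated \<open>D\<close>-module.
\<close>

theorem invariant_ring_noetherian:
  fixes G :: "('k::{field,finite} ^ 'n::finite ^ 'n) set"
  assumes G: "\<And>g. g \<in> G \<Longrightarrow> invertible g"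
  shows "noetherian_ring (invariant_ring G)"
proof -
  let ?S = "{f :: ('n, 'k) mpoly. \<forall>g\<in>G. GL_action g f = f}"
  let ?P = "form_product :: ('n, 'k) mpoly poly"
  have S: "subring_closed ?S" by (rule invariants_subring)
  have K: "subring_closed (range const :: ('n, 'k) mpoly set)"
    unfolding subring_closed_def
  proof (intro conjI ballI)
    show "1 \<in> range (const :: 'k \<Rightarrow> ('n, 'k) mpoly)" by (metis single_one rangeI)
    fix x y assume "x \<in> range (const :: 'k \<Rightarrow> ('n, 'k) mpoly)" "y \<in> range (const :: 'k \<Rightarrow> ('n, 'k) mpoly)"
    then obtain a b where "x = const a" "y = const b" by auto
    then have "x - y = const (a - b)" "x * y = const (a * b)" by (simp_all add: single_diff mult_single)
    then show "x - y \<in> range const" "x * y \<in> range const" by auto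
  qed
  have KN: "noetherian_ring (ring_on (range const :: ('n, 'k) mpoly set))"
  proof (rule noetherian_field[OF K])
    fix x assume "x \<in> range (const :: 'k \<Rightarrow> ('n, 'k) mpoly)" "x \<noteq> 0"
    then obtain a where "x = const a" by auto
    then have "x = const a" "a \<noteq> 0" using \<open>x \<noteq> 0\<close> by auto
    then have "const (inverse a) * x = 1" by (simp add: mult_single)
    then show "\<exists>y\<in>range const. y * x = 1" by blast
  qed
  obtain D where D: "subring_closed D" "noetherian_ring (ring_on D)" "range const \<subseteq> D"
    "Polynomial.coeff ?P ` {..Polynomial.degree ?P} \<subseteq> D"
    and min: "\<forall>S. subring_closed S \<longrightarrow> range const \<subseteq> S \<longrightarrow> Polynomial.coeff ?P ` {..Polynomial.degree ?P} \<subseteq> S \<longrightarrow> D \<subseteq> S"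
    using finitely_generated_noetherian_subring[OF K KN, of "Polynomial.coeff ?P ` {..Polynomial.degree ?P}"] by blast
  have PD: "Polynomial.coeff ?P j \<in> D" for j
  proof (cases "j \<le> Polynomial.degree ?P")
    case False
    then show ?thesis using subring_closedD(2)[OF D(1)] by (simp add: coeff_eq_0)
  qed (use D(4) in auto)
  have DS: "D \<subseteq> ?S"
  proof (rule min[rule_format, OF S])
    show "range const \<subseteq> ?S" by (auto simp: GL_action_def mpoly_subst_const)
    show "Polynomial.coeff ?P ` {..Polynomial.degree ?P} \<subseteq> ?S"
      using G by (auto simp: GL_action_form_product)
  qed
  obtain es where "lin_span (ring_on D) ambient_module es = UNIV"
    using mpoly_finitely_generated[OF D(1,3) form_product_monic PD form_product_root] by blast
  then show ?thesis unfolding invariant_ring_eq by (rule noetherian_intermediate_ring[OF D(1,2) S DS])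
qed

lemma dickson_invariant:
  fixes G :: "('k::{field,finite} ^ 'n::finite ^ 'n) set"
  assumes G: "\<And>g. g \<in> G \<Longrightarrow> invertible g"
  shows "dickson i \<in> carrier (invariant_ring G)"
proof -
  let ?S = "{f :: ('n, 'k) mpoly. \<forall>g\<in>G. GL_action g f = f}"
  note S = subring_closedD[OF invariants_subring[of G]]
  have "Polynomial.coeff form_product j \<in> ?S" for j using G by (simp add: GL_action_form_product)
  moreover have "(- 1) ^ k \<in> ?S" for k using S(7)[OF S(3)[OF S(1)]] .
  ultimately have "dickson i \<in> ?S"
    unfolding dickson_def form_product_def[symmetric] using S(6) by blast
  then show ?thesis unfolding invariant_ring_eq by simp
qed

section \<open>The complex of free graded modules over the ring of invariants\<close>

lemma (in cring) finprod_ideals_eq: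
  assumes "\<And>k. ideal (A k) R"
  shows "finprod (ideals_set R) A {k..k + p} = ideal_prod_from R A p k"
proof (induction p arbitrary: k)
  interpret S: comm_monoid "ideals_set R" by (rule ideals_set_is_comm_monoid)
  have A: "A j \<in> carrier (ideals_set R)" for j using assms by (simp add: ideals_set_def)
  case 0
  show ?case using A[of k] by (simp add: S.finprod_insert)
next
  case (Suc p)
  interpret S: comm_monoid "ideals_set R" by (rule ideals_set_is_comm_monoid)
  have A: "A j \<in> carrier (ideals_set R)" for j using assms by (simp add: ideals_set_def)
  have "{k..k + Suc p} = insert k {Suc k..Suc k + p}" by auto
  then have "finprod (ideals_set R) A {k..k + Suc p} = A k \<otimes>\<^bsub>ideals_set R\<^esub> finprod (ideals_set R) A {Suc k..Suc k + p}"
    using A by (simp add: S.finprod_insert Pi_iff)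
  also have "\<dots> = A k \<cdot> ideal_prod_from R A p (Suc k)"
    unfolding Suc.IH by (simp add: ideals_set_def)
  finally show ?case by simp
qed

lemma (in graded) irrelevant_raises_degree:
  assumes ds_ideal: "\<And>r n y. r \<in> carrier R \<Longrightarrow> y \<in> ds {n..} \<Longrightarrow> r \<odot>\<^bsub>M\<^esub> y \<in> ds {n..}"
    and Rg: "\<And>n. Rg n \<subseteq> carrier R"
    and x: "x \<in> genideal R (\<Union>n\<in>{0<..}. Rg n)" and y: "y \<in> ds {n..}"
  shows "x \<odot>\<^bsub>M\<^esub> y \<in> ds {n + 1..}"
proof -
  let ?J = "{x \<in> carrier R. \<forall>n. \<forall>y\<in>ds {n..}. x \<odot>\<^bsub>M\<^esub> y \<in> ds {n + 1..}}"
  have dsM: "y \<in> ds K \<Longrightarrow> y \<in> carrier M" for y K using ds_carrier by auto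
  have "ideal ?J R"
  proof (rule R.ideal_of_closed)
    show "\<zero>\<^bsub>R\<^esub> \<in> ?J" using dsM ds_zero by auto
    show "a \<oplus>\<^bsub>R\<^esub> b \<in> ?J" if "a \<in> ?J" "b \<in> ?J" for a b
      using that dsM ds_add by (auto simp: smult_l_distr)
    show "a \<otimes>\<^bsub>R\<^esub> b \<in> ?J" if "a \<in> carrier R" "b \<in> ?J" for a b
      using that dsM ds_ideal by (auto simp: smult_assoc1)
  qed auto
  moreover have "(\<Union>n\<in>{0<..}. Rg n) \<subseteq> ?J"
  proof
    fix s assume "s \<in> (\<Union>n\<in>{0<..}. Rg n)"
    then obtain m where m: "m > 0" "s \<in> Rg m" by auto
    have "s \<odot>\<^bsub>M\<^esub> y \<in> ds {n + 1..}" if "y \<in> ds {n..}" for y n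
      using ds_smult_homogeneous[OF m(2) _ that, of "{n + 1..}"] m Rg by auto
    then show "s \<in> ?J" using m Rg by auto
  qed
  ultimately have "genideal R (\<Union>n\<in>{0<..}. Rg n) \<subseteq> ?J" by (rule R.genideal_minimal)
  then show ?thesis using x y by blast
qed

lemma degree_span_map:
  assumes M: "graded R M Rg Mg" and N: "graded R N Rg Ng" and f: "f \<in> linear_hom R M N"
    and e: "\<And>n. f ` Mg n \<subseteq> Ng (n + e)" and x: "x \<in> degree_span M Mg K" and K: "\<And>n. n \<in> K \<Longrightarrow> n + e \<in> K'"
  shows "f x \<in> degree_span N Ng K'"
proof -
  interpret M: graded R M Rg Mg by fact
  interpret N: graded R N Rg Ng by fact
  show ?thesis using x
  proof (rule M.ds_induct)
    show "f \<zero>\<^bsub>M\<^esub> \<in> degree_span N Ng K'"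
      using linear_hom_zero[OF M.module_axioms N.module_axioms f] N.ds_zero by simp
    show "f y \<in> degree_span N Ng K'" if "n \<in> K" "y \<in> Mg n" for n y
      using e K that by (intro N.ds_single[of _ "n + e"]) auto
    show "f (x \<oplus>\<^bsub>M\<^esub> y) \<in> degree_span N Ng K'"
      if "x \<in> carrier M" "y \<in> carrier M" "f x \<in> degree_span N Ng K'" "f y \<in> degree_span N Ng K'" for x y
      using that N.ds_add linear_homD(2)[OF f] by simp
  qed
qed

text \<open>
  The coboundaries form a graded submodule because the differential is homogeneous: the preimage is split at
  the degree shifted by that of the differential.
\<close>

lemma graded_coboundary_split:
  assumes C: "cochain_complex R C \<delta>" and gr: "\<And>i. graded R (C i) Rg (Cg i)"
    and hom: "\<And>i. homogeneous_map (Cg i) (Cg (Suc i)) (\<delta> i)" and b: "b \<in> coboundaries C \<delta> i"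
  shows "\<exists>u v. u \<in> coboundaries C \<delta> i \<and> u \<in> degree_span (C i) (Cg i) {..<n} \<and>
    v \<in> degree_span (C i) (Cg i) {n..} \<and> b = u \<oplus>\<^bsub>C i\<^esub> v"
proof (cases i)
  case 0
  interpret M: graded R "C 0" Rg "Cg 0" by (rule gr)
  show ?thesis using b 0 M.ds_zero by (intro exI[of _ "\<zero>\<^bsub>C 0\<^esub>"]) (auto simp: coboundaries_def)
next
  case (Suc k)
  interpret K: graded R "C k" Rg "Cg k" by (rule gr)
  interpret M: graded R "C (Suc k)" Rg "Cg (Suc k)" by (rule gr)
  have d: "\<delta> k \<in> linear_hom R (C k) (C (Suc k))" using C by (simp add: cochain_complex_def)
  obtain e where e: "\<And>n. \<delta> k ` Cg k n \<subseteq> Cg (Suc k) (n + e)" using hom[of k] by (auto simp: homogeneous_map_def)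
  obtain a where a: "a \<in> carrier (C k)" "b = \<delta> k a" using b Suc by (auto simp: coboundaries_def)
  obtain u v where uv: "u \<in> degree_span (C k) (Cg k) {..<n - e}" "v \<in> degree_span (C k) (Cg k) (- {..<n - e})"
    "a = u \<oplus>\<^bsub>C k\<^esub> v" using K.ds_split[OF a(1)] by blast
  have c: "u \<in> carrier (C k)" "v \<in> carrier (C k)" using uv K.ds_carrier by auto
  have "\<delta> k u \<in> degree_span (C (Suc k)) (Cg (Suc k)) {..<n}"
    by (rule degree_span_map[OF gr gr d e uv(1)]) auto
  moreover have "\<delta> k v \<in> degree_span (C (Suc k)) (Cg (Suc k)) {n..}"
    by (rule degree_span_map[OF gr gr d e uv(2)]) auto
  moreover have "b = \<delta> k u \<oplus>\<^bsub>C (Suc k)\<^esub> \<delta> k v" using a uv c linear_homD(2)[OF d] by simp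
  moreover have "\<delta> k u \<in> coboundaries C \<delta> (Suc k)" using c by (auto simp: coboundaries_def)
  ultimately show ?thesis using Suc by blast
qed

theorem corollary1p12:
  fixes G :: "('k::{field,finite} ^ 'n::finite ^ 'n) set"
    and E :: "nat \<Rightarrow> (('n, 'k) mpoly, 'e) module"
    and \<epsilon> :: "('n, 'k) mpoly \<Rightarrow> 'e"
    and dE :: "nat \<Rightarrow> 'e \<Rightarrow> 'e"
    and a :: "nat \<Rightarrow> nat"
    and C :: "nat \<Rightarrow> (('n, 'k) mpoly, 'c) module"
    and Cg :: "nat \<Rightarrow> int \<Rightarrow> 'c set"
    and \<delta> :: "nat \<Rightarrow> 'c \<Rightarrow> 'c"
    and r :: nat
  assumes "CARD('n) \<ge> 3"
    and "subgroup G GL"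
    and "injective_resolution (invariant_ring G) (regular_module (invariant_ring G)) E \<epsilon> dE"
    and "\<forall>j<CARD('n).
           dickson_ideal G [^]\<^bsub>ideals_set (invariant_ring G)\<^esub> a j
             \<subseteq> annihilator (invariant_ring G)
                 (local_cohomology (invariant_ring G) (irrelevant_ideal G) E dE j)
           \<and> (\<forall>m<a j. \<not> dickson_ideal G [^]\<^bsub>ideals_set (invariant_ring G)\<^esub> m
             \<subseteq> annihilator (invariant_ring G)
                 (local_cohomology (invariant_ring G) (irrelevant_ideal G) E dE j))"
    and "cochain_complex (invariant_ring G) C \<delta>"
    and "\<forall>i>r. carrier (C i) = {\<zero>\<^bsub>C i\<^esub>}"
    and "\<forall>i. free_graded_module (invariant_ring G) (invariant_degree G) (C i) (Cg i)"
    and "\<forall>i. homogeneous_map (Cg i) (Cg (Suc i)) (\<delta> i)"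
    and "\<forall>i. finite_length (invariant_ring G) (cohomology C \<delta> i)"
  shows "\<forall>i<CARD('n).
           finprod (ideals_set (invariant_ring G))
             (\<lambda>j. dickson_ideal G [^]\<^bsub>ideals_set (invariant_ring G)\<^esub> a j) {..i}
           \<subseteq> annihilator (invariant_ring G) (cohomology C \<delta> i)"
proof (intro allI impI)
  fix i assume i: "i < CARD('n)"
  let ?S = "invariant_ring G"
  have G: "g \<in> G \<Longrightarrow> invertible g" for g
    using subgroup.subset[OF assms(2)] by (auto simp: GL_def)
  have S: "cring ?S" unfolding invariant_ring_eq by (rule ring_on_cring[OF invariants_subring])
  interpret S: cring ?S by (rule S)
  have noeth: "noetherian_ring ?S" by (rule invariant_ring_noetherian[OF G])
  have Sg: "invariant_degree G n \<subseteq> carrier ?S" for n by (auto simp: invariant_degree_def)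
  have I0: "ideal (irrelevant_ideal G) ?S"
    unfolding irrelevant_ideal_def using Sg by (intro S.genideal_ideal) auto
  obtain X where X: "X \<subseteq> carrier ?S" "finite X" "irrelevant_ideal G = genideal ?S X"
    using noetherian_ring.finetely_gen[OF noeth I0] by auto
  have XI: "X \<subseteq> irrelevant_ideal G" unfolding X(3) by (rule S.genideal_self[OF X(1)])
  have dickson: "ideal (dickson_ideal G) ?S"
    unfolding dickson_ideal_def using dickson_invariant[OF G] by (intro S.genideal_ideal) auto
  \<comment> \<open>Beyond the dimension the zero ideal serves as an annihilator, so that there is one for every degree.\<close>
  define A where "A = (\<lambda>j. if j < CARD('n) then dickson_ideal G [^]\<^bsub>ideals_set ?S\<^esub> a j else {\<zero>\<^bsub>?S\<^esub>})"
  have A: "ideal (A j) ?S" for j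
    unfolding A_def using S.ideal_pow_ideal[OF dickson] S.zeroideal by simp
  have E: "cochain_complex ?S E dE" using assms(3) by (simp add: injective_resolution_def)
  have A_ann: "A j \<subseteq> annihilator ?S (local_cohomology ?S (genideal ?S X) E dE j)" for j
  proof (cases "j < CARD('n)")
    case True
    then show ?thesis using assms(4) by (simp add: A_def X(3)[symmetric])
  next
    case False
    let ?T = "\<lambda>p. (E p)\<lparr>carrier := torsion_submodule ?S (irrelevant_ideal G) (E p)\<rparr>"
    have T: "cochain_complex ?S ?T dE" by (rule torsion_complex[OF E I0])
    have Tm: "module ?S (?T j)" using T by (simp add: cochain_complex_def)
    have "\<zero>\<^bsub>?S\<^esub> \<odot>\<^bsub>?T j\<^esub> z \<in> coboundaries ?T dE j" if "z \<in> cocycles ?T dE j" for z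
      using that module.smult_l_null[OF Tm] module.submodule_zero[OF Tm coboundaries_submodule(1)[OF T]]
      by (auto simp: cocycles_iff)
    then show ?thesis
      unfolding A_def local_cohomology_def X(3)[symmetric] using False
      by (simp add: annihilator_cohomology_iff[OF T])
  qed
  have gr: "graded ?S (C i) (invariant_degree G) (Cg i)" for i
    using assms(7) unfolding graded_def graded_axioms_def free_graded_module_def graded_module_def by blast
  have Cc: "cochain_complex ?S C \<delta>" by (rule assms(5))
  have "\<exists>B. module_basis ?S (C i) B" for i
    using assms(7) unfolding free_graded_module_def by blast
  then obtain B where B: "\<And>i. module_basis ?S (C i) (B i)" by metis
  have nil: "\<exists>N::nat. \<forall>z\<in>cocycles C \<delta> i. x [^]\<^bsub>?S\<^esub> N \<odot>\<^bsub>C i\<^esub> z \<in> coboundaries C \<delta> i" if x: "x \<in> X" for i x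
  proof -
    interpret M: graded ?S "C i" "invariant_degree G" "Cg i" by (rule gr)
    have up: "s \<odot>\<^bsub>C i\<^esub> y \<in> M.ds {n..}" if s: "s \<in> carrier ?S" and y: "y \<in> M.ds {n..}" for s y n
    proof (rule M.ds_smult[OF _ y])
      fix P assume P: "P \<zero>\<^bsub>?S\<^esub>" "\<And>m s. s \<in> invariant_degree G m \<Longrightarrow> s \<in> carrier ?S \<Longrightarrow> P s"
        "\<And>s t. s \<in> carrier ?S \<Longrightarrow> t \<in> carrier ?S \<Longrightarrow> P s \<Longrightarrow> P t \<Longrightarrow> P (s \<oplus>\<^bsub>?S\<^esub> t)"
      show "P s"
      proof (rule invariant_ring_graded_induct[OF s])
        show "P 0" using P(1) by (simp add: invariant_ring_eq)
        show "\<And>n s. s \<in> invariant_degree G n \<Longrightarrow> P s" using P(2) Sg by blast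
        show "\<And>s t. s \<in> carrier ?S \<Longrightarrow> t \<in> carrier ?S \<Longrightarrow> P s \<Longrightarrow> P t \<Longrightarrow> P (s + t)"
          using P(3) by (simp add: invariant_ring_eq)
      qed
    qed
    have xI: "x \<in> genideal ?S (\<Union>n\<in>{0<..}. invariant_degree G n)"
      using x XI by (auto simp: irrelevant_ideal_def)
    show ?thesis
    proof (rule M.finite_length_imp_nilpotent[OF cocycles_submodule[OF Cc] coboundaries_submodule[OF Cc]])
      show "finite_length ?S (quotient_module ((C i)\<lparr>carrier := cocycles C \<delta> i\<rparr>) (coboundaries C \<delta> i))"
        using assms(9) by (simp add: cohomology_def)
      show "\<exists>u v. u \<in> coboundaries C \<delta> i \<and> u \<in> M.ds {..<n} \<and> v \<in> M.ds {n..} \<and> b = u \<oplus>\<^bsub>C i\<^esub> v"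
        if "b \<in> coboundaries C \<delta> i" for n b
        by (rule graded_coboundary_split[OF Cc gr _ that]) (use assms(8) in blast)
      show "x \<odot>\<^bsub>C i\<^esub> y \<in> M.ds {n + 1..}" if "y \<in> M.ds {n..}" for n y
        by (rule M.irrelevant_raises_degree[OF up Sg xI that])
    qed (use x X(1) up in auto)
  qed
  have "ideal_prod_from ?S A i 0 \<subseteq> annihilator ?S (cohomology C \<delta> i)"
  proof (rule cohomology_annihilated_by_local_cohomology_annihilators[OF S noeth _ assms(3) X(2,1) A A_ann Cc _ B nil])
    show "\<one>\<^bsub>?S\<^esub> \<noteq> \<zero>\<^bsub>?S\<^esub>" by (simp add: invariant_ring_eq)
    show "carrier (C j) = {\<zero>\<^bsub>C j\<^esub>}" if "j > r" for j using assms(6) that by blast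
  qed
  moreover have "finprod (ideals_set ?S) (\<lambda>j. dickson_ideal G [^]\<^bsub>ideals_set ?S\<^esub> a j) {..i} = ideal_prod_from ?S A i 0"
  proof -
    interpret I: comm_monoid "ideals_set ?S" by (rule S.ideals_set_is_comm_monoid)
    have "finprod (ideals_set ?S) (\<lambda>j. dickson_ideal G [^]\<^bsub>ideals_set ?S\<^esub> a j) {..i} = finprod (ideals_set ?S) A {..i}"
      using A i by (intro I.finprod_cong') (auto simp: A_def ideals_set_def)
    also have "\<dots> = ideal_prod_from ?S A i 0"
      using S.finprod_ideals_eq[of A 0 i, OF A] by (simp add: atMost_atLeast0)
    finally show ?thesis .
  qed
  ultimately show "finprod (ideals_set ?S) (\<lambda>j. dickson_ideal G [^]\<^bsub>ideals_set ?S\<^esub> a j) {..i}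
      \<subseteq> annihilator ?S (cohomology C \<delta> i)" by simp
qed

end
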